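(* Let $\psi\in\mathcal S(\mathbb R^n)$ with $\psi(0)=1$, let $M$ be a weight, and put $\psi_k(\xi)=\psi(2^{-kM}\xi)$. If $u,v\in\mathcal S'(\mathbb R^n)$ and $\Omega\subset\mathbb R^n$ is an open set such that either $r_\Omega u=0$ or $r_\Omega v=0$, then $$r_\Omega\big(\mathcal F^{-1}(\psi_k\mathcal Fu)\cdot\mathcal F^{-1}(\psi_k\mathcal Fv)\big)\to0\quad\text{in }\mathcal D'(\Omega)\text{ for }k\to\infty.$$ In particular, $r_\Omega\pi(u,v)=0$ when $\pi(u,v)$ is defined.
   Context: A weight is $M=(m_1,\dots,m_n)$ with $m_j\ge1$ and $\min_j m_j=1$; $2^{-kM}x=(2^{-km_1}x_1,\dots,2^{-km_n}x_n)$. $r_\Omega\colon\mathcal D'(\mathbb R^n)\to\mathcal D'(\Omega)$ is restriction to $\Omega$. Product $\pi$ (for the given weight $M$). For $\psi\in C_0^\infty(\mathbb R^n)$ equal to $1$ in a neighbourhood of $0$, let $\psi_k(\xi)=\psi(2^{-kM}\xi)$ and, for $u,v\in\mathcal S'(\mathbb R^n)$, $\pi_\psi(u,v)=\lim_{k\to\infty}\mathcal F^{-1}(\psi_k\mathcal Fu)\cdot\mathcal F^{-1}(\psi_k\mathcal Fv)$ when the limit exists in $\mathcal D'(\mathbb R^n)$. $\pi(u,v):=\pi_\psi(u,v)$ when $\pi_\psi(u,v)$ exists for all such $\psi$ and is independent of $\psi$. *)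

theory Defs
  imports "HOL-Analysis.Analysis"
begin

type_synonym 'n cfun = "(real, 'n) vec \<Rightarrow> complex"
type_synonym 'n functional = "'n cfun \<Rightarrow> complex"

text \<open>A derivative of order \<open>k\<close> is indexed by the list of the \<open>k\<close> coordinate directions in
  which one differentiates, instead of by a multi-index.\<close>

primrec iter_partial :: "'n list \<Rightarrow> 'n::finite cfun \<Rightarrow> 'n cfun" where
  "iter_partial [] f = f"
| "iter_partial (j # js) f = (\<lambda>x. frechet_derivative (iter_partial js f) (at x) (axis j 1))"

text \<open>If all iterated partial derivatives are Frechet differentiable, they are in particular
  continuous, so the following is \<open>C\<^sup>\<infinity>(\<real>\<^sup>n)\<close>.\<close>

definition smooth :: "'n::finite cfun \<Rightarrow> bool" where
  "smooth f \<longleftrightarrow> (\<forall>js x. iter_partial js f differentiable (at x))"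

definition supp :: "'n::finite cfun \<Rightarrow> (real, 'n) vec set" where
  "supp f = closure {x. f x \<noteq> 0}"

text \<open>\<open>C\<^sub>0\<^sup>\<infinity>(\<Omega>)\<close>; its members are extended by zero to \<open>\<real>\<^sup>n\<close>.\<close>

definition test_functions :: "(real, 'n::finite) vec set \<Rightarrow> 'n cfun set" where
  "test_functions \<Omega> = {\<phi>. smooth \<phi> \<and> compact (supp \<phi>) \<and> supp \<phi> \<subseteq> \<Omega>}"

definition schwartz :: "'n::finite cfun set" where
  "schwartz = {f. smooth f \<and>
     (\<forall>js N. \<exists>B. \<forall>x. (1 + norm x) ^ N * norm (iter_partial js f x) \<le> B)}"

definition test_norm :: "nat \<Rightarrow> 'n::finite cfun \<Rightarrow> real" where
  "test_norm N f = (SUP (js, x) \<in> {js. length js \<le> N} \<times> UNIV. norm (iter_partial js f x))"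

definition schwartz_norm :: "nat \<Rightarrow> 'n::finite cfun \<Rightarrow> real" where
  "schwartz_norm N f =
     (SUP (js, x) \<in> {js. length js \<le> N} \<times> UNIV. (1 + norm x) ^ N * norm (iter_partial js f x))"

text \<open>A functional on a space of test functions is represented by a function on all of
  \<open>'n cfun\<close> that vanishes outside that space. With this convention, equality of
  distributions is HOL equality.\<close>

definition linear_functional_on :: "'n::finite cfun set \<Rightarrow> 'n functional \<Rightarrow> bool" where
  "linear_functional_on V u \<longleftrightarrow>
     (\<forall>f\<in>V. \<forall>g\<in>V. u (\<lambda>x. f x + g x) = u f + u g) \<and>
     (\<forall>c. \<forall>f\<in>V. u (\<lambda>x. c * f x) = c * u f) \<and>
     (\<forall>f. f \<notin> V \<longrightarrow> u f = 0)"

definition distributions :: "(real, 'n::finite) vec set \<Rightarrow> 'n functional set" where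
  "distributions \<Omega> = {u. linear_functional_on (test_functions \<Omega>) u \<and>
     (\<forall>K. compact K \<and> K \<subseteq> \<Omega> \<longrightarrow>
        (\<exists>C N. \<forall>\<phi>\<in>test_functions \<Omega>. supp \<phi> \<subseteq> K \<longrightarrow> norm (u \<phi>) \<le> C * test_norm N \<phi>))}"

definition tempered_distributions :: "'n::finite functional set" where
  "tempered_distributions = {u. linear_functional_on schwartz u \<and>
     (\<exists>C N. \<forall>f\<in>schwartz. norm (u f) \<le> C * schwartz_norm N f)}"

text \<open>The restriction \<open>r\<^sub>\<Omega>\<close>. Applied to a tempered distribution it includes the
  embedding of \<open>\<S>'(\<real>\<^sup>n)\<close> into \<open>\<D>'(\<real>\<^sup>n)\<close>.\<close>

definition restr :: "(real, 'n::finite) vec set \<Rightarrow> 'n functional \<Rightarrow> 'n functional" where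
  "restr \<Omega> u = (\<lambda>\<phi>. if \<phi> \<in> test_functions \<Omega> then u \<phi> else 0)"

definition converges_in_distributions ::
    "(real, 'n::finite) vec set \<Rightarrow> (nat \<Rightarrow> 'n functional) \<Rightarrow> 'n functional \<Rightarrow> bool" where
  "converges_in_distributions \<Omega> w w0 \<longleftrightarrow>
     (\<forall>k. w k \<in> distributions \<Omega>) \<and> w0 \<in> distributions \<Omega> \<and>
     (\<forall>\<phi>\<in>test_functions \<Omega>. (\<lambda>k. w k \<phi>) \<longlonglongrightarrow> w0 \<phi>)"

definition fun_distribution :: "'n::finite cfun \<Rightarrow> 'n functional" where
  "fun_distribution f =
     (\<lambda>\<phi>. if \<phi> \<in> test_functions UNIV then (LINT x|lborel. f x * \<phi> x) else 0)"

text \<open>The continuous function with which a distribution is identified; there is at most one, and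
  the value is meaningful only if there is one.\<close>

definition fun_of :: "'n::finite functional \<Rightarrow> 'n cfun" where
  "fun_of u = (THE f. continuous_on UNIV f \<and> restr UNIV u = fun_distribution f)"

definition fourier :: "'n::finite cfun \<Rightarrow> 'n cfun" where
  "fourier f = (\<lambda>\<xi>. LINT x|lborel. cis (- (x \<bullet> \<xi>)) * f x)"

definition fourier_inv :: "'n::finite cfun \<Rightarrow> 'n cfun" where
  "fourier_inv f =
     (\<lambda>x. of_real (1 / (2 * pi) ^ CARD('n)) * (LINT \<xi>|lborel. cis (x \<bullet> \<xi>) * f \<xi>))"

definition fourier_dist :: "'n::finite functional \<Rightarrow> 'n functional" where
  "fourier_dist u = (\<lambda>f. if f \<in> schwartz then u (fourier f) else 0)"

definition fourier_inv_dist :: "'n::finite functional \<Rightarrow> 'n functional" where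
  "fourier_inv_dist u = (\<lambda>f. if f \<in> schwartz then u (fourier_inv f) else 0)"

definition mult_dist :: "'n::finite cfun \<Rightarrow> 'n functional \<Rightarrow> 'n functional" where
  "mult_dist \<psi> u = (\<lambda>f. if f \<in> schwartz then u (\<lambda>x. \<psi> x * f x) else 0)"

definition weight :: "(real, 'n::finite) vec \<Rightarrow> bool" where
  "weight M \<longleftrightarrow> (\<forall>j. 1 \<le> M $ j) \<and> Min (range (\<lambda>j. M $ j)) = 1"

text \<open>\<open>dilate M k x\<close> is \<open>2\<close> to the power \<open>-kM\<close>, applied to \<open>x\<close>.\<close>

definition dilate :: "(real, 'n::finite) vec \<Rightarrow> nat \<Rightarrow> (real, 'n) vec \<Rightarrow> (real, 'n) vec" where
  "dilate M k x = (\<chi> j. 2 powr (- (real k * M $ j)) * x $ j)"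

text \<open>\<open>u\<^sub>k = \<F>\<^sup>-\<^sup>1(\<psi>\<^sub>k \<F>u)\<close> with \<open>\<psi>\<^sub>k = \<psi> \<circ> dilate M k\<close>. For a Schwartz function \<open>\<psi>\<close> this is a
  \<open>C\<^sup>\<infinity>\<close> function, which is what makes the pointwise product below meaningful.\<close>

definition smoothing ::
    "(real, 'n::finite) vec \<Rightarrow> 'n cfun \<Rightarrow> nat \<Rightarrow> 'n functional \<Rightarrow> 'n functional" where
  "smoothing M \<psi> k u = fourier_inv_dist (mult_dist (\<lambda>\<xi>. \<psi> (dilate M k \<xi>)) (fourier_dist u))"

definition approx_prod ::
    "(real, 'n::finite) vec \<Rightarrow> 'n cfun \<Rightarrow> 'n functional \<Rightarrow> 'n functional \<Rightarrow> nat \<Rightarrow> 'n functional"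
  where
  "approx_prod M \<psi> u v k =
     fun_distribution (\<lambda>x. fun_of (smoothing M \<psi> k u) x * fun_of (smoothing M \<psi> k v) x)"

definition cutoffs :: "'n::finite cfun set" where
  "cutoffs = {\<psi> \<in> test_functions UNIV. \<forall>\<^sub>F \<xi> in nhds 0. \<psi> \<xi> = 1}"

definition prod_psi_exists ::
    "(real, 'n::finite) vec \<Rightarrow> 'n cfun \<Rightarrow> 'n functional \<Rightarrow> 'n functional \<Rightarrow> bool" where
  "prod_psi_exists M \<psi> u v \<longleftrightarrow>
     (\<exists>w. converges_in_distributions UNIV (approx_prod M \<psi> u v) w)"

definition prod_psi ::
    "(real, 'n::finite) vec \<Rightarrow> 'n cfun \<Rightarrow> 'n functional \<Rightarrow> 'n functional \<Rightarrow> 'n functional" where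
  "prod_psi M \<psi> u v = (THE w. converges_in_distributions UNIV (approx_prod M \<psi> u v) w)"

definition prod_defined ::
    "(real, 'n::finite) vec \<Rightarrow> 'n functional \<Rightarrow> 'n functional \<Rightarrow> bool" where
  "prod_defined M u v \<longleftrightarrow>
     (\<forall>\<psi>\<in>cutoffs. prod_psi_exists M \<psi> u v) \<and>
     (\<forall>\<psi>\<in>cutoffs. \<forall>\<psi>'\<in>cutoffs. prod_psi M \<psi> u v = prod_psi M \<psi>' u v)"

definition prod_pi ::
    "(real, 'n::finite) vec \<Rightarrow> 'n functional \<Rightarrow> 'n functional \<Rightarrow> 'n functional" where
  "prod_pi M u v = (THE w. \<forall>\<psi>\<in>cutoffs. prod_psi M \<psi> u v = w)"

end

theory Submission
  imports Defs "HOL-Probability.Sinc_Integral" "HOL-Probability.Characteristic_Functions"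
begin

text \<open>The \<open>k\<close>-th regularisation of \<open>u\<close> is the function \<open>u\<^sub>k(x) = u(\<Phi>\<^sub>k(x - \<cdot>))\<close>, where \<open>\<Phi>\<^sub>k\<close> is the inverse
  Fourier transform of \<open>\<psi>\<^sub>k\<close>, that is, an anisotropic dilation of the fixed Schwartz function
  \<open>\<Phi> = \<F>\<^sup>-\<^sup>1\<psi>\<close>. Since a tempered distribution is bounded by a seminorm of finite order, \<open>u\<^sub>k\<close> grows
  at most like a fixed power of \<open>2\<^sup>k\<close> on compact sets. If \<open>u\<close> vanishes on \<open>\<Omega>\<close> and \<open>K \<subseteq> \<Omega>\<close> is compact, then
  for \<open>x \<in> K\<close> only the part of \<open>\<Phi>\<^sub>k(x - \<cdot>)\<close> at a fixed distance from \<open>x\<close> matters, and there the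
  rapid decrease of \<open>\<Phi>\<close> beats every power of \<open>2\<^sup>k\<close>. Hence \<open>u\<^sub>k v\<^sub>k\<close> tends to zero uniformly on \<open>K\<close>.\<close>

section \<open>Iterated partial derivatives\<close>

text \<open>The product is formed through \<open>fun_of\<close>, a definite description, so each
  regularisation has to be shown to be given by a continuous function, and that function to be
  unique. Its formula requires moving \<open>u\<close> inside an integral against a test function,
  which is done by approximation in a seminorm that bounds \<open>u\<close>. The anisotropy enters
  the estimates only through bounds for the dilation factors C_j = 2^(k M_j). Put t = 2^k. Since
  every M_j is at least 1, C_j \<ge> t, and this drives the decay; an integer m that is at least
  every M_j gives C_j \<le> t^m, and this limits the growth. The power of the upper bound in the
  estimates comes from the dimension and the order of the distribution, not from the decay that is
  sought. The order of decay can therefore be prescribed after the growth exponents of both factors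
  are known, although t^m may be much larger than t.\<close>

definition partial :: "'n \<Rightarrow> 'n::finite cfun \<Rightarrow> 'n cfun" where
  "partial j f = (\<lambda>x. frechet_derivative f (at x) (axis j 1))"

lemma iter_partial_Cons: "iter_partial (j # js) f = partial j (iter_partial js f)"
  by (simp add: partial_def)

lemma iter_partial_append: "iter_partial (js @ ks) f = iter_partial js (iter_partial ks f)"
  by (induction js) auto

lemma iter_partial_snoc: "iter_partial (js @ [j]) f = iter_partial js (partial j f)"
  by (simp add: iter_partial_append partial_def)

lemma partial_eqI: "(f has_derivative f') (at x) \<Longrightarrow> partial j f x = f' (axis j 1)"
  by (simp add: partial_def frechet_derivative_at[symmetric])

lemma smooth_iter_partial: "smooth f \<Longrightarrow> smooth (iter_partial js f)"
  unfolding smooth_def by (metis iter_partial_append)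

lemma smooth_partial: "smooth f \<Longrightarrow> smooth (partial j f)"
  using smooth_iter_partial[of f "[j]"] by (simp add: partial_def)

lemma smooth_differentiable: "smooth f \<Longrightarrow> f differentiable (at x)"
  unfolding smooth_def by (metis iter_partial.simps(1))

lemma smooth_has_derivative: "smooth f \<Longrightarrow> (f has_derivative frechet_derivative f (at x)) (at x)"
  by (simp add: smooth_differentiable frechet_derivative_works[symmetric])

lemma smooth_continuous_on: "smooth f \<Longrightarrow> continuous_on S f"
  by (meson continuous_at_imp_continuous_on differentiable_imp_continuous_within smooth_differentiable)

lemma smooth_measurable: "smooth f \<Longrightarrow> f \<in> borel_measurable borel"
  by (simp add: borel_measurable_continuous_onI smooth_continuous_on)

lemma frechet_derivative_sum_partial:
  fixes f :: "'n::finite cfun"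
  assumes "f differentiable (at x)"
  shows "frechet_derivative f (at x) h = (\<Sum>j\<in>UNIV. h $ j *\<^sub>R partial j f x)"
proof -
  interpret linear "frechet_derivative f (at x)"
    using assms by (rule linear_frechet_derivative)
  have "h = (\<Sum>j\<in>UNIV. h $ j *\<^sub>R axis j 1)"
    by (simp add: basis_expansion scalar_mult_eq_scaleR[symmetric])
  then show ?thesis
    unfolding partial_def by (metis (no_types, lifting) scale sum sum.cong)
qed

section \<open>Calculus rules and a criterion for smoothness\<close>

lemma partial_const: "partial j (\<lambda>x. c) = (\<lambda>x. 0)"
  by (rule ext, rule partial_eqI[THEN trans], rule derivative_intros, simp)

lemma partial_add:
  assumes "\<And>x. f differentiable (at x)" "\<And>x. g differentiable (at x)"
  shows "partial j (\<lambda>x. f x + g x) = (\<lambda>x. partial j f x + partial j g x)"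
  by (rule ext, subst partial_eqI[OF has_derivative_add[OF assms[THEN frechet_derivative_works[THEN iffD1]]]])
     (simp add: partial_def)

lemma partial_mult:
  assumes "\<And>x. f differentiable (at x)" "\<And>x. g differentiable (at x)"
  shows "partial j (\<lambda>x. f x * g x) = (\<lambda>x. f x * partial j g x + partial j f x * g x)"
  by (rule ext, subst partial_eqI[OF has_derivative_mult[OF assms[THEN frechet_derivative_works[THEN iffD1]]]])
     (simp add: partial_def)

text \<open>Smoothness of a function is proved by exhibiting generators whose first derivatives are
  polynomials in the generators; this set supplies those polynomials. Scalars have no rule of their
  own: a constant factor is a product with a constant function, which the generators have to
  provide.\<close>

inductive_set algebra_hull :: "'n::finite cfun set \<Rightarrow> 'n cfun set" for G where
  base: "g \<in> G \<Longrightarrow> g \<in> algebra_hull G"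
| add: "f \<in> algebra_hull G \<Longrightarrow> g \<in> algebra_hull G \<Longrightarrow> (\<lambda>x. f x + g x) \<in> algebra_hull G"
| mult: "f \<in> algebra_hull G \<Longrightarrow> g \<in> algebra_hull G \<Longrightarrow> (\<lambda>x. f x * g x) \<in> algebra_hull G"

text \<open>A coinduction principle: by the sum and product rules the hull is closed under partial
  derivatives as soon as the derivatives of the generators lie in it.\<close>

lemma smooth_algebra_hull:
  assumes "\<And>g x. g \<in> G \<Longrightarrow> g differentiable (at x)"
    and "\<And>g j. g \<in> G \<Longrightarrow> partial j g \<in> algebra_hull G"
    and "f \<in> algebra_hull G"
  shows "smooth f"
proof -
  have diff: "g differentiable (at x)" if "g \<in> algebra_hull G" for g x
    using that by induction (auto intro: assms(1) differentiable_add differentiable_mult)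
  have clos: "partial j g \<in> algebra_hull G" if "g \<in> algebra_hull G" for g j
    using that
  proof induction
    case (base g)
    then show ?case by (rule assms(2))
  next
    case (add f g)
    then show ?case
      by (subst partial_add) (auto intro: diff algebra_hull.add)
  next
    case (mult f g)
    then show ?case
      by (subst partial_mult) (auto intro!: diff algebra_hull.add algebra_hull.mult)
  qed
  have "iter_partial js f \<in> algebra_hull G" for js
    by (induction js) (simp_all add: assms(3) iter_partial_Cons clos del: iter_partial.simps(2))
  then show ?thesis
    unfolding smooth_def using diff by blast
qed

text \<open>All smooth functions together serve as generators. Their derivatives are generators
  again, so the sums and products that the hull adds are smooth as well.\<close>

lemma
  assumes "smooth f" "smooth g"
  shows smooth_add: "smooth (\<lambda>x. f x + g x)"
    and smooth_mult: "smooth (\<lambda>x. f x * g x)"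
  by (rule smooth_algebra_hull[of "Collect smooth"];
      auto intro: algebra_hull.intros smooth_differentiable smooth_partial assms)+

lemma smooth_const: "smooth (\<lambda>x. c)"
  by (rule smooth_algebra_hull[of "range (\<lambda>c x. c)"])
     (auto simp: partial_const intro: algebra_hull.base)

lemma has_derivative_component:
  "((\<lambda>x. complex_of_real (x $ i)) has_derivative (\<lambda>h. complex_of_real (h $ i))) (at x)"
  by (auto intro!: derivative_eq_intros bounded_linear_imp_has_derivative bounded_linear_vec_nth
      has_derivative_of_real)

lemma partial_component: "partial j (\<lambda>x. complex_of_real (x $ i)) = (\<lambda>x. if i = j then 1 else 0)"
  by (rule ext, subst partial_eqI[OF has_derivative_component]) (simp add: axis_def)

lemma smooth_component: "smooth (\<lambda>x. complex_of_real (x $ i))"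
proof (rule smooth_algebra_hull[of "Collect smooth \<union> {\<lambda>x. complex_of_real (x $ i)}"])
  fix g :: "'a cfun" and x
  assume "g \<in> Collect smooth \<union> {\<lambda>x. complex_of_real (x $ i)}"
  then show "g differentiable (at x)"
    using has_derivative_component[of i x]
    by (auto intro: smooth_differentiable differentiableI)
next
  fix g :: "'a cfun" and j
  assume "g \<in> Collect smooth \<union> {\<lambda>x. complex_of_real (x $ i)}"
  then show "partial j g \<in> algebra_hull (Collect smooth \<union> {\<lambda>x. complex_of_real (x $ i)})"
    by (auto simp: smooth_partial partial_component smooth_const intro!: algebra_hull.base)
qed (auto intro: algebra_hull.base)

lemma smooth_cmult: "smooth f \<Longrightarrow> smooth (\<lambda>x. c * f x)"
  by (rule smooth_mult[OF smooth_const])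

lemma smooth_diff: "smooth f \<Longrightarrow> smooth g \<Longrightarrow> smooth (\<lambda>x. f x - g x)"
  using smooth_add[OF _ smooth_cmult[of g "-1"]] by simp

lemma iter_partial_add:
  assumes "smooth f" "smooth g"
  shows "iter_partial js (\<lambda>x. f x + g x) = (\<lambda>x. iter_partial js f x + iter_partial js g x)"
  by (induction js)
     (simp_all add: iter_partial_Cons partial_add smooth_differentiable smooth_iter_partial assms
       del: iter_partial.simps(2))

lemma iter_partial_cmult:
  assumes "smooth f"
  shows "iter_partial js (\<lambda>x. c * f x) = (\<lambda>x. c * iter_partial js f x)"
  by (induction js)
     (simp_all add: iter_partial_Cons partial_mult partial_const smooth_differentiable
       smooth_iter_partial assms del: iter_partial.simps(2))

lemma iter_partial_diff:
  assumes "smooth f" "smooth g"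
  shows "iter_partial js (\<lambda>x. f x - g x) = (\<lambda>x. iter_partial js f x - iter_partial js g x)"
  using iter_partial_add[OF assms(1) smooth_cmult[OF assms(2), of "-1"], of js]
  by (simp only: iter_partial_cmult[OF assms(2)]) simp

text \<open>The Leibniz rule without multinomials: each derivative doubles the number of terms, and
  every term is a product of derivatives of order at most \<open>length js\<close>. The induction
  peels off the innermost direction, which acts on the product itself and leaves two new products;
  hence \<open>f\<close> and \<open>g\<close> are arbitrary.\<close>

lemma norm_iter_partial_mult_le:
  assumes "smooth f" "smooth g"
    and "\<And>ks. length ks \<le> length js \<Longrightarrow> norm (iter_partial ks f x) \<le> a"
    and "\<And>ks. length ks \<le> length js \<Longrightarrow> norm (iter_partial ks g x) \<le> b"
  shows "norm (iter_partial js (\<lambda>x. f x * g x) x) \<le> 2 ^ length js * a * b"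
  using assms
proof (induction js arbitrary: f g rule: rev_induct)
  case Nil
  then show ?case
    using Nil(3,4)[of "[]"] by (auto simp: norm_mult intro!: mult_mono intro: order_trans[OF norm_ge_zero])
next
  case (snoc j js)
  have *: "norm (iter_partial ks (partial j f) x) \<le> a"
          "norm (iter_partial ks (partial j g) x) \<le> b" if "length ks \<le> length js" for ks
    using snoc.prems(3,4)[of "ks @ [j]"] that by (simp_all add: iter_partial_snoc)
  have "norm (iter_partial js (\<lambda>x. f x * partial j g x) x) \<le> 2 ^ length js * a * b"
       "norm (iter_partial js (\<lambda>x. partial j f x * g x) x) \<le> 2 ^ length js * a * b"
    by (rule snoc.IH; simp add: snoc.prems smooth_partial *)+
  then show ?case
    by (simp add: iter_partial_snoc partial_mult smooth_differentiable snoc.prems iter_partial_add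
        smooth_mult smooth_partial norm_triangle_le)
qed

text \<open>The product of vectors is componentwise, so \<open>x \<mapsto> a + c * x\<close> is an affine map with
  diagonal linear part.\<close>

lemma has_derivative_affine:
  fixes f :: "'n::finite cfun"
  assumes "f differentiable (at (a + c * x))"
  shows "((\<lambda>x. f (a + c * x)) has_derivative
          (\<lambda>h. frechet_derivative f (at (a + c * x)) (c * h))) (at x)"
proof -
  have "bounded_linear (\<lambda>h::(real, 'n) vec. c * h)" for c
    unfolding linear_conv_bounded_linear[symmetric]
    by (rule linearI) (simp_all add: vec_eq_iff algebra_simps)
  from has_derivative_add[OF has_derivative_const bounded_linear.has_derivative[OF this has_derivative_ident]]
  have "((\<lambda>x. a + c * x) has_derivative (\<lambda>h. c * h)) (at x)"
    by simp
  from has_derivative_compose[OF this frechet_derivative_works[THEN iffD1, OF assms]]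
  show ?thesis .
qed

lemma partial_affine:
  assumes "\<And>x. f differentiable (at x)"
  shows "partial j (\<lambda>x. f (a + c * x)) = (\<lambda>x. complex_of_real (c $ j) * partial j f (a + c * x))"
proof
  fix x
  have "c * axis j 1 = (c $ j) *\<^sub>R axis j 1"
    by (simp add: vec_eq_iff axis_def)
  then show "partial j (\<lambda>x. f (a + c * x)) x = complex_of_real (c $ j) * partial j f (a + c * x)"
    using linear_scale[OF linear_frechet_derivative[OF assms]]
    by (subst partial_eqI[OF has_derivative_affine[OF assms]])
       (simp add: partial_def scaleR_conv_of_real)
qed

lemma differentiable_affine:
  fixes f :: "'n::finite cfun"
  shows "f differentiable (at (a + c * x)) \<Longrightarrow> (\<lambda>x. f (a + c * x)) differentiable (at x)"
  by (blast intro: differentiableI has_derivative_affine)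

lemma iter_partial_affine:
  assumes "smooth f"
  shows "iter_partial js (\<lambda>x. f (a + c * x)) =
    (\<lambda>x. complex_of_real (\<Prod>j\<leftarrow>js. c $ j) * iter_partial js f (a + c * x))"
proof (induction js)
  case (Cons j js)
  have "partial j (\<lambda>x. complex_of_real (\<Prod>j\<leftarrow>js. c $ j) * iter_partial js f (a + c * x)) =
    (\<lambda>x. complex_of_real (\<Prod>j\<leftarrow>js. c $ j) * (complex_of_real (c $ j) * partial j (iter_partial js f) (a + c * x)))"
    by (subst partial_mult)
       (simp_all add: partial_const partial_affine differentiable_affine smooth_differentiable
         smooth_iter_partial assms)
  then show ?case
    unfolding iter_partial_Cons Cons by (simp add: mult_ac)
qed simp

lemma smooth_affine: "smooth f \<Longrightarrow> smooth (\<lambda>x. f (a + c * x))"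
  unfolding smooth_def[of "\<lambda>x. f (a + c * x)"]
  by (simp only: iter_partial_affine)
     (intro allI differentiable_mult differentiable_const differentiable_affine
        smooth_differentiable smooth_iter_partial)

section \<open>Schwartz functions\<close>

lemma iter_partial_eq_0:
  assumes "open U" "\<And>x. x \<in> U \<Longrightarrow> f x = 0" "x \<in> U"
  shows "iter_partial js f x = 0"
  using assms(3)
proof (induction js arbitrary: x)
  case (Cons j js)
  have "(iter_partial js f has_derivative (\<lambda>h. 0)) (at x)"
    by (rule has_derivative_transform_within_open[OF _ assms(1) Cons.prems, of "\<lambda>_. 0"])
       (auto simp: Cons.IH)
  then show ?case
    unfolding iter_partial_Cons by (rule partial_eqI)
qed (simp add: assms)

lemma iter_partial_const: "iter_partial js (\<lambda>x. c) = (\<lambda>x. if js = [] then c else 0)"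
  by (induction js) (simp_all add: iter_partial_Cons partial_const del: iter_partial.simps(2))

text \<open>An upper bound for \<open>schwartz_norm N f\<close> without the supremum, which is an
  unspecified number for an unbounded set. Estimates are carried out pointwise in this form and meet
  the supremum only on the way to \<open>tempered_bound\<close>.\<close>

definition seminorm_le :: "nat \<Rightarrow> 'n::finite cfun \<Rightarrow> real \<Rightarrow> bool" where
  "seminorm_le N f B \<longleftrightarrow>
     (\<forall>js x. length js \<le> N \<longrightarrow> (1 + norm x) ^ N * norm (iter_partial js f x) \<le> B)"

lemma finite_lists_le: "finite {js :: 'n::finite list. length js \<le> N}"
  using finite_lists_length_le[of "UNIV :: 'n set" N] by simp

text \<open>The definition gives one bound for each list and power; there are finitely many lists of
  length at most \<open>N\<close>, which makes the bound uniform. For the converse the index is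
  raised until it admits both the list and the power.\<close>

lemma schwartz_iff:
  fixes f :: "'n::finite cfun"
  shows "f \<in> schwartz \<longleftrightarrow> smooth f \<and> (\<forall>N. \<exists>B. seminorm_le N f B)"
proof (intro iffI conjI allI)
  fix N
  assume f: "f \<in> schwartz"
  have "\<exists>B. \<forall>js x. (1 + norm x) ^ N * norm (iter_partial js f x) \<le> B js"
    by (rule choice) (use f in \<open>simp add: schwartz_def\<close>)
  then obtain B where B: "\<And>js x. (1 + norm x) ^ N * norm (iter_partial js f x) \<le> B js"
    by blast
  have "seminorm_le N f (\<Sum>js\<in>{js. length js \<le> N}. \<bar>B js\<bar>)"
    unfolding seminorm_le_def
  proof (intro allI impI)
    fix js :: "'n list" and x :: "(real, 'n) vec"
    assume "length js \<le> N"
    then have "\<bar>B js\<bar> \<le> (\<Sum>js\<in>{js. length js \<le> N}. \<bar>B js\<bar>)"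
      by (intro member_le_sum) (auto intro: finite_lists_le)
    then show "(1 + norm x) ^ N * norm (iter_partial js f x) \<le> (\<Sum>js\<in>{js. length js \<le> N}. \<bar>B js\<bar>)"
      using B[of x js] by linarith
  qed
  then show "\<exists>B. seminorm_le N f B" ..
next
  assume f: "smooth f \<and> (\<forall>N. \<exists>B. seminorm_le N f B)"
  show "f \<in> schwartz"
    unfolding schwartz_def
  proof (intro CollectI conjI allI)
    fix js :: "'n list" and N
    obtain B where "seminorm_le (max N (length js)) f B"
      using conjunct2[OF f, THEN spec, of "max N (length js)"] by (elim exE)
    then have B: "(1 + norm x) ^ max N (length js) * norm (iter_partial js f x) \<le> B" for x
      by (simp add: seminorm_le_def)
    have "(1 + norm x) ^ N * norm (iter_partial js f x) \<le> B" for x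
    proof -
      have "(1 + norm x) ^ N \<le> (1 + norm x) ^ max N (length js)"
        by (intro power_increasing) simp_all
      then show ?thesis
        using B[of x] mult_right_mono[OF _ norm_ge_zero] by (meson order_trans)
    qed
    then show "\<exists>B. \<forall>x. (1 + norm x) ^ N * norm (iter_partial js f x) \<le> B"
      by (intro exI[of _ B] allI)
  qed (use f in blast)
qed (simp add: schwartz_def)

lemma schwartz_smooth: "f \<in> schwartz \<Longrightarrow> smooth f"
  by (simp add: schwartz_def)

lemma schwartz_bound:
  assumes "f \<in> schwartz"
  obtains B where "B \<ge> 0" "\<And>x. (1 + norm x) ^ N * norm (iter_partial js f x) \<le> B"
proof -
  from assms obtain B where "\<And>x. (1 + norm x) ^ N * norm (iter_partial js f x) \<le> B"
    unfolding schwartz_def by blast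
  moreover from this[of 0] have "B \<ge> 0"
    by (rule order_trans[rotated]) simp
  ultimately show ?thesis using that by blast
qed

lemma schwartz_bound0:
  assumes "f \<in> schwartz"
  obtains B where "B \<ge> 0" "\<And>x. (1 + norm x) ^ N * norm (f x) \<le> B"
  using schwartz_bound[OF assms, of N "[]"] that by (metis iter_partial.simps(1))

lemma seminorm_le_nonneg: "seminorm_le N f B \<Longrightarrow> B \<ge> 0"
  unfolding seminorm_le_def by (drule spec[of _ "[]"], drule spec[of _ 0]) (auto intro: order_trans[OF norm_ge_zero])

lemma seminorm_leD:
  fixes f :: "'n::finite cfun"
  assumes "seminorm_le N f B" "length js \<le> N"
  shows "norm (iter_partial js f x) \<le> B / (1 + norm x) ^ N"
proof -
  have "(1 + norm x) ^ N > 0"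
    by (intro zero_less_power) (use norm_ge_zero[of x] in linarith)
  then show ?thesis
    using assms by (simp add: seminorm_le_def pos_le_divide_eq mult.commute)
qed

lemma seminorm_leI:
  fixes f :: "'n::finite cfun"
  assumes "\<And>js x. length js \<le> N \<Longrightarrow> norm (iter_partial js f x) \<le> B / (1 + norm x) ^ N"
  shows "seminorm_le N f B"
  unfolding seminorm_le_def
proof (intro allI impI)
  fix js :: "'n list" and x :: "(real, 'n) vec"
  assume "length js \<le> N"
  moreover have "(1 + norm x) ^ N > 0"
    by (intro zero_less_power) (use norm_ge_zero[of x] in linarith)
  ultimately show "(1 + norm x) ^ N * norm (iter_partial js f x) \<le> B"
    using assms[of js x] by (simp add: pos_le_divide_eq mult.commute)
qed

text \<open>The second claim rests on \<open>B\<close> too: it makes the set bounded above, and only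
  then is the supremum known to dominate one of its nonnegative values.\<close>

lemma schwartz_norm_le:
  fixes f :: "'n::finite cfun"
  assumes "seminorm_le N f B"
  shows "schwartz_norm N f \<le> B" "schwartz_norm N f \<ge> 0"
proof -
  let ?S = "{js :: 'n list. length js \<le> N} \<times> (UNIV :: (real, 'n) vec set)"
  let ?h = "\<lambda>(js, x). (1 + norm x) ^ N * norm (iter_partial js f x)"
  have B: "?h p \<le> B" if "p \<in> ?S" for p
    using assms that by (auto simp: seminorm_le_def)
  have ne: "([], 0) \<in> ?S" by simp
  show "schwartz_norm N f \<le> B"
    unfolding schwartz_norm_def by (rule cSUP_least[OF _ B]) (use ne in blast)+
  have "bdd_above (?h ` ?S)"
    using B by (intro bdd_aboveI2) blast
  then show "schwartz_norm N f \<ge> 0"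
    unfolding schwartz_norm_def by (rule cSUP_upper2[OF _ ne]) simp
qed

lemma tempered_bound:
  fixes u :: "'n::finite functional"
  assumes "u \<in> tempered_distributions"
  obtains C N where "C \<ge> 0" "\<And>f B. f \<in> schwartz \<Longrightarrow> seminorm_le N f B \<Longrightarrow> norm (u f) \<le> C * B"
proof -
  from assms obtain C N where C: "\<And>f. f \<in> schwartz \<Longrightarrow> norm (u f) \<le> C * schwartz_norm N f"
    unfolding tempered_distributions_def by blast
  show ?thesis
  \<comment> \<open>The definition puts no sign on the constant; its absolute value allows the norm
    to be replaced by a larger bound.\<close>
  proof (rule that[of "\<bar>C\<bar>" N])
    fix f :: "'n cfun" and B
    assume "f \<in> schwartz" and sB: "seminorm_le N f B"
    then have "norm (u f) \<le> C * schwartz_norm N f" by (intro C)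
    also have "\<dots> \<le> \<bar>C\<bar> * B"
      using schwartz_norm_le[OF sB] by (intro mult_mono) auto
    finally show "norm (u f) \<le> \<bar>C\<bar> * B" .
  qed simp
qed

lemma schwartz_iter_partial: "f \<in> schwartz \<Longrightarrow> iter_partial js f \<in> schwartz"
  by (simp add: schwartz_def smooth_iter_partial iter_partial_append[symmetric])

lemma schwartz_partial: "f \<in> schwartz \<Longrightarrow> partial j f \<in> schwartz"
  using schwartz_iter_partial[of f "[j]"] by (simp add: partial_def)

lemma schwartz_add:
  fixes f :: "'n::finite cfun"
  assumes "f \<in> schwartz" "g \<in> schwartz"
  shows "(\<lambda>x. f x + g x) \<in> schwartz"
  unfolding schwartz_def
proof (intro CollectI conjI allI)
  fix js :: "'n list" and N
  obtain B where B: "\<And>x. (1 + norm x) ^ N * norm (iter_partial js f x) \<le> B"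
    using schwartz_bound[OF assms(1)] by blast
  obtain C where C: "\<And>x. (1 + norm x) ^ N * norm (iter_partial js g x) \<le> C"
    using schwartz_bound[OF assms(2)] by blast
  have "(1 + norm x) ^ N * norm (iter_partial js (\<lambda>x. f x + g x) x) \<le> B + C" for x
  proof -
    have "(1 + norm x) ^ N * norm (iter_partial js (\<lambda>x. f x + g x) x) \<le>
      (1 + norm x) ^ N * (norm (iter_partial js f x) + norm (iter_partial js g x))"
      by (intro mult_left_mono)
         (simp_all add: iter_partial_add schwartz_smooth assms norm_triangle_ineq)
    then show ?thesis using B[of x] C[of x] by (simp add: distrib_left)
  qed
  then show "\<exists>B. \<forall>x. (1 + norm x) ^ N * norm (iter_partial js (\<lambda>x. f x + g x) x) \<le> B" by blast
qed (simp add: smooth_add schwartz_smooth assms)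

text \<open>The multipliers of the Schwartz space, often written O_M; the degree of growth may
  depend on the derivative. Coordinate functions, which arise in differentiating a Fourier
  transform, and Schwartz functions are both of this kind.\<close>

definition temperate :: "'n::finite cfun \<Rightarrow> bool" where
  "temperate f \<longleftrightarrow> smooth f \<and>
     (\<forall>js. \<exists>C m. \<forall>x. norm (iter_partial js f x) \<le> C * (1 + norm x) ^ m)"

lemma schwartz_temperate:
  fixes f :: "'n::finite cfun"
  assumes "f \<in> schwartz"
  shows "temperate f"
  unfolding temperate_def
proof (intro conjI allI)
  fix js :: "'n list"
  obtain B where "\<And>x. norm (iter_partial js f x) \<le> B"
    using schwartz_bound[OF assms, of 0 js] by auto
  then show "\<exists>C m. \<forall>x. norm (iter_partial js f x) \<le> C * (1 + norm x) ^ m"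
    by (intro exI[of _ B] exI[of _ 0]) simp
qed (rule schwartz_smooth[OF assms])

lemma temperate_const: "temperate (\<lambda>x. c)"
  unfolding temperate_def
  by (intro conjI smooth_const allI exI[of _ "norm c"] exI[of _ 0]) (simp add: iter_partial_const)

lemma temperate_component: "temperate (\<lambda>x::(real, 'n::finite) vec. complex_of_real (x $ i))"
  unfolding temperate_def
proof (intro conjI allI smooth_component)
  fix js :: "'n list"
  show "\<exists>C m. \<forall>x::(real, 'n) vec. norm (iter_partial js (\<lambda>x. complex_of_real (x $ i)) x) \<le> C * (1 + norm x) ^ m"
  proof (cases js rule: rev_cases)
    case Nil
    have "\<bar>x $ i\<bar> \<le> 1 + norm x" for x
      using component_le_norm_cart[of x i] by simp
    then show ?thesis
      by (intro exI[of _ 1]) (simp add: Nil)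
  next
    case (snoc ks j)
    show ?thesis
      by (intro exI[of _ 1] exI[of _ 0])
         (auto simp: snoc iter_partial_snoc partial_component iter_partial_const)
  qed
qed

lemma temperate_uniform:
  fixes f :: "'n::finite cfun"
  assumes "temperate f" "finite L"
  shows "\<exists>C m. C \<ge> 0 \<and> (\<forall>js\<in>L. \<forall>x. norm (iter_partial js f x) \<le> C * (1 + norm x) ^ m)"
  using assms(2)
proof induction
  case empty
  show ?case by (rule exI[of _ 0]) simp
next
  case (insert ks L)
  from insert.IH obtain C m where C: "C \<ge> 0"
      "\<And>js x. js \<in> L \<Longrightarrow> norm (iter_partial js f x) \<le> C * (1 + norm x) ^ m"
    by auto
  from assms(1) have "\<exists>C m. \<forall>x. norm (iter_partial ks f x) \<le> C * (1 + norm x) ^ m"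
    unfolding temperate_def by (elim conjE allE)
  then obtain D l where D: "\<And>x. norm (iter_partial ks f x) \<le> D * (1 + norm x) ^ l"
    by auto
  have "norm (iter_partial js f x) \<le> (C + \<bar>D\<bar>) * (1 + norm x) ^ (m + l)" if js: "js \<in> insert ks L" for js x
  proof (cases "js = ks")
    case True
    have "D * (1 + norm x) ^ l \<le> (C + \<bar>D\<bar>) * (1 + norm x) ^ (m + l)"
      by (intro mult_mono power_increasing) (use C(1) in auto)
    then show ?thesis using D[of x] True by simp
  next
    case False
    have "C * (1 + norm x) ^ m \<le> (C + \<bar>D\<bar>) * (1 + norm x) ^ (m + l)"
      by (intro mult_mono power_increasing) (use C(1) in auto)
    then show ?thesis using C(2)[of js x] False js by simp
  qed
  then show ?case
    by (intro exI[of _ "C + \<bar>D\<bar>"] exI[of _ "m + l"] conjI ballI allI) (use C(1) in simp_all)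
qed

text \<open>Growth of \<open>f\<close> of degree \<open>l\<close> is paid for by a seminorm of
  \<open>g\<close> with \<open>l\<close> more powers of the weight.\<close>

lemma schwartz_mult:
  fixes f :: "'n::finite cfun"
  assumes "temperate f" "g \<in> schwartz"
  shows "(\<lambda>x. f x * g x) \<in> schwartz"
  unfolding schwartz_iff
proof (intro conjI allI)
  have f: "smooth f" and g: "smooth g"
    using assms by (simp_all add: temperate_def schwartz_smooth)
  then show "smooth (\<lambda>x. f x * g x)"
    by (rule smooth_mult)
  fix N
  obtain D l where D: "D \<ge> 0"
      and fb: "\<And>js x. length js \<le> N \<Longrightarrow> norm (iter_partial js f x) \<le> D * (1 + norm x) ^ l"
    using temperate_uniform[OF assms(1) finite_lists_le[of N]] by auto
  obtain B where B: "seminorm_le (N + l) g B"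
    using assms(2) unfolding schwartz_iff by blast
  have "seminorm_le N (\<lambda>x. f x * g x) (2 ^ N * D * B)"
  proof (rule seminorm_leI)
    fix js :: "'n list" and x :: "(real, 'n) vec"
    assume js: "length js \<le> N"
    have pos: "1 + norm x > 0" using norm_ge_zero[of x] by linarith
    have "norm (iter_partial js (\<lambda>x. f x * g x) x) \<le>
      2 ^ length js * (D * (1 + norm x) ^ l) * (B / (1 + norm x) ^ (N + l))"
      by (rule norm_iter_partial_mult_le[OF f g]) (use js in \<open>auto intro: fb seminorm_leD[OF B]\<close>)
    also have "\<dots> = 2 ^ length js * D * B / (1 + norm x) ^ N"
      using pos by (simp add: power_add field_simps)
    also have "\<dots> \<le> 2 ^ N * D * B / (1 + norm x) ^ N"
      using js pos seminorm_le_nonneg[OF B]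
      by (intro divide_right_mono mult_right_mono power_increasing) (use D in auto)
    finally show "norm (iter_partial js (\<lambda>x. f x * g x) x) \<le> 2 ^ N * D * B / (1 + norm x) ^ N" .
  qed
  then show "\<exists>B. seminorm_le N (\<lambda>x. f x * g x) B" ..
qed

lemma schwartz_cmult: "f \<in> schwartz \<Longrightarrow> (\<lambda>x. c * f x) \<in> schwartz"
  by (rule schwartz_mult[OF temperate_const])

lemma schwartz_diff: "f \<in> schwartz \<Longrightarrow> g \<in> schwartz \<Longrightarrow> (\<lambda>x. f x - g x) \<in> schwartz"
  using schwartz_add[OF _ schwartz_cmult[of g "-1"]] by simp

text \<open>As no \<open>c $ j\<close> vanishes, the coordinates of \<open>x\<close> are recovered
  from \<open>a + c * x\<close>. Thus \<open>1 + norm x\<close> is at most a constant times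
  \<open>1 + norm (a + c * x)\<close>, and decay in the latter is decay in \<open>x\<close>.\<close>

lemma schwartz_affine:
  fixes c :: "(real, 'n::finite) vec"
  assumes "f \<in> schwartz" "\<And>j. c $ j \<noteq> 0"
  shows "(\<lambda>x. f (a + c * x)) \<in> schwartz"
  unfolding schwartz_def
proof (intro CollectI conjI allI)
  have f: "smooth f" using assms(1) by (rule schwartz_smooth)
  then show "smooth (\<lambda>x. f (a + c * x))" by (rule smooth_affine)
  fix js :: "'n list" and N
  obtain B where B: "B \<ge> 0" "\<And>x. (1 + norm x) ^ N * norm (iter_partial js f x) \<le> B"
    using schwartz_bound[OF assms(1)] by blast
  define s where "s = (\<Sum>j\<in>UNIV. 1 / \<bar>c $ j\<bar>)"
  have s: "s \<ge> 0" unfolding s_def by (simp add: sum_nonneg)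
  define K where "K = 1 + s + s * norm a"
  have "1 + norm x \<le> K * (1 + norm (a + c * x))" for x
  proof -
    have "norm x \<le> (\<Sum>j\<in>UNIV. \<bar>x $ j\<bar>)" by (rule norm_le_l1_cart)
    also have "\<dots> \<le> (\<Sum>j\<in>UNIV. 1 / \<bar>c $ j\<bar> * (norm (a + c * x) + norm a))"
    proof (rule sum_mono)
      fix j
      have "\<bar>(a + c * x) $ j\<bar> \<le> norm (a + c * x)" "\<bar>a $ j\<bar> \<le> norm a"
        by (rule component_le_norm_cart)+
      then have "\<bar>c $ j\<bar> * \<bar>x $ j\<bar> \<le> norm (a + c * x) + norm a"
        unfolding abs_mult[symmetric] by simp
      then show "\<bar>x $ j\<bar> \<le> 1 / \<bar>c $ j\<bar> * (norm (a + c * x) + norm a)"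
        using assms(2)[of j] by (simp add: field_simps)
    qed
    also have "\<dots> = s * (norm (a + c * x) + norm a)"
      by (simp add: s_def sum_distrib_right)
    finally have "1 + norm x \<le> 1 + s * norm (a + c * x) + s * norm a"
      by (simp add: distrib_left)
    also have "\<dots> \<le> K * (1 + norm (a + c * x))"
      using s by (simp add: K_def algebra_simps)
    finally show ?thesis .
  qed
  then have "(1 + norm x) ^ N \<le> K ^ N * (1 + norm (a + c * x)) ^ N" for x
    unfolding power_mult_distrib[symmetric] by (intro power_mono) auto
  moreover have "iter_partial js (\<lambda>x. f (a + c * x)) x =
      complex_of_real (\<Prod>j\<leftarrow>js. c $ j) * iter_partial js f (a + c * x)" for x
    by (simp only: iter_partial_affine[OF f])
  ultimately have "(1 + norm x) ^ N * norm (iter_partial js (\<lambda>x. f (a + c * x)) x) \<le>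
      (K ^ N * (1 + norm (a + c * x)) ^ N) *
      (\<bar>\<Prod>j\<leftarrow>js. c $ j\<bar> * norm (iter_partial js f (a + c * x)))" for x
    by (simp add: norm_mult mult_right_mono)
  moreover have "(K ^ N * (1 + norm (a + c * x)) ^ N) *
      (\<bar>\<Prod>j\<leftarrow>js. c $ j\<bar> * norm (iter_partial js f (a + c * x))) \<le>
      K ^ N * \<bar>\<Prod>j\<leftarrow>js. c $ j\<bar> * B" for x
  proof -
    have "K ^ N * \<bar>\<Prod>j\<leftarrow>js. c $ j\<bar> *
      ((1 + norm (a + c * x)) ^ N * norm (iter_partial js f (a + c * x))) \<le>
      K ^ N * \<bar>\<Prod>j\<leftarrow>js. c $ j\<bar> * B"
      using s by (intro mult_left_mono B) (auto simp: K_def)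
    then show ?thesis by (simp add: mult_ac)
  qed
  ultimately show "\<exists>B. \<forall>x. (1 + norm x) ^ N * norm (iter_partial js (\<lambda>x. f (a + c * x)) x) \<le> B"
    by (meson order_trans)
qed

lemma test_functions_schwartz:
  fixes f :: "'n::finite cfun"
  assumes "f \<in> test_functions \<Omega>"
  shows "f \<in> schwartz"
  unfolding schwartz_def
proof (intro CollectI conjI allI)
  have f: "smooth f" and K: "compact (supp f)"
    using assms by (auto simp: test_functions_def)
  then show "smooth f" by blast
  fix js :: "'n list" and N
  let ?h = "\<lambda>x. (1 + norm x) ^ N * norm (iter_partial js f x)"
  have "continuous_on (supp f) ?h"
    by (intro continuous_intros smooth_continuous_on smooth_iter_partial f)
  then have "bounded (?h ` supp f)"
    using K compact_continuous_image compact_imp_bounded by blast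
  then obtain B where B: "B > 0" "\<And>x. x \<in> supp f \<Longrightarrow> ?h x \<le> B"
    unfolding bounded_pos by fastforce
  have "?h x \<le> B" for x
  proof (cases "x \<in> supp f")
    case False
    have "iter_partial js f x = 0"
    proof (rule iter_partial_eq_0)
      show "open (- supp f)" by (simp add: supp_def open_closed)
      show "f y = 0" if "y \<in> - supp f" for y
        using that closure_subset[of "{x. f x \<noteq> 0}"] by (auto simp: supp_def)
    qed (use False in simp)
    then show ?thesis using B(1) by simp
  qed (rule B)
  then show "\<exists>B. \<forall>x. ?h x \<le> B" by blast
qed

lemma not_in_supp: "x \<notin> supp f \<Longrightarrow> f x = 0"
  using closure_subset[of "{x. f x \<noteq> 0}"] by (auto simp: supp_def)

section \<open>Integrability\<close>

lemma integrable_inverse_1_plus_square_real: "integrable lborel (\<lambda>x::real. inverse (1 + x\<^sup>2))"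
  using integrable_inverse_1_plus_square by (simp add: set_integrable_def einterval_def)

text \<open>The exponent is two per coordinate: each \<open>1 + (x \<bullet> b)\<^sup>2\<close> is
  at most \<open>(1 + norm x)\<^sup>2\<close>, so the function is dominated by a product of
  one-dimensional functions 1/(1 + t^2), whose integral factors.\<close>

lemma integrable_weight:
  "integrable lborel (\<lambda>x::(real, 'n::finite) vec. 1 / (1 + norm x) ^ (2 * CARD('n)))"
proof (rule Bochner_Integration.integrable_bound)
  let ?w = "\<lambda>x::(real, 'n) vec. \<Prod>b\<in>Basis. inverse (1 + (x \<bullet> b)\<^sup>2)"
  show "integrable lborel ?w"
  proof (rule integrableI_bounded)
    have "(\<integral>\<^sup>+x. ennreal (norm (?w x)) \<partial>lborel) =
        (\<integral>\<^sup>+x. (\<Prod>b\<in>Basis. ennreal (inverse (1 + (x \<bullet> b)\<^sup>2))) \<partial>(lborel :: (real, 'n) vec measure))"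
      by (intro nn_integral_cong) (simp add: prod_ennreal prod_nonneg)
    also have "\<dots> = (\<Prod>b\<in>(Basis :: (real, 'n) vec set). (\<integral>\<^sup>+t. ennreal (inverse (1 + t\<^sup>2)) \<partial>lborel))"
      by (rule nn_integral_lborel_prod) auto
    also have "\<dots> < \<infinity>"
      using integrable_inverse_1_plus_square_real
      by (auto simp: integrable_iff_bounded less_top[symmetric] power_eq_top_ennreal)
    finally show "(\<integral>\<^sup>+x. ennreal (norm (?w x)) \<partial>lborel) < \<infinity>" .
  qed measurable
  show "AE x in lborel. norm (1 / (1 + norm x) ^ (2 * CARD('n))) \<le> norm (?w x)"
  proof (rule AE_I2)
    fix x :: "(real, 'n) vec"
    have "(\<Prod>b\<in>(Basis :: (real, 'n) vec set). 1 + (x \<bullet> b)\<^sup>2) \<le> (\<Prod>b\<in>(Basis :: (real, 'n) vec set). (1 + norm x)\<^sup>2)"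
    proof (rule prod_mono, intro conjI)
      fix b :: "(real, 'n) vec" assume "b \<in> Basis"
      then have "\<bar>x \<bullet> b\<bar> \<le> norm x" by (rule Basis_le_norm)
      then have "(x \<bullet> b)\<^sup>2 \<le> (norm x)\<^sup>2" by (simp add: abs_le_square_iff[symmetric])
      then show "1 + (x \<bullet> b)\<^sup>2 \<le> (1 + norm x)\<^sup>2"
        using norm_ge_zero[of x] unfolding power2_sum power_one by linarith
    qed simp
    also have "\<dots> = (1 + norm x) ^ (2 * CARD('n))"
      by (simp add: power_mult)
    finally have le: "(\<Prod>b\<in>(Basis :: (real, 'n) vec set). 1 + (x \<bullet> b)\<^sup>2) \<le> (1 + norm x) ^ (2 * CARD('n))" .
    have "(\<Prod>b\<in>(Basis :: (real, 'n) vec set). 1 + (x \<bullet> b)\<^sup>2) > 0"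
      by (intro prod_pos) (simp add: add_pos_nonneg)
    with le have "1 / (1 + norm x) ^ (2 * CARD('n)) \<le> 1 / (\<Prod>b\<in>(Basis :: (real, 'n) vec set). 1 + (x \<bullet> b)\<^sup>2)"
      by (intro divide_left_mono) auto
    then show "norm (1 / (1 + norm x) ^ (2 * CARD('n))) \<le> norm (?w x)"
      by (simp add: prod_nonneg prod_inversef[unfolded o_def] inverse_eq_divide[symmetric])
  qed
qed (simp; measurable)

lemma integrable_decay:
  fixes f :: "'n::finite cfun"
  assumes "f \<in> borel_measurable borel" "\<And>x. (1 + norm x) ^ (2 * CARD('n)) * norm (f x) \<le> B"
  shows "integrable lborel f"
proof (rule Bochner_Integration.integrable_bound)
  show "integrable lborel (\<lambda>x::(real, 'n) vec. B * (1 / (1 + norm x) ^ (2 * CARD('n))))"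
    by (intro integrable_mult_right integrable_weight)
  have "norm (f x) \<le> B * (1 / (1 + norm x) ^ (2 * CARD('n)))" for x
  proof -
    have "(1 + norm x) ^ (2 * CARD('n)) > 0"
      by (intro zero_less_power) (use norm_ge_zero[of x] in linarith)
    then show ?thesis using assms(2)[of x] by (simp add: field_simps)
  qed
  then show "AE x in lborel. norm (f x) \<le> norm (B * (1 / (1 + norm x) ^ (2 * CARD('n))))"
    unfolding real_norm_def by (intro AE_I2 order_trans[OF _ abs_ge_self])
qed (use assms in simp)

lemma schwartz_integrable:
  fixes f :: "'n::finite cfun"
  shows "f \<in> schwartz \<Longrightarrow> integrable lborel f"
  by (rule schwartz_bound0[of f "2 * CARD('n)"], assumption, rule integrable_decay)
     (auto intro: smooth_measurable schwartz_smooth)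

section \<open>Mean value estimates, weights and vanishing integrals of derivatives\<close>

lemma frechet_derivative_norm_le:
  fixes f :: "'n::finite cfun"
 and b :: real
  assumes "f differentiable (at x)" "\<And>i. norm (partial i f x) \<le> b"
  shows "onorm (frechet_derivative f (at x)) \<le> real CARD('n) * b"
proof (rule onorm_bound)
  show "0 \<le> real CARD('n) * b"
    using order_trans[OF norm_ge_zero assms(2)] by simp
  fix h :: "(real, 'n) vec"
  have "norm (frechet_derivative f (at x) h) \<le> (\<Sum>i\<in>UNIV. norm (h $ i *\<^sub>R partial i f x))"
    unfolding frechet_derivative_sum_partial[OF assms(1)] by (rule norm_sum)
  also have "\<dots> \<le> (\<Sum>i\<in>(UNIV :: 'n set). norm h * b)"
    by (intro sum_mono) (auto intro!: mult_mono assms(2) component_le_norm_cart)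
  finally show "norm (frechet_derivative f (at x) h) \<le> real CARD('n) * b * norm h"
    by (simp add: mult_ac)
qed

text \<open>Serves to dominate difference quotients and to obtain Lipschitz bounds for translates.
  Both times the derivative decays, so a bound is asked for on the segment only, where the decay can
  still be exploited.\<close>

lemma partial_mean_value:
  fixes f :: "'n::finite cfun"
 and b :: real
  assumes "\<And>x. f differentiable (at x)"
    and "\<And>i t. 0 \<le> t \<Longrightarrow> t \<le> 1 \<Longrightarrow> norm (partial i f (x + t *\<^sub>R a)) \<le> b"
  shows "norm (f (x + a) - f x) \<le> norm a * (real CARD('n) * b)"
proof (rule differentiable_bound_segment[of x a UNIV])
  show "(f has_derivative frechet_derivative f (at y)) (at y within UNIV)" for y
    using assms(1) by (simp add: frechet_derivative_works[symmetric])
  show "onorm (frechet_derivative f (at (x + t *\<^sub>R a))) \<le> real CARD('n) * b" if "t \<in> {0..1}" for t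
    using that by (intro frechet_derivative_norm_le assms) auto
qed simp

text \<open>Peetre's inequality: a polynomial weight is moved from one point to another at the price
  of the weight of their difference.\<close>

lemma peetre: "1 + norm x \<le> (1 + norm y) * (1 + norm (x - y))"
proof -
  have "norm x \<le> norm y + norm (x - y)"
    using norm_triangle_ineq[of y "x - y"] by simp
  moreover have "0 \<le> norm y * norm (x - y)" by simp
  moreover have "(1 + norm y) * (1 + norm (x - y)) = 1 + norm y + norm (x - y) + norm y * norm (x - y)"
    by (simp add: algebra_simps)
  ultimately show ?thesis by linarith
qed

lemma peetre_power: "(1 + norm x) ^ N \<le> (1 + norm y) ^ N * (1 + norm (x - y)) ^ N"
  unfolding power_mult_distrib[symmetric] by (intro power_mono peetre) simp

lemma lborel_integral_translate:
  fixes f :: "(real, 'n::finite) vec \<Rightarrow> complex"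
  assumes "integrable lborel f"
  shows "integrable lborel (\<lambda>x. f (x + c))" "(LINT x|lborel. f (x + c)) = (LINT x|lborel. f x)"
proof -
  have [measurable]: "f \<in> borel_measurable borel"
    using assms borel_measurable_integrable by force
  have eq: "f \<circ> (+) c = (\<lambda>x. f (x + c))"
    by (auto simp: add.commute)
  have "integrable (distr lborel borel ((+) c)) f"
    by (simp add: lborel_distr_plus assms)
  then show "integrable lborel (\<lambda>x. f (x + c))"
    by (subst (asm) integrable_distr_eq) (simp_all add: add.commute)
  have "(LINT x|lborel. f x) = (LINT x|distr lborel borel ((+) c). f x)"
    by (simp add: lborel_distr_plus)
  also have "\<dots> = (LINT x|lborel. f (x + c))"
    by (subst integral_distr) (simp_all add: add.commute)
  finally show "(LINT x|lborel. f (x + c)) = (LINT x|lborel. f x)" ..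
qed

text \<open>By translation invariance the difference quotients of \<open>h\<close> integrate to zero.\<close>

lemma integral_partial_eq_0:
  fixes h :: "'n::finite cfun" and B :: real
  assumes diff: "\<And>x. h differentiable (at x)"
    and meas: "partial j h \<in> borel_measurable borel"
    and int: "integrable lborel h"
    and bound: "\<And>i x. (1 + norm x) ^ (2 * CARD('n)) * norm (partial i h x) \<le> B"
  shows "(LINT x|lborel. partial j h x) = 0"
proof -
  let ?m = "2 * CARD('n)"
  define e :: "nat \<Rightarrow> (real, 'n) vec" where "e k = (1 / Suc k) *\<^sub>R axis j 1" for k
  define s where "s k x = complex_of_real (Suc k) * (h (x + e k) - h x)" for k x
  have [measurable]: "h \<in> borel_measurable borel"
    by (meson diff borel_measurable_continuous_onI continuous_at_imp_continuous_on
        differentiable_imp_continuous_within)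
  have [measurable]: "s k \<in> borel_measurable borel" for k
    unfolding s_def by measurable
  have ne: "norm (e k) = 1 / Suc k" for k
    by (simp add: e_def norm_axis_1 del: of_nat_Suc)
  have ne0: "e k \<noteq> 0" for k
    using ne[of k] by (metis norm_zero of_nat_neq_0 zero_neq_one divide_eq_0_iff)
  have s0: "integral\<^sup>L lborel (s k) = 0" for k
    using lborel_integral_translate[OF int, of "e k"] int by (simp add: s_def[abs_def])
  have pos: "(1 + norm x) ^ m > 0" for x :: "(real, 'n) vec" and m
    by (intro zero_less_power) (use norm_ge_zero[of x] in linarith)
  \<comment> \<open>The dominating function is the same for all \<open>k\<close>: the segment from
    \<open>x\<close> to \<open>x + e k\<close> has length at most 1, so moving the weight along it
    costs at most the factor \<open>2 ^ ?m\<close>.\<close>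
  have bd: "norm (s k x) \<le> real CARD('n) * (B * 2 ^ ?m) * (1 / (1 + norm x) ^ ?m)" for k x
  proof -
    have "norm (partial i h (x + t *\<^sub>R e k)) \<le> B * 2 ^ ?m / (1 + norm x) ^ ?m"
      if t: "0 \<le> t" "t \<le> 1" for i t
    proof -
      let ?y = "x + t *\<^sub>R e k"
      have "norm (x - ?y) \<le> 1"
        using t ne[of k] by (simp add: mult_le_one)
      have "(1 + norm x) ^ ?m * norm (partial i h ?y) \<le>
          ((1 + norm ?y) ^ ?m * (1 + norm (x - ?y)) ^ ?m) * norm (partial i h ?y)"
        by (intro mult_right_mono peetre_power) simp
      also have "\<dots> = (1 + norm (x - ?y)) ^ ?m * ((1 + norm ?y) ^ ?m * norm (partial i h ?y))"
        by simp
      also have "\<dots> \<le> 2 ^ ?m * B"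
        using \<open>norm (x - ?y) \<le> 1\<close> by (intro mult_mono power_mono bound) auto
      finally show ?thesis
        by (simp add: pos_le_divide_eq[OF pos] mult.commute)
    qed
    then have "norm (h (x + e k) - h x) \<le> norm (e k) * (real CARD('n) * (B * 2 ^ ?m / (1 + norm x) ^ ?m))"
      by (intro partial_mean_value diff)
    then have "Suc k * norm (h (x + e k) - h x) \<le>
        Suc k * (norm (e k) * (real CARD('n) * (B * 2 ^ ?m / (1 + norm x) ^ ?m)))"
      by (intro mult_left_mono) simp_all
    also have "\<dots> = real CARD('n) * (B * 2 ^ ?m) * (1 / (1 + norm x) ^ ?m)"
      unfolding ne by (simp add: field_simps del: of_nat_Suc)
    finally show ?thesis
      by (simp add: s_def norm_mult del: of_nat_Suc)
  qed
  have lim: "(\<lambda>k. s k x) \<longlonglongrightarrow> partial j h x" for x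
  proof -
    let ?D = "frechet_derivative h (at x)"
    have D: "(h has_derivative ?D) (at x)"
      using diff by (simp add: frechet_derivative_works[symmetric])
    then interpret D: bounded_linear ?D by (rule has_derivative_bounded_linear)
    have "((\<lambda>y. norm (h (x + y) - h x - ?D y) / norm y) \<longlongrightarrow> 0) (at 0)"
      using D by (simp add: has_derivative_at)
    moreover have "filterlim e (at 0) sequentially"
    proof (rule filterlim_atI)
      show "e \<longlonglongrightarrow> 0"
        using LIMSEQ_Suc[OF lim_1_over_n[where ?'a = real]]
        by (subst tendsto_norm_zero_iff[symmetric]) (simp add: ne del: of_nat_Suc)
    qed (simp add: ne0)
    ultimately have "(\<lambda>k. norm (h (x + e k) - h x - ?D (e k)) / norm (e k)) \<longlonglongrightarrow> 0"
      by (rule filterlim_compose)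
    moreover have "norm (h (x + e k) - h x - ?D (e k)) / norm (e k) = norm (s k x - partial j h x)" for k
    proof -
      have "?D (e k) = complex_of_real (1 / Suc k) * partial j h x"
        by (simp only: e_def D.scaleR partial_def scaleR_conv_of_real[where 'a = complex])
      then have "complex_of_real (Suc k) * ?D (e k) = partial j h x"
        by (simp del: of_nat_Suc)
      then have "s k x - partial j h x = complex_of_real (Suc k) * (h (x + e k) - h x - ?D (e k))"
        by (simp only: s_def right_diff_distrib)
      then show ?thesis
        by (simp add: ne norm_mult del: of_nat_Suc)
    qed
    ultimately have "(\<lambda>k. norm (s k x - partial j h x)) \<longlonglongrightarrow> 0" by simp
    then show ?thesis
      by (simp add: tendsto_norm_zero_iff LIM_zero_iff)
  qed
  have "(\<lambda>k. integral\<^sup>L lborel (s k)) \<longlonglongrightarrow> integral\<^sup>L lborel (partial j h)"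
  proof (rule integral_dominated_convergence)
    show "integrable lborel (\<lambda>x::(real, 'n) vec. real CARD('n) * (B * 2 ^ ?m) * (1 / (1 + norm x) ^ ?m))"
      by (intro integrable_mult_right integrable_weight)
  qed (use lim bd meas in auto)
  then show ?thesis
    unfolding s0 by (simp add: LIMSEQ_const_iff)
qed

section \<open>The Fourier transform of Schwartz functions\<close>

text \<open>A quadratic remainder for the exponential, which reduces differentiability of a Fourier
  transform to finiteness of a second moment.\<close>

lemma norm_cis_minus_le: "norm (cis t - 1 - \<i> * complex_of_real t) \<le> t\<^sup>2"
proof -
  have "norm (iexp t - (\<Sum>k\<le>1. (\<i> * complex_of_real t) ^ k / fact k)) \<le> \<bar>t\<bar> ^ Suc 1 / fact (Suc 1)"
    by (rule iexp_approx1)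
  then have "norm (cis t - 1 - \<i> * complex_of_real t) \<le> t\<^sup>2 / 2"
    by (simp add: cis_conv_exp power2_eq_square algebra_simps)
  then show ?thesis using zero_le_power2[of t] by linarith
qed

lemma integrable_cis_mult:
  fixes f :: "'a::euclidean_space \<Rightarrow> complex"
  assumes "integrable lborel f" "continuous_on UNIV g"
  shows "integrable lborel (\<lambda>x. cis (g x) * f x)"
proof (rule Bochner_Integration.integrable_bound[OF assms(1)])
  have [measurable]: "(\<lambda>x. cis (g x)) \<in> borel_measurable borel"
    by (intro borel_measurable_continuous_onI continuous_intros assms(2))
  have [measurable]: "f \<in> borel_measurable borel"
    using assms(1) borel_measurable_integrable by force
  show "(\<lambda>x. cis (g x) * f x) \<in> borel_measurable lborel" by simp
qed (simp add: norm_mult)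

lemma fourier_integrable:
  assumes "f \<in> schwartz"
  shows "integrable lborel (\<lambda>x. cis (- (x \<bullet> \<xi>)) * f x)"
  by (intro integrable_cis_mult schwartz_integrable assms continuous_intros)

text \<open>Differentiation under the integral sign with an explicit remainder: it is at most
  \<open>K * (norm (y - \<xi>))\<^sup>2\<close>, where \<open>K\<close> is the second absolute
  moment of \<open>f\<close>.\<close>

lemma has_derivative_fourier:
  fixes f :: "'n::finite cfun"
  assumes f: "f \<in> schwartz"
  shows "(fourier f has_derivative
      (\<lambda>h. \<Sum>j\<in>UNIV. h $ j *\<^sub>R fourier (\<lambda>x. (- \<i> * complex_of_real (x $ j)) * f x) \<xi>)) (at \<xi>)"
proof -
  define g where "g j = (\<lambda>x. (- \<i> * complex_of_real (x $ j)) * f x)" for j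
  have g: "g j \<in> schwartz" for j
    using schwartz_cmult[OF schwartz_mult[OF temperate_component f], of "-\<i>" j]
    by (simp add: g_def mult.assoc)
  have int2: "integrable lborel (\<lambda>x. complex_of_real ((norm x)\<^sup>2) * f x)"
  proof -
    obtain B where B: "\<And>x. (1 + norm x) ^ (2 * CARD('n) + 2) * norm (f x) \<le> B"
      using schwartz_bound0[OF f] by metis
    show ?thesis
    proof (rule integrable_decay)
      show "(\<lambda>x. complex_of_real ((norm x)\<^sup>2) * f x) \<in> borel_measurable borel"
        using smooth_measurable[OF schwartz_smooth[OF f]] by measurable
      show "(1 + norm x) ^ (2 * CARD('n)) * norm (complex_of_real ((norm x)\<^sup>2) * f x) \<le> B" for x
      proof -
        have "(1 + norm x) ^ (2 * CARD('n)) * norm (complex_of_real ((norm x)\<^sup>2) * f x) =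
            (1 + norm x) ^ (2 * CARD('n)) * (norm x)\<^sup>2 * norm (f x)"
          by (simp add: norm_mult norm_power)
        also have "\<dots> \<le> (1 + norm x) ^ (2 * CARD('n)) * (1 + norm x)\<^sup>2 * norm (f x)"
          by (intro mult_right_mono mult_left_mono power_mono) auto
        also have "\<dots> = (1 + norm x) ^ (2 * CARD('n) + 2) * norm (f x)"
          by (simp add: power_add power2_eq_square)
        finally show ?thesis using B[of x] by linarith
      qed
    qed
  qed
  define K where "K = (LINT x|lborel. norm (complex_of_real ((norm x)\<^sup>2) * f x))"
  let ?D = "\<lambda>h. \<Sum>j\<in>UNIV. h $ j *\<^sub>R fourier (g j) \<xi>"
  have est: "norm ((fourier f y - fourier f \<xi>) - ?D (y - \<xi>)) \<le> K * (norm (y - \<xi>))\<^sup>2" for y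
  proof -
    define h where "h = y - \<xi>"
    \<comment> \<open>The integrand of the first-order Taylor remainder of \<open>fourier f\<close>
      at \<open>\<xi>\<close>: the exponential in the increment \<open>h\<close>, less its constant
      and linear parts.\<close>
    define r where "r x = cis (- (x \<bullet> \<xi>)) * ((cis (- (x \<bullet> h)) - 1 - \<i> * complex_of_real (- (x \<bullet> h))) * f x)" for x
    have r: "r x = cis (- (x \<bullet> y)) * f x - cis (- (x \<bullet> \<xi>)) * f x -
        (\<Sum>j\<in>UNIV. h $ j *\<^sub>R (cis (- (x \<bullet> \<xi>)) * g j x))" for x
    proof -
      have 1: "(\<Sum>j\<in>UNIV. h $ j *\<^sub>R (cis (- (x \<bullet> \<xi>)) * g j x)) =
          cis (- (x \<bullet> \<xi>)) * (- \<i> * complex_of_real (x \<bullet> h)) * f x"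
        by (simp add: g_def inner_vec_def scaleR_conv_of_real sum_distrib_left sum_distrib_right
            sum_negf[symmetric] mult_ac)
      have 2: "cis (- (x \<bullet> y)) = cis (- (x \<bullet> \<xi>)) * cis (- (x \<bullet> h))"
        by (simp add: h_def cis_mult inner_diff_right)
      show ?thesis
        unfolding 1 2 r_def by (simp add: algebra_simps)
    qed
    have "fourier f y - fourier f \<xi> - ?D h = (LINT x|lborel. r x)"
      unfolding r fourier_def
      by (simp add: Bochner_Integration.integral_diff Bochner_Integration.integral_sum
          fourier_integrable f g integrable_diff integrable_sum del: sum_subtractf)
    also have "norm \<dots> \<le> (LINT x|lborel. (norm h)\<^sup>2 * norm (complex_of_real ((norm x)\<^sup>2) * f x))"
    proof (rule order_trans[OF Bochner_Integration.integral_norm_bound integral_mono])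
      show "integrable lborel (\<lambda>x. norm (r x))"
        unfolding r
        by (intro integrable_norm Bochner_Integration.integrable_diff Bochner_Integration.integrable_sum
            integrable_scaleR_right fourier_integrable f g)
      show "integrable lborel (\<lambda>x. (norm h)\<^sup>2 * norm (complex_of_real ((norm x)\<^sup>2) * f x))"
        by (intro integrable_mult_right integrable_norm int2)
      fix x
      have "norm (cis (- (x \<bullet> h)) - 1 - \<i> * complex_of_real (- (x \<bullet> h))) \<le> (x \<bullet> h)\<^sup>2"
        using norm_cis_minus_le[of "- (x \<bullet> h)"] by simp
      also have "\<dots> \<le> (norm x * norm h)\<^sup>2"
        using Cauchy_Schwarz_ineq2[of x h] by (metis abs_ge_zero power2_abs power_mono)
      finally have "norm (cis (- (x \<bullet> h)) - 1 - \<i> * complex_of_real (- (x \<bullet> h))) * norm (f x) \<le>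
          (norm x * norm h)\<^sup>2 * norm (f x)"
        by (rule mult_right_mono) simp
      then show "norm (r x) \<le> (norm h)\<^sup>2 * norm (complex_of_real ((norm x)\<^sup>2) * f x)"
        by (simp add: r_def norm_mult norm_power power_mult_distrib mult_ac)
    qed
    also have "\<dots> = K * (norm h)\<^sup>2"
      by (simp add: K_def)
    finally show ?thesis by (simp add: h_def)
  qed
  have "(fourier f has_derivative ?D) (at \<xi>)"
  proof (rule has_derivativeI_sandwich[of 1])
    show "bounded_linear ?D"
      by (intro bounded_linear_sum bounded_linear_compose[OF bounded_linear_scaleR_left bounded_linear_vec_nth])
    show "norm (fourier f y - fourier f \<xi> - ?D (y - \<xi>)) / norm (y - \<xi>) \<le> K * norm (y - \<xi>)"
      if "y \<noteq> \<xi>" for y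
      using est[of y] that by (simp add: pos_divide_le_eq power2_eq_square mult.assoc)
    have "((\<lambda>y. K * norm (y - \<xi>)) \<longlongrightarrow> K * norm (\<xi> - \<xi>)) (at \<xi>)"
      by (intro tendsto_intros)
    then show "((\<lambda>y. K * norm (y - \<xi>)) \<longlongrightarrow> 0) (at \<xi>)" by simp
  qed simp
  then show ?thesis by (simp add: g_def)
qed

lemma partial_fourier:
  "f \<in> schwartz \<Longrightarrow> partial j (fourier f) = fourier (\<lambda>x. (- \<i> * complex_of_real (x $ j)) * f x)"
  by (rule ext, subst partial_eqI[OF has_derivative_fourier])
     (simp_all add: axis_def if_distrib[of "\<lambda>t. t *\<^sub>R _"] cong: if_cong)

text \<open>Multiplication by the monomial that becomes \<open>iter_partial js\<close> after a
  Fourier transform.\<close>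

primrec moment :: "'n list \<Rightarrow> 'n::finite cfun \<Rightarrow> 'n cfun" where
  "moment [] f = f"
| "moment (j # js) f = (\<lambda>x. (- \<i> * complex_of_real (x $ j)) * moment js f x)"

lemma moment_schwartz: "f \<in> schwartz \<Longrightarrow> moment js f \<in> schwartz"
proof (induction js)
  case (Cons j js)
  then show ?case
    using schwartz_cmult[OF schwartz_mult[OF temperate_component], of "moment js f" "-\<i>" j]
    by (simp add: mult.assoc)
qed simp

lemma moment_mult: "moment js (\<lambda>x. f x * g x) = (\<lambda>x. moment js f x * g x)"
  by (induction js) (simp_all add: mult.assoc)

lemma iter_partial_fourier:
  assumes "f \<in> schwartz"
  shows "iter_partial js (fourier f) = fourier (moment js f)"
  by (induction js)
     (simp_all add: iter_partial_Cons partial_fourier moment_schwartz assms del: iter_partial.simps(2))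

lemma smooth_fourier:
  assumes "f \<in> schwartz"
  shows "smooth (fourier f)"
  unfolding smooth_def iter_partial_fourier[OF assms]
  using has_derivative_fourier[OF moment_schwartz[OF assms]] by (auto intro: differentiableI)

text \<open>Integration by parts: the derivative of \<open>cis (- (x \<bullet> \<xi>)) * f x\<close>
  integrates to zero, and the product rule splits it into the two sides of the claim.\<close>

lemma fourier_partial:
  fixes f :: "'n::finite cfun"
  assumes f: "f \<in> schwartz"
  shows "fourier (partial j f) \<xi> = \<i> * complex_of_real (\<xi> $ j) * fourier f \<xi>"
proof -
  define h where "h x = cis (- (x \<bullet> \<xi>)) * f x" for x
  have cis': "((\<lambda>x. cis (- (x \<bullet> \<xi>))) has_derivative
      (\<lambda>y. cis (- (x \<bullet> \<xi>)) * (- \<i> * complex_of_real (y \<bullet> \<xi>)))) (at x)" for x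
  proof -
    have "((\<lambda>x. \<i> * complex_of_real (- (x \<bullet> \<xi>))) has_derivative
        (\<lambda>y. \<i> * complex_of_real (- (y \<bullet> \<xi>)))) (at x)"
      by (intro has_derivative_mult_right has_derivative_of_real has_derivative_minus
          has_derivative_inner_left has_derivative_ident)
    from has_derivative_compose[OF this DERIV_exp[THEN has_field_derivative_imp_has_derivative]]
    show ?thesis unfolding cis_conv_exp by simp
  qed
  have cisd: "(\<lambda>x. cis (- (x \<bullet> \<xi>))) differentiable (at x)" for x
    using cis' by (rule differentiableI)
  have cisp: "partial i (\<lambda>x. cis (- (x \<bullet> \<xi>))) = (\<lambda>x. cis (- (x \<bullet> \<xi>)) * (- \<i> * complex_of_real (\<xi> $ i)))" for i
    by (rule ext, subst partial_eqI[OF cis']) (simp add: inner_axis inner_axis')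
  have fd: "f differentiable (at x)" for x
    using smooth_differentiable schwartz_smooth f by blast
  \<comment> \<open>Each derivative of \<open>h\<close> is a factor of modulus 1 times a Schwartz
    function; this yields the decay under which the integral vanishes.\<close>
  have hp: "partial i h = (\<lambda>x. cis (- (x \<bullet> \<xi>)) * (partial i f x - \<i> * complex_of_real (\<xi> $ i) * f x))" for i
    unfolding h_def partial_mult[OF cisd fd] cisp by (simp add: algebra_simps)
  have hpS: "(\<lambda>x. partial i f x - \<i> * complex_of_real (\<xi> $ i) * f x) \<in> schwartz" for i
    by (intro schwartz_diff schwartz_partial schwartz_cmult f)
  have "\<exists>B. \<forall>i x. (1 + norm x) ^ (2 * CARD('n)) * norm (partial i h x) \<le> B"
  proof -
    have "\<exists>B. \<forall>x. (1 + norm x) ^ (2 * CARD('n)) * norm (partial i h x) \<le> B" for i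
    proof -
      obtain B where "\<And>x. (1 + norm x) ^ (2 * CARD('n)) *
          norm (partial i f x - \<i> * complex_of_real (\<xi> $ i) * f x) \<le> B"
        using schwartz_bound0[OF hpS[of i]] by metis
      then show ?thesis
        unfolding hp by (intro exI[of _ B]) (simp add: norm_mult)
    qed
    then obtain B where "\<And>i x. (1 + norm x) ^ (2 * CARD('n)) * norm (partial i h x) \<le> B i"
      by metis
    then have "(1 + norm x) ^ (2 * CARD('n)) * norm (partial i h x) \<le> Max (range B)" for i x
      by (rule order_trans) simp
    then show ?thesis by blast
  qed
  then obtain B where B: "\<And>i x. (1 + norm x) ^ (2 * CARD('n)) * norm (partial i h x) \<le> B"
    by blast
  have "(LINT x|lborel. partial j h x) = 0"
  proof (rule integral_partial_eq_0[OF _ _ _ B])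
    show "h differentiable (at x)" for x
      unfolding h_def by (intro differentiable_mult cisd fd)
    show "integrable lborel h"
      unfolding h_def by (rule fourier_integrable[OF f])
    show "partial j h \<in> borel_measurable borel"
      unfolding hp
      by (intro borel_measurable_continuous_onI continuous_intros smooth_continuous_on
          schwartz_smooth f schwartz_partial)
  qed
  moreover have "(LINT x|lborel. partial j h x) =
      fourier (partial j f) \<xi> - \<i> * complex_of_real (\<xi> $ j) * fourier f \<xi>"
  proof -
    have "(\<lambda>x. partial j h x) = (\<lambda>x. cis (- (x \<bullet> \<xi>)) * partial j f x -
        \<i> * complex_of_real (\<xi> $ j) * (cis (- (x \<bullet> \<xi>)) * f x))"
      unfolding hp by (simp add: algebra_simps)
    then show ?thesis
      unfolding fourier_def
      by (simp add: fourier_integrable f schwartz_partial Bochner_Integration.integral_diff)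
  qed
  ultimately show ?thesis by simp
qed

text \<open>One power of the weight is bought with one derivative, because
  \<open>\<bar>\<xi> $ j\<bar>\<close> times the modulus of \<open>fourier f \<xi>\<close> is the
  modulus of the transform of \<open>partial j f\<close>. With the sum of the coordinates as weight
  this is an identity, and that weight dominates the one with \<open>norm \<xi>\<close>.\<close>

lemma fourier_decay:
  fixes f :: "'n::finite cfun"
  assumes "f \<in> schwartz"
  shows "\<exists>B. \<forall>\<xi>. (1 + (\<Sum>j\<in>UNIV. \<bar>\<xi> $ j\<bar>)) ^ N * norm (fourier f \<xi>) \<le> B"
  using assms
proof (induction N arbitrary: f)
  case 0
  have "norm (fourier f \<xi>) \<le> (LINT x|lborel. norm (f x))" for \<xi>
    unfolding fourier_def
    by (rule order_trans[OF integral_norm_bound]) (simp add: norm_mult)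
  then show ?case by auto
next
  case (Suc N)
  let ?s = "\<lambda>\<xi>::(real, 'n) vec. 1 + (\<Sum>j\<in>UNIV. \<bar>\<xi> $ j\<bar>)"
  obtain B where B: "\<And>\<xi>. ?s \<xi> ^ N * norm (fourier f \<xi>) \<le> B"
    using Suc by blast
  have "\<exists>B. \<forall>\<xi>. ?s \<xi> ^ N * norm (fourier (partial j f) \<xi>) \<le> B" for j
    by (rule Suc.IH[OF schwartz_partial[OF Suc.prems]])
  then obtain C where C: "\<And>j \<xi>. ?s \<xi> ^ N * norm (fourier (partial j f) \<xi>) \<le> C j"
    by metis
  have "?s \<xi> ^ Suc N * norm (fourier f \<xi>) \<le> B + (\<Sum>j\<in>UNIV. C j)" for \<xi>
  proof -
    have "(\<Sum>j\<in>UNIV. norm (fourier (partial j f) \<xi>)) = (\<Sum>j\<in>UNIV. \<bar>\<xi> $ j\<bar>) * norm (fourier f \<xi>)"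
      by (simp add: fourier_partial[OF Suc.prems] norm_mult sum_distrib_right)
    then have "?s \<xi> ^ Suc N * norm (fourier f \<xi>) = ?s \<xi> ^ N * (norm (fourier f \<xi>) +
        (\<Sum>j\<in>UNIV. norm (fourier (partial j f) \<xi>)))"
      by (simp add: algebra_simps)
    also have "\<dots> = ?s \<xi> ^ N * norm (fourier f \<xi>) + (\<Sum>j\<in>UNIV. ?s \<xi> ^ N * norm (fourier (partial j f) \<xi>))"
      by (simp add: distrib_left sum_distrib_left)
    also have "\<dots> \<le> B + (\<Sum>j\<in>UNIV. C j)"
      by (intro add_mono sum_mono B C)
    finally show ?thesis .
  qed
  then show ?case by blast
qed

lemma fourier_schwartz:
  fixes f :: "'n::finite cfun"
  assumes "f \<in> schwartz"
  shows "fourier f \<in> schwartz"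
  unfolding schwartz_def
proof (intro CollectI conjI allI smooth_fourier assms)
  fix js :: "'n list" and N
  obtain B where B: "\<And>\<xi>. (1 + (\<Sum>j\<in>UNIV. \<bar>\<xi> $ j\<bar>)) ^ N * norm (fourier (moment js f) \<xi>) \<le> B"
    using fourier_decay[OF moment_schwartz[OF assms]] by metis
  have "(1 + norm \<xi>) ^ N * norm (iter_partial js (fourier f) \<xi>) \<le> B" for \<xi>
    unfolding iter_partial_fourier[OF assms]
    by (rule order_trans[OF mult_right_mono B])
       (auto intro!: power_mono simp: norm_le_l1_cart)
  then show "\<exists>B. \<forall>x. (1 + norm x) ^ N * norm (iter_partial js (fourier f) x) \<le> B" by blast
qed

section \<open>The inverse transform and its interplay with multipliers\<close>

definition fourier_const :: "'n::finite itself \<Rightarrow> complex" where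
  "fourier_const _ = of_real (1 / (2 * pi) ^ CARD('n))"

lemma fourier_inv_conv:
  fixes f :: "'n::finite cfun"
  shows "fourier_inv f x = fourier_const TYPE('n) * fourier f (- x)"
  unfolding fourier_inv_def fourier_def fourier_const_def by (simp add: inner_commute)

lemma fourier_inv_schwartz:
  fixes f :: "'n::finite cfun"
  assumes "f \<in> schwartz"
  shows "fourier_inv f \<in> schwartz"
proof -
  have "fourier_inv f = (\<lambda>x. fourier_const TYPE('n) * fourier f (0 + (- 1) * x))"
    by (rule ext) (simp add: fourier_inv_conv)
  then show ?thesis
    using schwartz_cmult[OF schwartz_affine[OF fourier_schwartz[OF assms], of "- 1" 0]] by simp
qed

text \<open>Only Fubini's theorem is needed here, not Fourier inversion.\<close>

lemma fourier_mult_fourier_inv: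
  fixes f \<psi> :: "'n::finite cfun"
  assumes f: "f \<in> schwartz" and \<psi>: "\<psi> \<in> schwartz"
  shows "fourier (\<lambda>\<xi>. \<psi> \<xi> * fourier_inv f \<xi>) y = (LINT x|lborel. f x * fourier_inv \<psi> (x - y))"
proof -
  interpret lborel_pair: pair_sigma_finite "lborel :: (real, 'n) vec measure" "lborel :: (real, 'n) vec measure" ..
  define c where "c = fourier_const TYPE('n)"
  define F where "F \<xi> x = (c * (cis (- (\<xi> \<bullet> y)) * \<psi> \<xi>)) * (cis (x \<bullet> \<xi>) * f x)" for \<xi> x
  have cinv: "fourier_inv g z = c * (LINT \<xi>|lborel. cis (z \<bullet> \<xi>) * g \<xi>)" for g :: "'n cfun" and z
    by (simp add: fourier_inv_def c_def fourier_const_def)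
  have nF: "norm (F \<xi> x) = norm c * norm (\<psi> \<xi>) * norm (f x)" for \<xi> x
    by (simp add: F_def norm_mult)
  have cont: "continuous_on UNIV f" "continuous_on UNIV \<psi>"
    using f \<psi> by (simp_all add: smooth_continuous_on schwartz_smooth)
  have contF: "continuous_on UNIV (\<lambda>p. F (fst p) (snd p))"
    unfolding F_def
    by (intro continuous_intros continuous_on_compose2[OF cont(1)] continuous_on_compose2[OF cont(2)]) auto
  have int: "integrable (lborel \<Otimes>\<^sub>M lborel) (case_prod F)"
  proof (rule lborel_pair.Fubini_integrable)
    have "case_prod F \<in> borel_measurable borel"
      unfolding case_prod_beta by (intro borel_measurable_continuous_onI contF)
    then show "case_prod F \<in> borel_measurable (lborel \<Otimes>\<^sub>M lborel)"
      by (simp add: lborel_prod)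
    show "integrable lborel (\<lambda>\<xi>. LINT x|lborel. norm (case_prod F (\<xi>, x)))"
      unfolding prod.case nF using f \<psi> by (simp add: schwartz_integrable)
    show "AE \<xi> in lborel. integrable lborel (\<lambda>x. case_prod F (\<xi>, x))"
      unfolding prod.case F_def
      by (intro AE_I2 integrable_mult_right integrable_cis_mult schwartz_integrable f continuous_intros)
  qed
  have "cis (- (\<xi> \<bullet> y)) * (\<psi> \<xi> * fourier_inv f \<xi>) = (LINT x|lborel. F \<xi> x)" for \<xi>
    unfolding F_def integral_mult_right_zero by (simp add: cinv inner_commute[of \<xi>])
  then have "fourier (\<lambda>\<xi>. \<psi> \<xi> * fourier_inv f \<xi>) y = (LINT \<xi>|lborel. LINT x|lborel. F \<xi> x)"
    unfolding fourier_def by simp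
  also have "\<dots> = (LINT x|lborel. LINT \<xi>|lborel. F \<xi> x)"
    using lborel_pair.Fubini_integral[OF int] by simp
  also have "\<dots> = (LINT x|lborel. f x * fourier_inv \<psi> (x - y))"
  proof (rule Bochner_Integration.integral_cong[OF refl])
    fix x
    have "F \<xi> x = (c * f x) * (cis ((x - y) \<bullet> \<xi>) * \<psi> \<xi>)" for \<xi>
    proof -
      have "cis ((x - y) \<bullet> \<xi>) = cis (- (\<xi> \<bullet> y)) * cis (x \<bullet> \<xi>)"
        by (simp add: cis_mult inner_diff_left inner_commute[of \<xi>])
      then show ?thesis by (simp add: F_def mult_ac)
    qed
    then show "(LINT \<xi>|lborel. F \<xi> x) = f x * fourier_inv \<psi> (x - y)"
      by (simp only: integral_mult_right_zero) (simp add: cinv)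
  qed
  finally show ?thesis .
qed

text \<open>Up to the constant, \<open>fourier_inv \<psi> (x - y)\<close> equals
  \<open>fourier \<psi> (y - x)\<close>, which in \<open>y\<close> is a translate without
  reflection. Hence derivatives in \<open>y\<close> produce moments of \<open>\<psi>\<close> and no
  signs.\<close>

lemma iter_partial_fourier_inv_shift:
  fixes \<psi> :: "'n::finite cfun"
  assumes "\<psi> \<in> schwartz"
  shows "iter_partial js (\<lambda>y. fourier_inv \<psi> (x - y)) y = fourier_inv (moment js \<psi>) (x - y)"
proof -
  have "(\<lambda>y. fourier_inv \<psi> (x - y)) = (\<lambda>y. fourier_const TYPE('n) * fourier \<psi> (- x + 1 * y))"
    by (simp add: fourier_inv_conv)
  moreover have "iter_partial js (\<lambda>y. fourier \<psi> (- x + 1 * y)) y = fourier (moment js \<psi>) (- x + y)"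
  proof -
    have "prod_list (map (($) (1 :: (real, 'n) vec)) js) = 1"
      by (induction js) simp_all
    then show ?thesis
      unfolding iter_partial_affine[OF smooth_fourier[OF assms]] iter_partial_fourier[OF assms] by simp
  qed
  moreover have "smooth (\<lambda>y. fourier \<psi> (- x + 1 * y))"
    by (rule smooth_affine[OF smooth_fourier[OF assms]])
  ultimately show ?thesis
    by (simp only: iter_partial_cmult fourier_inv_conv) simp
qed

text \<open>The formula of order zero is applied to \<open>moment js \<psi>\<close> in place of
  \<open>\<psi>\<close>, since a moment of a product can be put on its first factor. Having every
  derivative as a superposition of derivatives of translates is what permits approximation in the
  Schwartz seminorms.\<close>

lemma iter_partial_fourier_mult_fourier_inv:
  fixes f \<psi> :: "'n::finite cfun"
  assumes f: "f \<in> schwartz" and \<psi>: "\<psi> \<in> schwartz"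
  shows "iter_partial js (fourier (\<lambda>\<xi>. \<psi> \<xi> * fourier_inv f \<xi>)) y =
    (LINT x|lborel. f x * iter_partial js (\<lambda>y. fourier_inv \<psi> (x - y)) y)"
proof -
  have "(\<lambda>\<xi>. \<psi> \<xi> * fourier_inv f \<xi>) \<in> schwartz"
    by (intro schwartz_mult schwartz_temperate \<psi> fourier_inv_schwartz f)
  then show ?thesis
    by (simp only: iter_partial_fourier moment_mult fourier_mult_fourier_inv[OF f moment_schwartz[OF \<psi>]]
        iter_partial_fourier_inv_shift[OF \<psi>])
qed

section \<open>Tempered distributions and integrals\<close>

lemma fun_diff_eq_affine:
  fixes \<Psi> :: "'n::finite cfun"
  shows "(\<lambda>y. \<Psi> (x - y)) = (\<lambda>y. \<Psi> (x + (- 1) * y))"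
  by simp

lemma schwartz_shift:
  fixes \<Psi> :: "'n::finite cfun"
  assumes "\<Psi> \<in> schwartz"
  shows "(\<lambda>y. \<Psi> (x - y)) \<in> schwartz"
  unfolding fun_diff_eq_affine by (rule schwartz_affine[OF assms]) simp

lemma iter_partial_shift:
  fixes \<Psi> :: "'n::finite cfun"
  assumes "smooth \<Psi>"
  shows "iter_partial js (\<lambda>y. \<Psi> (x - y)) y = (- 1) ^ length js * iter_partial js \<Psi> (x - y)"
proof -
  have "prod_list (map (($) (- 1 :: (real, 'n) vec)) js) = (- 1) ^ length js"
    by (induction js) simp_all
  then show ?thesis
    unfolding fun_diff_eq_affine iter_partial_affine[OF assms] by simp
qed

lemma one_plus_norm_power_pos: "(1 + norm x) ^ N > 0"
  by (intro zero_less_power) (use norm_ge_zero[of x] in linarith)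

text \<open>The mean value estimate on the segment from \<open>x' - y\<close> to
  \<open>x - y\<close> costs one derivative, hence the seminorm of order \<open>Suc N\<close>. Each
  point \<open>z\<close> of the segment satisfies \<open>norm (z + y) \<le> \<bar>R\<bar>\<close>,
  so Peetre's inequality turns decay in \<open>z\<close> into decay in \<open>y\<close>.\<close>

lemma shift_lipschitz:
  fixes \<Psi> :: "'n::finite cfun"
  assumes \<Psi>: "\<Psi> \<in> schwartz"
  obtains L where "L \<ge> 0"
    "\<And>x x'. norm x \<le> R \<Longrightarrow> norm x' \<le> R \<Longrightarrow>
      seminorm_le N (\<lambda>y. \<Psi> (x - y) - \<Psi> (x' - y)) (L * norm (x - x'))"
proof -
  obtain B where B: "seminorm_le (Suc N) \<Psi> B"
    using \<Psi> unfolding schwartz_iff by blast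
  note B0 = seminorm_le_nonneg[OF B]
  have sm: "smooth \<Psi>" by (rule schwartz_smooth[OF \<Psi>])
  define L where "L = real CARD('n) * (B * (1 + \<bar>R\<bar>) ^ N)"
  show ?thesis
  proof (rule that[of L])
    show "L \<ge> 0" using B0 by (simp add: L_def)
    fix x x' :: "(real, 'n) vec"
    assume x: "norm x \<le> R" "norm x' \<le> R"
    show "seminorm_le N (\<lambda>y. \<Psi> (x - y) - \<Psi> (x' - y)) (L * norm (x - x'))"
    proof (rule seminorm_leI)
      fix js :: "'n list" and y :: "(real, 'n) vec"
      assume js: "length js \<le> N"
      have "norm (iter_partial js \<Psi> ((x' - y) + (x - x')) - iter_partial js \<Psi> (x' - y)) \<le>
          norm (x - x') * (real CARD('n) * (B * (1 + \<bar>R\<bar>) ^ N / (1 + norm y) ^ N))"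
      proof (rule partial_mean_value)
        show "iter_partial js \<Psi> differentiable (at z)" for z
          by (rule smooth_differentiable[OF smooth_iter_partial[OF sm]])
        fix i and t :: real
        assume t: "0 \<le> t" "t \<le> 1"
        define z where "z = x' - y + t *\<^sub>R (x - x')"
        have "norm (z + y) = norm ((1 - t) *\<^sub>R x' + t *\<^sub>R x)"
          by (simp add: z_def algebra_simps)
        also have "\<dots> \<le> (1 - t) * norm x' + t * norm x"
          using t by (intro norm_triangle_le) simp
        also have "\<dots> \<le> (1 - t) * R + t * R"
          using t x by (intro add_mono mult_left_mono) auto
        finally have zy: "norm (z + y) \<le> \<bar>R\<bar>" by (simp add: algebra_simps)
        have "(1 + norm y) ^ N \<le> (1 + norm (- z)) ^ N * (1 + norm (y - (- z))) ^ N"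
          by (rule peetre_power)
        also have "\<dots> \<le> (1 + norm z) ^ Suc N * (1 + \<bar>R\<bar>) ^ N"
          using zy power_increasing[of N "Suc N" "1 + norm z"]
          by (intro mult_mono power_mono) (auto simp: add.commute simp del: power_Suc)
        finally have le: "(1 + norm y) ^ N \<le> (1 + norm z) ^ Suc N * (1 + \<bar>R\<bar>) ^ N" .
        have "norm (partial i (iter_partial js \<Psi>) z) \<le> B / (1 + norm z) ^ Suc N"
          using seminorm_leD[OF B, of "i # js" z] js by (simp add: iter_partial_Cons del: iter_partial.simps(2))
        also have "\<dots> \<le> B * (1 + \<bar>R\<bar>) ^ N / (1 + norm y) ^ N"
        proof -
          have "B * (1 + norm y) ^ N \<le> B * ((1 + norm z) ^ Suc N * (1 + \<bar>R\<bar>) ^ N)"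
            by (rule mult_left_mono[OF le B0])
          then show ?thesis
            using one_plus_norm_power_pos[of z "Suc N"] one_plus_norm_power_pos[of y N]
            by (simp add: divide_simps mult_ac del: power_Suc)
        qed
        finally show "norm (partial i (iter_partial js \<Psi>) (x' - y + t *\<^sub>R (x - x'))) \<le>
            B * (1 + \<bar>R\<bar>) ^ N / (1 + norm y) ^ N"
          by (simp add: z_def)
      qed
      also have "(x' - y) + (x - x') = x - y" by simp
      finally have "norm (iter_partial js \<Psi> (x - y) - iter_partial js \<Psi> (x' - y)) \<le>
          L * norm (x - x') / (1 + norm y) ^ N"
        by (simp add: L_def mult_ac)
      moreover have "iter_partial js (\<lambda>y. \<Psi> (x - y) - \<Psi> (x' - y)) y =
          (- 1) ^ length js * (iter_partial js \<Psi> (x - y) - iter_partial js \<Psi> (x' - y))"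
        by (simp only: iter_partial_diff[OF schwartz_smooth[OF schwartz_shift[OF \<Psi>]]
              schwartz_smooth[OF schwartz_shift[OF \<Psi>]]] iter_partial_shift[OF sm] right_diff_distrib)
      ultimately show "norm (iter_partial js (\<lambda>y. \<Psi> (x - y) - \<Psi> (x' - y)) y) \<le>
          L * norm (x - x') / (1 + norm y) ^ N"
        by (simp add: norm_mult norm_power)
    qed
  qed
qed

lemma
  assumes "u \<in> tempered_distributions"
  shows tempered_add: "f \<in> schwartz \<Longrightarrow> g \<in> schwartz \<Longrightarrow> u (\<lambda>x. f x + g x) = u f + u g"
    and tempered_cmult: "f \<in> schwartz \<Longrightarrow> u (\<lambda>x. c * f x) = c * u f"
  using assms by (auto simp: tempered_distributions_def linear_functional_on_def)

lemma tempered_diff: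
  assumes "u \<in> tempered_distributions" "f \<in> schwartz" "g \<in> schwartz"
  shows "u (\<lambda>x. f x - g x) = u f - u g"
  using tempered_add[OF assms(1,2) schwartz_cmult[OF assms(3), of "-1"]]
    tempered_cmult[OF assms(1,3), of "-1"] by simp

lemma schwartz_sum:
  fixes f :: "'i \<Rightarrow> 'n::finite cfun"
  assumes "finite A" "\<And>a. a \<in> A \<Longrightarrow> f a \<in> schwartz"
  shows "(\<lambda>y. \<Sum>a\<in>A. c a * f a y) \<in> schwartz"
  using assms
proof (induction A)
  case empty
  have "(\<lambda>y. 0) \<in> (schwartz :: 'n cfun set)"
    by (rule test_functions_schwartz[of _ UNIV])
       (simp add: test_functions_def smooth_const supp_def)
  then show ?case by simp
next
  case (insert a A)
  then show ?case by (simp add: schwartz_add schwartz_cmult)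
qed

lemma tempered_sum:
  fixes f :: "'i \<Rightarrow> 'n::finite cfun"
  assumes "u \<in> tempered_distributions" "finite A" "\<And>a. a \<in> A \<Longrightarrow> f a \<in> schwartz"
  shows "u (\<lambda>y. \<Sum>a\<in>A. c a * f a y) = (\<Sum>a\<in>A. c a * u (f a))"
  using assms(2,3)
proof (induction A)
  case empty
  have "(\<lambda>y. 0) \<in> (schwartz :: 'n cfun set)"
    using schwartz_sum[of "{}" "\<lambda>_::'i. \<lambda>_. 0"] by simp
  from tempered_cmult[OF assms(1) this, of 0] show ?case by simp
next
  case (insert a A)
  then show ?case
    by (simp add: tempered_add[OF assms(1)] tempered_cmult[OF assms(1)] schwartz_cmult schwartz_sum)
qed

lemma iter_partial_sum:
  fixes f :: "'i \<Rightarrow> 'n::finite cfun"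
  assumes "finite A" "\<And>a. a \<in> A \<Longrightarrow> f a \<in> schwartz"
  shows "iter_partial js (\<lambda>y. \<Sum>a\<in>A. c a * f a y) y = (\<Sum>a\<in>A. c a * iter_partial js (f a) y)"
  using assms
proof (induction A)
  case empty
  show ?case by (simp add: iter_partial_const)
next
  case (insert a A)
  then show ?case
    by (simp add: iter_partial_add iter_partial_cmult smooth_cmult schwartz_smooth schwartz_sum)
qed

text \<open>The bound is asked for only where \<open>f\<close> does not vanish, so that
  \<open>g\<close> may grow at infinity when \<open>f\<close> has bounded support.\<close>

lemma integrable_mult_bounded:
  fixes f g :: "'a::euclidean_space \<Rightarrow> complex"
  assumes "integrable lborel f" "g \<in> borel_measurable borel" "\<And>x. f x \<noteq> 0 \<Longrightarrow> norm (g x) \<le> K"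
  shows "integrable lborel (\<lambda>x. f x * g x)"
proof (rule Bochner_Integration.integrable_bound)
  show "integrable lborel (\<lambda>x. K *\<^sub>R f x)"
    by (intro integrable_scaleR_right assms(1))
  show "(\<lambda>x. f x * g x) \<in> borel_measurable lborel"
    using assms(1,2) borel_measurable_integrable by force
  have "norm (f x * g x) \<le> norm (K *\<^sub>R f x)" for x
  proof (cases "f x = 0")
    case False
    then have "norm (g x) \<le> \<bar>K\<bar>" using assms(3)[of x] by linarith
    then show ?thesis
      by (simp add: norm_mult mult.commute[of "\<bar>K\<bar>"] mult_left_mono)
  qed simp
  then show "AE x in lborel. norm (f x * g x) \<le> norm (K *\<^sub>R f x)" by simp
qed

text \<open>As \<open>p\<close> has finitely many values, the integral is a finite sum whose
  coefficients, the integrals of \<open>f\<close> over the level sets, do not depend on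
  \<open>g\<close>. The same coefficients therefore describe the derivatives of an approximating sum
  and the value of \<open>u\<close> on it.\<close>

lemma integral_simple_function_comp:
  fixes f :: "'a::euclidean_space \<Rightarrow> complex" and g :: "'b \<Rightarrow> complex"
  assumes f: "integrable lborel f" and p: "simple_function lborel p"
  shows "integrable lborel (\<lambda>x. f x * g (p x))"
    and "(LINT x|lborel. f x * g (p x)) =
      (\<Sum>a\<in>range p. (LINT x|lborel. indicator (p -` {a}) x *\<^sub>R f x) * g a)"
proof -
  have fin: "finite (range p)" and meas: "p -` {a} \<in> sets lborel" for a
    using p simple_functionD(2)[OF p, of "{a}"] by (simp_all add: simple_function_def)
  have eq: "f x * g (p x) = (\<Sum>a\<in>range p. (indicator (p -` {a}) x *\<^sub>R f x) * g a)" for x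
  proof -
    have "(\<Sum>a\<in>range p. (indicator (p -` {a}) x *\<^sub>R f x) * g a) =
        (\<Sum>a\<in>range p. if p x = a then f x * g a else 0)"
      by (intro sum.cong) (auto simp: indicator_def)
    also have "\<dots> = f x * g (p x)"
      using fin by simp
    finally show ?thesis ..
  qed
  have int: "integrable lborel (\<lambda>x. (indicator (p -` {a}) x *\<^sub>R f x) * g a)" for a
    by (intro integrable_mult_left integrable_mult_indicator meas f)
  show "integrable lborel (\<lambda>x. f x * g (p x))"
    unfolding eq by (intro Bochner_Integration.integrable_sum int)
  show "(LINT x|lborel. f x * g (p x)) =
      (\<Sum>a\<in>range p. (LINT x|lborel. indicator (p -` {a}) x *\<^sub>R f x) * g a)"
    unfolding eq by (subst Bochner_Integration.integral_sum) (simp_all only: int integral_mult_left_zero)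
qed

lemma tempered_shift_lipschitz:
  fixes \<Psi> :: "'n::finite cfun"
  assumes u: "u \<in> tempered_distributions" and \<Psi>: "\<Psi> \<in> schwartz"
  obtains L where "L \<ge> 0"
    "\<And>x x'. norm x \<le> R \<Longrightarrow> norm x' \<le> R \<Longrightarrow>
      norm (u (\<lambda>y. \<Psi> (x - y)) - u (\<lambda>y. \<Psi> (x' - y))) \<le> L * norm (x - x')"
proof -
  obtain C N where C: "C \<ge> 0" "\<And>f B. f \<in> schwartz \<Longrightarrow> seminorm_le N f B \<Longrightarrow> norm (u f) \<le> C * B"
    by (rule tempered_bound[OF u]) blast
  obtain L where L: "L \<ge> 0" "\<And>x x'. norm x \<le> R \<Longrightarrow> norm x' \<le> R \<Longrightarrow>
      seminorm_le N (\<lambda>y. \<Psi> (x - y) - \<Psi> (x' - y)) (L * norm (x - x'))"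
    by (rule shift_lipschitz[OF \<Psi>, of R N]) blast
  show ?thesis
  proof (rule that[of "C * L"])
    show "C * L \<ge> 0" using C L by simp
    fix x x' :: "(real, 'n) vec"
    assume "norm x \<le> R" "norm x' \<le> R"
    then have "norm (u (\<lambda>y. \<Psi> (x - y) - \<Psi> (x' - y))) \<le> C * (L * norm (x - x'))"
      by (intro C L schwartz_diff schwartz_shift \<Psi>)
    then show "norm (u (\<lambda>y. \<Psi> (x - y)) - u (\<lambda>y. \<Psi> (x' - y))) \<le> C * L * norm (x - x')"
      by (simp add: tempered_diff[OF u] schwartz_shift \<Psi> mult.assoc)
  qed
qed

lemma continuous_tempered_shift:
  fixes \<Psi> :: "'n::finite cfun"
  assumes u: "u \<in> tempered_distributions" and \<Psi>: "\<Psi> \<in> schwartz"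
  shows "continuous_on UNIV (\<lambda>x. u (\<lambda>y. \<Psi> (x - y)))"
proof (rule continuous_at_imp_continuous_on, rule ballI)
  fix x :: "(real, 'n) vec"
  let ?W = "\<lambda>x. u (\<lambda>y. \<Psi> (x - y))"
  obtain L where L: "L \<ge> 0" "\<And>z z'. norm z \<le> norm x + 1 \<Longrightarrow> norm z' \<le> norm x + 1 \<Longrightarrow>
      norm (?W z - ?W z') \<le> L * norm (z - z')"
    by (rule tempered_shift_lipschitz[OF u \<Psi>, of "norm x + 1"]) blast
  have "\<forall>\<^sub>F z in at x. norm (?W z - ?W x) \<le> L * norm (z - x)"
  proof -
    have "norm (?W z - ?W x) \<le> L * norm (z - x)" if "dist z x < 1" for z
    proof (rule L)
      show "norm z \<le> norm x + 1"
        using that norm_triangle_ineq2[of z x] by (simp add: dist_norm)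
    qed simp
    then show ?thesis
      unfolding eventually_at by (intro exI[of _ 1]) auto
  qed
  moreover have "((\<lambda>z. L * norm (z - x)) \<longlongrightarrow> L * norm (x - x)) (at x)"
    by (intro tendsto_intros)
  then have "((\<lambda>z. L * norm (z - x)) \<longlongrightarrow> 0) (at x)" by simp
  ultimately have "((\<lambda>z. ?W z - ?W x) \<longlongrightarrow> 0) (at x)"
    by (rule Lim_null_comparison)
  then show "isCont ?W x"
    unfolding isCont_def by (rule LIM_zero_cancel)
qed

text \<open>The proof approximates the identity by simple functions \<open>p i\<close>, for which the claim is linearity;
  the Lipschitz bounds control both errors by the integral of \<open>norm (f x) * norm (x - p i x)\<close>.\<close>

lemma tempered_integral_interchange:
  fixes f H \<Psi> :: "'n::finite cfun"
  assumes u: "u \<in> tempered_distributions" and f: "f \<in> schwartz" and \<Psi>: "\<Psi> \<in> schwartz"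
    and H: "H \<in> schwartz"
    and fR: "\<And>x. f x \<noteq> 0 \<Longrightarrow> norm x \<le> R"
    and dH: "\<And>js y. iter_partial js H y = (LINT x|lborel. f x * iter_partial js (\<lambda>y. \<Psi> (x - y)) y)"
  shows "u H = (LINT x|lborel. f x * u (\<lambda>y. \<Psi> (x - y)))"
proof -
  let ?W = "\<lambda>x. u (\<lambda>y. \<Psi> (x - y))"
  obtain C N where C: "C \<ge> 0" "\<And>f B. f \<in> schwartz \<Longrightarrow> seminorm_le N f B \<Longrightarrow> norm (u f) \<le> C * B"
    by (rule tempered_bound[OF u]) blast
  \<comment> \<open>The radius is \<open>2 * R\<close> because the simple functions below satisfy
    \<open>norm (p i x) \<le> 2 * norm x\<close>: where \<open>f x\<close> is nonzero, both
    \<open>x\<close> and \<open>p i x\<close> lie in this ball.\<close>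
  obtain L where L: "L \<ge> 0" "\<And>x x'. norm x \<le> 2 * R \<Longrightarrow> norm x' \<le> 2 * R \<Longrightarrow>
      seminorm_le N (\<lambda>y. \<Psi> (x - y) - \<Psi> (x' - y)) (L * norm (x - x'))"
    by (rule shift_lipschitz[OF \<Psi>, of "2 * R" N]) blast
  obtain L' where L': "L' \<ge> 0" "\<And>x x'. norm x \<le> 2 * R \<Longrightarrow> norm x' \<le> 2 * R \<Longrightarrow>
      norm (?W x - ?W x') \<le> L' * norm (x - x')"
    by (rule tempered_shift_lipschitz[OF u \<Psi>, of "2 * R"]) blast
  have intf: "integrable lborel f" by (rule schwartz_integrable[OF f])
  then have [measurable]: "f \<in> borel_measurable borel"
    using borel_measurable_integrable by force
  have "(\<lambda>x::(real, 'n) vec. x) \<in> borel_measurable lborel" by simp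
  from borel_measurable_implies_sequence_metric[OF this, of 0]
  obtain p :: "nat \<Rightarrow> (real, 'n) vec \<Rightarrow> (real, 'n) vec"
    where p: "\<And>i. simple_function lborel (p i)" and plim: "\<And>x. (\<lambda>i. p i x) \<longlonglongrightarrow> x"
      and pb: "\<And>i x. norm (p i x) \<le> 2 * norm x"
    by auto
  have [measurable]: "p i \<in> borel_measurable borel" for i
    using borel_measurable_simple_function[OF p[of i]] by simp
  define \<delta> where "\<delta> i = (LINT x|lborel. norm (f x) * norm (x - p i x))" for i
  have \<delta>bd: "norm (norm (f x) * norm (x - p i x)) \<le> 3 * R * norm (f x)" for i x
  proof (cases "f x = 0")
    case False
    have "norm (x - p i x) \<le> 3 * R"
      using norm_triangle_ineq4[of x "p i x"] pb[of i x] fR[OF False] by linarith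
    then have "norm (f x) * norm (x - p i x) \<le> norm (f x) * (3 * R)"
      by (rule mult_left_mono) simp
    then show ?thesis by (simp add: abs_mult mult_ac)
  qed simp
  have int3: "integrable lborel (\<lambda>x. 3 * R * norm (f x))"
    by (intro integrable_mult_right integrable_norm intf)
  have \<delta>int: "integrable lborel (\<lambda>x. norm (f x) * norm (x - p i x))" for i
    by (rule Bochner_Integration.integrable_bound[OF int3])
       (use \<delta>bd[of _ i] in \<open>simp_all add: order_trans[OF _ abs_ge_self]\<close>)
  have "\<delta> \<longlonglongrightarrow> (LINT x|lborel. norm (f x) * norm (x - x :: (real, 'n) vec))"
    unfolding \<delta>_def
  proof (rule integral_dominated_convergence[OF _ _ int3])
    show "AE x in lborel. (\<lambda>i. norm (f x) * norm (x - p i x)) \<longlonglongrightarrow> norm (f x) * norm (x - x)"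
      by (intro AE_I2 tendsto_intros plim)
  qed (use \<delta>bd in simp_all)
  then have \<delta>lim: "\<delta> \<longlonglongrightarrow> 0" by simp
  have W_meas: "?W \<in> borel_measurable borel"
    by (intro borel_measurable_continuous_onI continuous_tempered_shift u \<Psi>)
  have W_int: "integrable lborel (\<lambda>x. f x * ?W x)"
  proof (rule integrable_mult_bounded[OF intf W_meas])
    fix x assume "f x \<noteq> 0"
    then have "norm x \<le> R" by (rule fR)
    then have "norm x \<le> 2 * R" "norm (0 :: (real, 'n) vec) \<le> 2 * R"
      unfolding norm_zero using norm_ge_zero[of x] by linarith+
    then have "norm (?W x - ?W 0) \<le> L' * norm (x - 0)"
      by (rule L')
    also have "\<dots> \<le> L' * R"
      using L'(1) \<open>norm x \<le> R\<close> by (simp add: mult_left_mono)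
    finally show "norm (?W x) \<le> norm (?W 0) + L' * R"
      using norm_triangle_ineq2[of "?W x" "?W 0"] by linarith
  qed
  define c where "c i a = (LINT x|lborel. indicator (p i -` {a}) x *\<^sub>R f x)" for i a
  \<comment> \<open>The integral for \<open>H\<close> with \<open>p i x\<close> in place of
    \<open>x\<close> inside the kernel, written as a finite combination of translates.\<close>
  define S where "S i = (\<lambda>y. \<Sum>a\<in>range (p i). c i a * \<Psi> (a - y))" for i
  have fin: "finite (range (p i))" for i
    using p[of i] by (simp add: simple_function_def)
  have S: "S i \<in> schwartz" for i
    unfolding S_def by (intro schwartz_sum fin schwartz_shift \<Psi>)
  have uS: "u (S i) = (LINT x|lborel. f x * ?W (p i x))" for i
    unfolding S_def integral_simple_function_comp(2)[OF intf p, where g = ?W] c_def[symmetric]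
    by (rule tempered_sum[OF u fin]) (rule schwartz_shift[OF \<Psi>])
  have pR: "norm x \<le> 2 * R \<and> norm (p i x) \<le> 2 * R" if "f x \<noteq> 0" for i x
    using fR[OF that] pb[of i x] norm_ge_zero[of x] by linarith
  have "seminorm_le N (\<lambda>y. H y - S i y) (L * \<delta> i)" for i
  proof (rule seminorm_leI)
    fix js :: "'n list" and y :: "(real, 'n) vec"
    assume js: "length js \<le> N"
    let ?d = "\<lambda>x. iter_partial js (\<lambda>y. \<Psi> (x - y)) y"
    have d_meas: "?d \<in> borel_measurable borel"
    proof -
      have "continuous_on UNIV (\<lambda>x. iter_partial js \<Psi> (x - y))"
        by (rule continuous_on_compose2[OF smooth_continuous_on[OF smooth_iter_partial[OF schwartz_smooth[OF \<Psi>]]]])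
           (auto intro: continuous_intros)
      then show ?thesis
        unfolding iter_partial_shift[OF schwartz_smooth[OF \<Psi>]]
        by (intro borel_measurable_continuous_onI continuous_intros)
    qed
    obtain K where K: "\<And>z. norm (iter_partial js \<Psi> z) \<le> K"
      using schwartz_bound[OF \<Psi>, of 0 js] by auto
    have int1: "integrable lborel (\<lambda>x. f x * ?d x)"
      by (rule integrable_mult_bounded[OF intf d_meas, of K])
         (simp add: iter_partial_shift[OF schwartz_smooth[OF \<Psi>]] norm_mult norm_power K)
    have int2: "integrable lborel (\<lambda>x. f x * ?d (p i x))"
      by (rule integral_simple_function_comp(1)[OF intf p, where g = ?d])
    have "iter_partial js (S i) y = (LINT x|lborel. f x * ?d (p i x))"
      unfolding S_def integral_simple_function_comp(2)[OF intf p, where g = ?d] c_def[symmetric]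
      by (rule iter_partial_sum[OF fin schwartz_shift[OF \<Psi>]])
    then have "iter_partial js (\<lambda>y. H y - S i y) y = (LINT x|lborel. f x * ?d x - f x * ?d (p i x))"
      using int1 int2 by (simp add: iter_partial_diff schwartz_smooth H S dH)
    also have "norm \<dots> \<le> (LINT x|lborel. norm (f x * ?d x - f x * ?d (p i x)))"
      by (rule Bochner_Integration.integral_norm_bound)
    also have "\<dots> \<le> (LINT x|lborel. L / (1 + norm y) ^ N * (norm (f x) * norm (x - p i x)))"
    proof (rule integral_mono)
      show "integrable lborel (\<lambda>x. norm (f x * ?d x - f x * ?d (p i x)))"
        by (intro integrable_norm Bochner_Integration.integrable_diff int1 int2)
      show "integrable lborel (\<lambda>x. L / (1 + norm y) ^ N * (norm (f x) * norm (x - p i x)))"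
        by (intro integrable_mult_right \<delta>int)
      fix x
      show "norm (f x * ?d x - f x * ?d (p i x)) \<le> L / (1 + norm y) ^ N * (norm (f x) * norm (x - p i x))"
      proof (cases "f x = 0")
        case False
        have "norm (?d x - ?d (p i x)) =
            norm (iter_partial js (\<lambda>y. \<Psi> (x - y) - \<Psi> (p i x - y)) y)"
          by (simp add: iter_partial_diff schwartz_smooth schwartz_shift \<Psi>)
        also have "\<dots> \<le> L * norm (x - p i x) / (1 + norm y) ^ N"
          using pR[OF False, of i] by (intro seminorm_leD[OF L(2)] js) auto
        finally have "norm (f x) * norm (?d x - ?d (p i x)) \<le>
            norm (f x) * (L * norm (x - p i x) / (1 + norm y) ^ N)"
          by (rule mult_left_mono) simp
        then show ?thesis
          by (simp add: right_diff_distrib[symmetric] norm_mult mult_ac)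
      qed simp
    qed
    also have "\<dots> = L * \<delta> i / (1 + norm y) ^ N"
      by (simp add: \<delta>_def)
    finally show "norm (iter_partial js (\<lambda>y. H y - S i y) y) \<le> L * \<delta> i / (1 + norm y) ^ N" .
  qed
  then have est1: "norm (u H - u (S i)) \<le> C * (L * \<delta> i)" for i
    using C(2)[OF schwartz_diff[OF H S]] by (simp add: tempered_diff[OF u H S])
  have est2: "norm (u (S i) - (LINT x|lborel. f x * ?W x)) \<le> L' * \<delta> i" for i
  proof -
    have int2: "integrable lborel (\<lambda>x. f x * ?W (p i x))"
      by (rule integral_simple_function_comp(1)[OF intf p, where g = ?W])
    have "norm ((LINT x|lborel. f x * ?W x) - u (S i)) = norm (LINT x|lborel. f x * ?W x - f x * ?W (p i x))"
      unfolding uS using int2 W_int by simp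
    also have "\<dots> \<le> (LINT x|lborel. norm (f x * ?W x - f x * ?W (p i x)))"
      by (rule Bochner_Integration.integral_norm_bound)
    also have "\<dots> \<le> (LINT x|lborel. L' * (norm (f x) * norm (x - p i x)))"
    proof (rule integral_mono)
      show "integrable lborel (\<lambda>x. norm (f x * ?W x - f x * ?W (p i x)))"
        by (intro integrable_norm Bochner_Integration.integrable_diff int2 W_int)
      show "integrable lborel (\<lambda>x. L' * (norm (f x) * norm (x - p i x)))"
        by (intro integrable_mult_right \<delta>int)
      fix x
      show "norm (f x * ?W x - f x * ?W (p i x)) \<le> L' * (norm (f x) * norm (x - p i x))"
      proof (cases "f x = 0")
        case False
        have "norm (?W x - ?W (p i x)) \<le> L' * norm (x - p i x)"
          using pR[OF False, of i] by (intro L') auto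
        then have "norm (f x) * norm (?W x - ?W (p i x)) \<le> norm (f x) * (L' * norm (x - p i x))"
          by (rule mult_left_mono) simp
        then show ?thesis
          by (simp add: right_diff_distrib[symmetric] norm_mult mult_ac)
      qed simp
    qed
    also have "\<dots> = L' * \<delta> i" by (simp add: \<delta>_def)
    finally show ?thesis by (simp add: norm_minus_commute)
  qed
  have est: "norm (u H - (LINT x|lborel. f x * ?W x)) \<le> (C * L + L') * \<delta> i" for i
  proof -
    have "norm (u H - (LINT x|lborel. f x * ?W x)) \<le>
        norm (u H - u (S i)) + norm (u (S i) - (LINT x|lborel. f x * ?W x))"
      using norm_triangle_ineq[of "u H - u (S i)" "u (S i) - (LINT x|lborel. f x * ?W x)"] by simp
    also have "\<dots> \<le> C * (L * \<delta> i) + L' * \<delta> i"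
      by (rule add_mono[OF est1 est2])
    finally show ?thesis by (simp only: distrib_right mult.assoc)
  qed
  have "(\<lambda>i. (C * L + L') * \<delta> i) \<longlonglongrightarrow> (C * L + L') * 0"
    by (intro tendsto_intros \<delta>lim)
  then have "(\<lambda>i. (C * L + L') * \<delta> i) \<longlonglongrightarrow> 0" by simp
  then have "norm (u H - (LINT x|lborel. f x * ?W x)) \<le> 0"
    by (rule LIMSEQ_le_const) (use est in blast)
  then show ?thesis by simp
qed

section \<open>Regularisations as convolutions\<close>

lemma test_functions_bounded_support:
  assumes "\<phi> \<in> test_functions \<Omega>"
  obtains R where "\<And>x. \<phi> x \<noteq> 0 \<Longrightarrow> norm x \<le> R"
proof -
  have "bounded (supp \<phi>)"
    using assms by (simp add: test_functions_def compact_imp_bounded)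
  then obtain R where "\<And>x. x \<in> supp \<phi> \<Longrightarrow> norm x \<le> R"
    unfolding bounded_iff by blast
  then show ?thesis
    using that not_in_supp[of _ \<phi>] by blast
qed

text \<open>The convolution of \<open>u\<close> with \<open>fourier_inv \<psi>\<close>.\<close>

definition smoothing_fun :: "'n::finite cfun \<Rightarrow> 'n functional \<Rightarrow> 'n cfun" where
  "smoothing_fun \<psi> u = (\<lambda>x. u (\<lambda>y. fourier_inv \<psi> (x - y)))"

lemma continuous_smoothing_fun:
  "u \<in> tempered_distributions \<Longrightarrow> \<psi> \<in> schwartz \<Longrightarrow> continuous_on UNIV (smoothing_fun \<psi> u)"
  unfolding smoothing_fun_def by (intro continuous_tempered_shift fourier_inv_schwartz)

text \<open>By definition all three operations fall on \<open>\<phi>\<close>, and \<open>u\<close>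
  is evaluated at the resulting Schwartz function. That function is an integral of translates of
  \<open>fourier_inv \<psi>\<close> with density \<open>\<phi>\<close>, so \<open>u\<close> can be
  moved inside.\<close>

lemma fourier_inv_dist_mult_dist:
  fixes \<psi> \<phi> :: "'n::finite cfun"
  assumes u: "u \<in> tempered_distributions" and \<psi>: "\<psi> \<in> schwartz" and \<phi>: "\<phi> \<in> test_functions UNIV"
  shows "fourier_inv_dist (mult_dist \<psi> (fourier_dist u)) \<phi> = (LINT x|lborel. smoothing_fun \<psi> u x * \<phi> x)"
proof -
  obtain R where R: "\<And>x. \<phi> x \<noteq> 0 \<Longrightarrow> norm x \<le> R"
    by (rule test_functions_bounded_support[OF \<phi>]) blast
  have \<phi>S: "\<phi> \<in> schwartz" by (rule test_functions_schwartz[OF \<phi>])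
  have prod: "(\<lambda>\<xi>. \<psi> \<xi> * fourier_inv \<phi> \<xi>) \<in> schwartz"
    by (intro schwartz_mult schwartz_temperate \<psi> fourier_inv_schwartz \<phi>S)
  have "fourier_inv_dist (mult_dist \<psi> (fourier_dist u)) \<phi> = u (fourier (\<lambda>\<xi>. \<psi> \<xi> * fourier_inv \<phi> \<xi>))"
    by (simp add: fourier_inv_dist_def mult_dist_def fourier_dist_def \<phi>S prod fourier_inv_schwartz)
  also have "\<dots> = (LINT x|lborel. \<phi> x * u (\<lambda>y. fourier_inv \<psi> (x - y)))"
    by (rule tempered_integral_interchange[OF u \<phi>S fourier_inv_schwartz[OF \<psi>] fourier_schwartz[OF prod] R])
       (simp_all add: iter_partial_fourier_mult_fourier_inv[OF \<phi>S \<psi>])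
  finally show ?thesis
    by (simp add: smoothing_fun_def mult.commute)
qed

section \<open>Cutoff functions\<close>

text \<open>For t > 0 this is exp(-1/t) / t^m. The powers are included so that the linear span of
  the family is closed under differentiation.\<close>

definition flat :: "nat \<Rightarrow> real \<Rightarrow> real" where
  "flat m t = (if t > 0 then exp (- inverse t) * inverse t ^ m else 0)"

lemma flat_nonneg: "flat m t \<ge> 0"
  by (simp add: flat_def)

text \<open>A bound of second order makes the derivative at 0 exist and vanish. It comes from s^k
  \<le> exp(k s) with k = m + 2 and k s = 1/t; of the k powers of t gained, two survive the division
  by t^m.\<close>

lemma flat_le: "flat m t \<le> real (m + 2) ^ (m + 2) * t\<^sup>2"
proof (cases "t > 0")
  case True
  define k where "k = m + 2"
  define s where "s = inverse t / real k"
  have k: "real k > 0" by (simp add: k_def)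
  have s: "s > 0" using True k by (simp add: s_def)
  have "s ^ k \<le> exp s ^ k"
    using exp_ge_add_one_self[of s] s by (intro power_mono) linarith+
  also have "\<dots> = exp (inverse t)"
    using k by (simp add: s_def exp_of_nat_mult[symmetric])
  finally have "exp (- inverse t) \<le> inverse (s ^ k)"
    using s by (simp add: exp_minus le_imp_inverse_le)
  also have "\<dots> = real k ^ k * t ^ k"
    using True by (simp add: s_def power_divide field_simps power_inverse)
  finally have "exp (- inverse t) * inverse t ^ m \<le> real k ^ k * t ^ k * inverse t ^ m"
    using True by (intro mult_right_mono) auto
  moreover have "t ^ k * inverse t ^ m = t\<^sup>2"
    using True by (simp add: k_def power_add power_inverse power2_eq_square field_simps)
  ultimately have "exp (- inverse t) * inverse t ^ m \<le> real k ^ k * t\<^sup>2"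
    by (simp only: mult.assoc)
  then show ?thesis
    using True unfolding flat_def k_def by simp
qed (simp add: flat_def)

lemma flat_deriv: "(flat m has_real_derivative (flat (m + 2) t - real m * flat (m + 1) t)) (at t)"
proof -
  consider "t > 0" | "t < 0" | "t = 0" by linarith
  then show ?thesis
  proof cases
    case 1
    have "((\<lambda>t. exp (- inverse t) * inverse t ^ m) has_real_derivative
        flat (m + 2) t - real m * flat (m + 1) t) (at t)"
    proof -
      have i: "(inverse has_real_derivative - (inverse t * inverse t)) (at t)"
        using 1 by (auto intro!: derivative_eq_intros)
      have e: "((\<lambda>t. exp (- inverse t)) has_real_derivative exp (- inverse t) * (inverse t * inverse t)) (at t)"
        using DERIV_fun_exp[OF DERIV_minus[OF i]] by simp
      show ?thesis
        by (rule DERIV_cong[OF DERIV_mult[OF e DERIV_power[OF i]]])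
           (use 1 in \<open>cases m; simp add: flat_def power2_eq_square algebra_simps\<close>)
    qed
    then show ?thesis
      by (rule has_field_derivative_transform_within_open[of _ _ _ "{0<..}"])
         (use 1 in \<open>auto simp: flat_def\<close>)
  next
    case 2
    have "((\<lambda>t. 0) has_real_derivative 0) (at t)" by simp
    then have "(flat m has_real_derivative 0) (at t)"
      by (rule has_field_derivative_transform_within_open[of _ _ _ "{..<0}"])
         (use 2 in \<open>auto simp: flat_def\<close>)
    then show ?thesis using 2 by (simp add: flat_def)
  next
    case 3
    define K where "K = real (m + 2) ^ (m + 2)"
    have "((\<lambda>h. (flat m (0 + h) - flat m 0) / h) \<longlongrightarrow> 0) (at 0)"
    proof (rule Lim_null_comparison)
      have "norm ((flat m (0 + h) - flat m 0) / h) \<le> K * \<bar>h\<bar>" for h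
      proof (cases "h = 0")
        case False
        have "flat m h \<le> K * (\<bar>h\<bar> * \<bar>h\<bar>)"
          using flat_le[of m h] by (simp only: K_def power2_eq_square abs_mult_self_eq)
        then show ?thesis
          using False flat_nonneg[of m h] by (simp add: flat_def[of m 0] pos_divide_le_eq mult.assoc)
      qed simp
      then show "\<forall>\<^sub>F h in at 0. norm ((flat m (0 + h) - flat m 0) / h) \<le> K * \<bar>h\<bar>"
        by simp
      have "((\<lambda>h. K * \<bar>h\<bar>) \<longlongrightarrow> K * \<bar>0\<bar>) (at 0)"
        by (intro tendsto_intros)
      then show "((\<lambda>h. K * \<bar>h\<bar>) \<longlongrightarrow> 0) (at 0)" by simp
    qed
    then have "(flat m has_real_derivative 0) (at 0)"
      by (simp add: DERIV_def)
    then show ?thesis using 3 by (simp add: flat_def)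
  qed
qed

text \<open>The generators are the smooth functions and all \<open>flat m\<close> composed with
  \<open>p\<close>: by \<open>flat_deriv\<close>, the derivative of such a composition is a
  polynomial in generators.\<close>

lemma smooth_flat:
  fixes p :: "(real, 'n::finite) vec \<Rightarrow> real"
  assumes p: "smooth (\<lambda>x. complex_of_real (p x))"
  shows "smooth (\<lambda>x. complex_of_real (flat m (p x)))"
proof -
  define G where "G = Collect smooth \<union> range (\<lambda>m x. complex_of_real (flat m (p x)))"
  \<comment> \<open>Smoothness is defined for complex-valued functions; taking real parts recovers
    the real derivative of \<open>p\<close> that the chain rule needs.\<close>
  have pr: "(p has_derivative (\<lambda>h. Re (frechet_derivative (\<lambda>x. complex_of_real (p x)) (at x) h))) (at x)" for x
    using bounded_linear.has_derivative[OF bounded_linear_Re smooth_has_derivative[OF p]] by simp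
  have pp: "partial j (\<lambda>x. complex_of_real (p x)) x =
      complex_of_real (Re (frechet_derivative (\<lambda>x. complex_of_real (p x)) (at x) (axis j 1)))" for j x
    by (rule partial_eqI[OF has_derivative_of_real[OF pr]])
  have fd: "((\<lambda>x. complex_of_real (flat m (p x))) has_derivative
      (\<lambda>h. complex_of_real ((flat (m + 2) (p x) - real m * flat (m + 1) (p x)) *
        Re (frechet_derivative (\<lambda>x. complex_of_real (p x)) (at x) h)))) (at x)" for m x
    by (intro has_derivative_of_real
        has_derivative_compose[OF pr has_field_derivative_imp_has_derivative[OF flat_deriv]])
  have fp: "partial j (\<lambda>x. complex_of_real (flat m (p x))) =
      (\<lambda>x. (complex_of_real (flat (m + 2) (p x)) + (- of_nat m) * complex_of_real (flat (m + 1) (p x))) *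
        partial j (\<lambda>x. complex_of_real (p x)) x)" for j m
    by (rule ext, subst partial_eqI[OF fd]) (simp add: pp)
  have flatG: "(\<lambda>x. complex_of_real (flat m (p x))) \<in> G" for m
    by (auto simp: G_def)
  have smG: "g \<in> G" if "smooth g" for g
    using that by (simp add: G_def)
  show ?thesis
  proof (rule smooth_algebra_hull[of G])
    fix g :: "'n cfun" and x and j
    assume "g \<in> G"
    then consider "smooth g" | m where "g = (\<lambda>x. complex_of_real (flat m (p x)))"
      by (auto simp: G_def)
    note cases = this
    show "g differentiable (at x)"
      using cases by cases (auto intro: smooth_differentiable differentiableI fd)
    show "partial j g \<in> algebra_hull G"
      using cases
    proof cases
      case 1
      then show ?thesis by (intro algebra_hull.base smG smooth_partial)
    next
      case (2 m)
      show ?thesis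
        unfolding 2 fp
        by (intro algebra_hull.mult algebra_hull.add algebra_hull.base[OF flatG]
            algebra_hull.base[OF smG] smooth_partial p smooth_const)
    qed
  qed (rule algebra_hull.base[OF flatG])
qed

text \<open>The derivative of the reciprocal is a smooth function times two copies of the
  reciprocal, so adjoining the reciprocal to the smooth functions gives a closed system of
  generators.\<close>

lemma smooth_inverse:
  fixes g :: "'n::finite cfun"
  assumes g: "smooth g" and nz: "\<And>x. g x \<noteq> 0"
  shows "smooth (\<lambda>x. inverse (g x))"
proof -
  define G where "G = Collect smooth \<union> {\<lambda>x. inverse (g x)}"
  have d: "((\<lambda>x. inverse (g x)) has_derivative
      (\<lambda>h. - (inverse (g x) * frechet_derivative g (at x) h * inverse (g x)))) (at x)" for x
    by (rule Deriv.has_derivative_inverse[OF nz smooth_has_derivative[OF g]])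
  have p: "partial j (\<lambda>x. inverse (g x)) = (\<lambda>x. (- 1 * partial j g x) * (inverse (g x) * inverse (g x)))" for j
    by (rule ext, subst partial_eqI[OF d]) (simp add: partial_def)
  have invG: "(\<lambda>x. inverse (g x)) \<in> G" by (simp add: G_def)
  have smG: "f \<in> G" if "smooth f" for f
    using that by (simp add: G_def)
  show ?thesis
  proof (rule smooth_algebra_hull[of G])
    fix f :: "'n cfun" and x and j
    assume "f \<in> G"
    then consider "smooth f" | "f = (\<lambda>x. inverse (g x))"
      by (auto simp: G_def)
    note cases = this
    show "f differentiable (at x)"
      using cases by cases (auto intro: smooth_differentiable differentiableI d)
    show "partial j f \<in> algebra_hull G"
      using cases
    proof cases
      case 1
      then show ?thesis by (intro algebra_hull.base smG smooth_partial)
    next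
      case 2
      show ?thesis
        unfolding 2 p
        by (intro algebra_hull.mult algebra_hull.base[OF invG]
            algebra_hull.base[OF smG] smooth_cmult smooth_partial g)
    qed
  qed (rule algebra_hull.base[OF invG])
qed

section \<open>Bump functions and cutoffs for compact sets\<close>

lemma smooth_sum:
  assumes "finite A" "\<And>a. a \<in> A \<Longrightarrow> smooth (f a)"
  shows "smooth (\<lambda>x. \<Sum>a\<in>A. f a x)"
  using assms by induction (simp_all add: smooth_const smooth_add)

lemma smooth_norm_square: "smooth (\<lambda>x::(real, 'n::finite) vec. complex_of_real ((norm (x - a))\<^sup>2))"
proof -
  have "complex_of_real ((norm (x - a))\<^sup>2) =
      (\<Sum>j\<in>UNIV. (complex_of_real (x $ j) - complex_of_real (a $ j)) * (complex_of_real (x $ j) - complex_of_real (a $ j)))"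
    for x :: "(real, 'n) vec"
    by (simp add: power2_norm_eq_inner inner_vec_def)
  then show ?thesis
    by (simp only:) (intro smooth_sum smooth_mult smooth_diff smooth_component smooth_const finite_UNIV, simp)
qed

text \<open>The standard quotient of flat(2 - q) by flat(2 - q) + flat(q - 1), whose denominator is
  positive because q < 2 or q > 1. It is 1 for q \<le> 1 and 0 for q \<ge> 2, the latter in
  particular from distance \<open>2 * s\<close> on, where q \<ge> 4. Here \<open>q\<close> is a
  squared distance since the norm itself is not smooth at \<open>a\<close>.\<close>

lemma bump_exists:
  fixes a :: "(real, 'n::finite) vec"
  assumes s: "s > 0"
  obtains t where "smooth (\<lambda>x. complex_of_real (t x))" "\<And>x. t x \<ge> 0"
    "\<And>x. norm (x - a) \<le> s \<Longrightarrow> t x = 1" "\<And>x. norm (x - a) \<ge> 2 * s \<Longrightarrow> t x = 0"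
proof -
  define q where "q x = (norm (x - a))\<^sup>2 / s\<^sup>2" for x
  define e where "e = (\<lambda>x. flat 0 (2 - q x) + flat 0 (q x - 1))"
  define t where "t x = flat 0 (2 - q x) * inverse (e x)" for x
  have "smooth (\<lambda>x. complex_of_real (1 / s\<^sup>2) * complex_of_real ((norm (x - a))\<^sup>2))"
    by (intro smooth_cmult smooth_norm_square)
  then have q: "smooth (\<lambda>x. complex_of_real (q x))"
    by (simp add: q_def)
  have 1: "smooth (\<lambda>x. complex_of_real (flat 0 (2 - q x)))"
    using smooth_diff[OF smooth_const q, of 2] by (intro smooth_flat) simp
  have 2: "smooth (\<lambda>x. complex_of_real (flat 0 (q x - 1)))"
    using smooth_diff[OF q smooth_const, of 1] by (intro smooth_flat) simp
  have e_pos: "e x > 0" for x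
  proof (cases "q x < 2")
    case True
    then have "flat 0 (2 - q x) > 0" by (simp add: flat_def)
    then show ?thesis using flat_nonneg[of 0 "q x - 1"] by (simp add: e_def)
  next
    case False
    then have "flat 0 (q x - 1) > 0" by (simp add: flat_def)
    then show ?thesis using flat_nonneg[of 0 "2 - q x"] by (simp add: e_def)
  qed
  show ?thesis
  proof (rule that[of t])
    have "smooth (\<lambda>x. inverse (complex_of_real (e x)))"
    proof (rule smooth_inverse)
      show "smooth (\<lambda>x. complex_of_real (e x))"
        using smooth_add[OF 1 2] by (simp add: e_def)
      show "complex_of_real (e x) \<noteq> 0" for x
        using e_pos[of x] by simp
    qed
    from smooth_mult[OF 1 this]
    show "smooth (\<lambda>x. complex_of_real (t x))"
      by (simp add: t_def)
    show "t x \<ge> 0" for x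
      using e_pos[of x] flat_nonneg[of 0 "2 - q x"] by (simp add: t_def)
    show "t x = 1" if "norm (x - a) \<le> s" for x
    proof -
      have "q x \<le> 1"
        using that s by (simp add: q_def power_mono)
      then have "e x = flat 0 (2 - q x)"
        by (simp add: e_def flat_def)
      then show ?thesis using e_pos[of x] by (simp add: t_def)
    qed
    show "t x = 0" if "norm (x - a) \<ge> 2 * s" for x
    proof -
      have "(2 * s)\<^sup>2 \<le> (norm (x - a))\<^sup>2"
        using that s by (intro power_mono) auto
      moreover have "2 * s\<^sup>2 \<le> (2 * s)\<^sup>2"
        by (simp add: power_mult_distrib)
      ultimately have "2 * s\<^sup>2 \<le> (norm (x - a))\<^sup>2" by linarith
      then have "q x \<ge> 2"
        using s by (simp add: q_def pos_le_divide_eq power_mult_distrib)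
      then show ?thesis by (simp add: t_def flat_def)
    qed
  qed
qed

lemma supp_subset: "closed S \<Longrightarrow> (\<And>x. x \<notin> S \<Longrightarrow> f x = 0) \<Longrightarrow> supp f \<subseteq> S"
  unfolding supp_def by (rule closure_minimal) auto

lemma test_functionsI:
  fixes f :: "'n::finite cfun"
  assumes "smooth f" "compact S" "S \<subseteq> \<Omega>" "\<And>x. x \<notin> S \<Longrightarrow> f x = 0"
  shows "f \<in> test_functions \<Omega>"
proof -
  have sub: "supp f \<subseteq> S"
    by (rule supp_subset) (use assms in \<open>auto simp: compact_imp_closed\<close>)
  moreover have "closed (supp f)" by (simp add: supp_def)
  ultimately have "compact (S \<inter> supp f)"
    using assms(2) by (intro compact_Int_closed)
  moreover have "S \<inter> supp f = supp f" using sub by blast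
  ultimately show ?thesis
    using assms sub by (simp add: test_functions_def)
qed

lemma test_functionsD:
  assumes "\<phi> \<in> test_functions \<Omega>"
  shows "smooth \<phi>" "compact (supp \<phi>)" "supp \<phi> \<subseteq> \<Omega>"
  using assms by (simp_all add: test_functions_def)

lemma test_functions_mono: "\<phi> \<in> test_functions \<Omega> \<Longrightarrow> \<phi> \<in> test_functions UNIV"
  by (simp add: test_functions_def)

lemma test_functions_add:
  assumes "f \<in> test_functions \<Omega>" "g \<in> test_functions \<Omega>"
  shows "(\<lambda>x. f x + g x) \<in> test_functions \<Omega>"
  by (rule test_functionsI[of _ "supp f \<union> supp g"])
     (use assms[THEN test_functionsD(1)] assms[THEN test_functionsD(2)] assms[THEN test_functionsD(3)] in
       \<open>auto simp: smooth_add not_in_supp\<close>)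

lemma test_functions_mult:
  assumes "smooth f" "g \<in> test_functions \<Omega>"
  shows "(\<lambda>x. f x * g x) \<in> test_functions \<Omega>"
  by (rule test_functionsI[of _ "supp g"])
     (use assms test_functionsD[OF assms(2)] in \<open>auto simp: smooth_mult not_in_supp\<close>)

lemma test_functions_cmult: "f \<in> test_functions \<Omega> \<Longrightarrow> (\<lambda>x. c * f x) \<in> test_functions \<Omega>"
  by (rule test_functions_mult[OF smooth_const])

text \<open>A further bump \<open>t\<close> is joined by forming
  \<open>\<eta> + (1 - \<eta>) * t\<close>, that is 1 - (1 - \<eta>)(1 - t), which is 1 wherever one
  of the two is 1 and whose support stays inside \<open>\<Omega>\<close>.\<close>

lemma cutoff_finite_union:
  fixes A :: "(real, 'n::finite) vec set" and s :: "(real, 'n) vec \<Rightarrow> real"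
  assumes "finite A" "\<And>a. a \<in> A \<Longrightarrow> s a > 0 \<and> cball a (2 * s a) \<subseteq> \<Omega>"
  shows "\<exists>\<eta>\<in>test_functions \<Omega>. \<forall>x\<in>(\<Union>a\<in>A. ball a (s a)). \<eta> x = 1"
  using assms
proof (induction A)
  case empty
  have "(\<lambda>_. 0) \<in> test_functions \<Omega>"
    by (rule test_functionsI[of _ "{}"]) (auto intro: smooth_const)
  then show ?case by auto
next
  case (insert a A)
  have "\<exists>\<eta>\<in>test_functions \<Omega>. \<forall>x\<in>(\<Union>a\<in>A. ball a (s a)). \<eta> x = 1"
    by (rule insert.IH) (use insert.prems in auto)
  then obtain \<eta> where \<eta>: "\<eta> \<in> test_functions \<Omega>" and "\<forall>x\<in>(\<Union>a\<in>A. ball a (s a)). \<eta> x = 1"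
    by (rule bexE)
  note \<eta>1 = bspec[OF this(2)]
  have sa: "s a > 0" "cball a (2 * s a) \<subseteq> \<Omega>" using insert.prems by auto
  obtain t where t: "smooth (\<lambda>x. complex_of_real (t x))" "\<And>x. t x \<ge> 0"
    "\<And>x. norm (x - a) \<le> s a \<Longrightarrow> t x = 1" "\<And>x. norm (x - a) \<ge> 2 * s a \<Longrightarrow> t x = 0"
    by (rule bump_exists[OF sa(1), of a]) blast
  have tt: "(\<lambda>x. complex_of_real (t x)) \<in> test_functions \<Omega>"
  proof (rule test_functionsI[OF t(1) compact_cball sa(2)])
    fix x assume "x \<notin> cball a (2 * s a)"
    then have "norm (x - a) \<ge> 2 * s a" by (simp add: dist_norm norm_minus_commute)
    then show "complex_of_real (t x) = 0" using t(4) by simp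
  qed
  have mem: "(\<lambda>x. \<eta> x + (1 - \<eta> x) * complex_of_real (t x)) \<in> test_functions \<Omega>"
    by (rule test_functions_add[OF \<eta> test_functions_mult[OF smooth_diff[OF smooth_const test_functionsD(1)[OF \<eta>]] tt]])
  have one: "\<eta> x + (1 - \<eta> x) * complex_of_real (t x) = 1" if "x \<in> (\<Union>a\<in>insert a A. ball a (s a))" for x
  proof (cases "x \<in> ball a (s a)")
    case True
    then have "norm (x - a) \<le> s a" by (simp add: dist_norm norm_minus_commute)
    then show ?thesis by (simp add: t(3))
  next
    case False
    then have "x \<in> (\<Union>a\<in>A. ball a (s a))" using that by blast
    then show ?thesis by (simp add: \<eta>1)
  qed
  show ?case
    by (rule bexI[OF _ mem]) (intro ballI one)
qed

text \<open>The finitely many balls that cover \<open>K\<close> contain a neighbourhood of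
  \<open>K\<close> of some uniform width \<open>d\<close>. This width becomes the distance from
  \<open>x\<close> beyond which the kernels are estimated.\<close>

lemma cutoff_exists:
  fixes K :: "(real, 'n::finite) vec set"
  assumes K: "compact K" "K \<subseteq> \<Omega>" and \<Omega>: "open \<Omega>"
  obtains \<eta> d where "\<eta> \<in> test_functions \<Omega>" "d > 0"
    "\<And>x y. x \<in> K \<Longrightarrow> norm (x - y) < d \<Longrightarrow> \<eta> y = 1"
proof -
  have "\<exists>s>0. cball x (2 * s) \<subseteq> \<Omega>" if x: "x \<in> K" for x
  proof -
    obtain e where "e > 0" "cball x e \<subseteq> \<Omega>"
      using \<Omega> K(2) x open_contains_cball by blast
    then show ?thesis by (intro exI[of _ "e / 2"]) simp
  qed
  then obtain s where s: "\<And>x. x \<in> K \<Longrightarrow> s x > 0 \<and> cball x (2 * s x) \<subseteq> \<Omega>"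
    by metis
  have "K \<subseteq> (\<Union>x\<in>K. ball x (s x))"
    using s by force
  then obtain A where A: "A \<subseteq> K" "finite A" "K \<subseteq> (\<Union>x\<in>A. ball x (s x))"
    using compactE_image[OF K(1), of K "\<lambda>x. ball x (s x)"] by (metis open_ball)
  have "\<exists>\<eta>\<in>test_functions \<Omega>. \<forall>x\<in>(\<Union>a\<in>A. ball a (s a)). \<eta> x = 1"
    by (rule cutoff_finite_union[OF A(2)]) (use A(1) s in blast)
  then obtain \<eta> where \<eta>: "\<eta> \<in> test_functions \<Omega>" and "\<forall>x\<in>(\<Union>a\<in>A. ball a (s a)). \<eta> x = 1"
    by (rule bexE)
  note \<eta>1 = bspec[OF this(2)]
  have "open (\<Union>a\<in>A. ball a (s a))" by blast
  from compact_subset_open_imp_ball_epsilon_subset[OF K(1) this A(3)]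
  obtain d where d: "d > 0" "(\<Union>x\<in>K. ball x d) \<subseteq> (\<Union>a\<in>A. ball a (s a))"
    by blast
  show ?thesis
  proof (rule that[OF \<eta> d(1)])
    fix x y assume "x \<in> K" "norm (x - y) < d"
    then have "y \<in> (\<Union>x\<in>K. ball x d)" by (auto simp: dist_norm)
    then show "\<eta> y = 1" by (rule \<eta>1[OF subsetD[OF d(2)]])
  qed
qed

text \<open>The value of \<open>prod_pi\<close> is read off from some cutoff, so one has to
  exist.\<close>

lemma cutoffs_nonempty: "(cutoffs :: 'n::finite cfun set) \<noteq> {}"
proof -
  obtain \<eta> :: "'n cfun" and d where \<eta>: "\<eta> \<in> test_functions UNIV" "d > 0"
    "\<And>x y. x \<in> {0} \<Longrightarrow> norm (x - y) < d \<Longrightarrow> \<eta> y = 1"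
    by (rule cutoff_exists[of "{0 :: (real, 'n) vec}" UNIV]) auto
  have "\<eta> \<xi> = 1" if "dist \<xi> 0 < d" for \<xi>
    using that by (intro \<eta>(3)[of 0]) (auto simp: dist_norm)
  then have "\<forall>\<^sub>F \<xi> in nhds 0. \<eta> \<xi> = 1"
    unfolding eventually_nhds_metric using \<eta>(2) by blast
  then show ?thesis using \<eta>(1) by (auto simp: cutoffs_def)
qed

section \<open>Continuous functions as distributions\<close>

lemma integrable_continuous_test:
  fixes f \<phi> :: "'n::finite cfun"
  assumes f: "continuous_on UNIV f" and \<phi>: "\<phi> \<in> test_functions \<Omega>"
  shows "integrable lborel (\<lambda>x. f x * \<phi> x)"
proof -
  have "bounded (f ` supp \<phi>)"
    using test_functionsD(2)[OF \<phi>] f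
    by (meson compact_continuous_image compact_imp_bounded continuous_on_subset subset_UNIV)
  then obtain B where B: "\<And>x. x \<in> supp \<phi> \<Longrightarrow> norm (f x) \<le> B"
    unfolding bounded_iff by blast
  have "integrable lborel (\<lambda>x. \<phi> x * f x)"
  proof (rule integrable_mult_bounded)
    show "integrable lborel \<phi>"
      by (rule schwartz_integrable[OF test_functions_schwartz[OF \<phi>]])
    show "f \<in> borel_measurable borel"
      by (rule borel_measurable_continuous_onI[OF f])
    show "norm (f x) \<le> B" if "\<phi> x \<noteq> 0" for x
      using that not_in_supp[of x \<phi>] by (intro B) blast
  qed
  then show ?thesis by (simp add: mult.commute)
qed

text \<open>The fundamental lemma of the calculus of variations; it makes the description in
  \<open>fun_of\<close> unambiguous.\<close>

lemma fun_distribution_inject: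
  fixes f g :: "'n::finite cfun"
  assumes f: "continuous_on UNIV f" and g: "continuous_on UNIV g"
    and eq: "fun_distribution f = fun_distribution g"
  shows "f = g"
proof (rule ccontr)
  assume "f \<noteq> g"
  then obtain x0 where x0: "f x0 \<noteq> g x0" by blast
  \<comment> \<open>Multiplication by the conjugate of the difference at \<open>x0\<close> reduces
    the matter to a real function that is positive at \<open>x0\<close>.\<close>
  define F where "F x = Re (cnj (f x0 - g x0) * (f x - g x))" for x
  define \<epsilon> where "\<epsilon> = F x0 / 2"
  have "F x0 = (norm (f x0 - g x0))\<^sup>2"
    unfolding F_def cmod_power2 by (simp add: power2_eq_square algebra_simps)
  then have F0: "F x0 > 0"
    using x0 by simp
  have contF: "continuous_on UNIV F"
    unfolding F_def by (intro continuous_intros f g)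
  then have "isCont F x0"
    by (simp add: continuous_on_eq_continuous_at)
  then obtain d where d: "d > 0" "\<And>x. norm (x - x0) < d \<Longrightarrow> norm (F x - F x0) < \<epsilon>"
    using F0 unfolding isCont_def LIM_eq \<epsilon>_def
    by (metis diff_self half_gt_zero norm_zero)
  have Fd: "F x \<ge> \<epsilon>" if "norm (x - x0) < d" for x
  proof -
    have "\<bar>F x - F x0\<bar> < \<epsilon>" using d(2)[OF that] by simp
    moreover have "F x0 = 2 * \<epsilon>" by (simp add: \<epsilon>_def)
    ultimately show ?thesis by linarith
  qed
  define s where "s = d / 2"
  have s: "s > 0" using d by (simp add: s_def)
  obtain t where t: "smooth (\<lambda>x. complex_of_real (t x))" "\<And>x. t x \<ge> 0"
    "\<And>x. norm (x - x0) \<le> s \<Longrightarrow> t x = 1" "\<And>x. norm (x - x0) \<ge> 2 * s \<Longrightarrow> t x = 0"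
    by (rule bump_exists[OF s, of x0]) blast
  let ?b = "\<lambda>x. complex_of_real (t x)"
  have b: "?b \<in> test_functions UNIV"
  proof (rule test_functionsI[OF t(1) compact_cball[of x0 "2 * s"]])
    fix x assume "x \<notin> cball x0 (2 * s)"
    then have "norm (x - x0) \<ge> 2 * s" by (simp add: dist_norm norm_minus_commute)
    then show "?b x = 0" using t(4) by simp
  qed simp
  have fi: "integrable lborel (\<lambda>x. f x * ?b x)" and gi: "integrable lborel (\<lambda>x. g x * ?b x)"
    by (rule integrable_continuous_test[OF f b], rule integrable_continuous_test[OF g b])
  have "(LINT x|lborel. f x * ?b x) = (LINT x|lborel. g x * ?b x)"
    using fun_cong[OF eq, of ?b] b by (simp add: fun_distribution_def)
  then have zero: "(LINT x|lborel. cnj (f x0 - g x0) * (f x * ?b x - g x * ?b x)) = 0"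
    using fi gi by simp
  have int: "integrable lborel (\<lambda>x. cnj (f x0 - g x0) * (f x * ?b x - g x * ?b x))"
    using fi gi by simp
  have Fb: "Re (cnj (f x0 - g x0) * (f x * ?b x - g x * ?b x)) = F x * t x" for x
  proof -
    have "cnj (f x0 - g x0) * (f x * ?b x - g x * ?b x) = ?b x * (cnj (f x0 - g x0) * (f x - g x))"
      by (simp add: algebra_simps)
    moreover have "Re (complex_of_real r * z) = r * Re z" for r z by simp
    ultimately show ?thesis by (simp only: F_def mult.commute[of "t x"])
  qed
  have "(LINT x|lborel. F x * t x) = 0"
    using integral_Re[OF int] unfolding Fb zero by simp
  moreover have "integrable lborel (\<lambda>x. F x * t x)"
    using integrable_Re[OF int] unfolding Fb .
  moreover have "(LINT x|lborel. \<epsilon> * indicator (cball x0 s) x) \<le> (LINT x|lborel. F x * t x)"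
  proof (rule integral_mono)
    show "integrable lborel (\<lambda>x. \<epsilon> * indicator (cball x0 s) x)"
      by (intro integrable_mult_right integrable_real_indicator) (use emeasure_compact_finite[of "cball x0 s"] in simp_all)
    show "integrable lborel (\<lambda>x. F x * t x)" by fact
    fix x
    show "\<epsilon> * indicator (cball x0 s) x \<le> F x * t x"
    proof (cases "norm (x - x0) \<le> s")
      case True
      then have "\<epsilon> \<le> F x" using s by (intro Fd) (simp add: s_def)
      then show ?thesis using True by (simp add: t(3) indicator_def dist_norm norm_minus_commute)
    next
      case False
      have "F x * t x \<ge> 0"
      proof (cases "norm (x - x0) < d")
        case True
        then have "F x \<ge> 0" using Fd[of x] F0 by (simp add: \<epsilon>_def)
        then show ?thesis using t(2) by simp
      next
        case False
        then have "t x = 0" by (intro t(4)) (simp add: s_def)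
        then show ?thesis by simp
      qed
      then show ?thesis using False by (simp add: indicator_def dist_norm norm_minus_commute)
    qed
  qed
  moreover have "(LINT x|lborel. \<epsilon> * indicator (cball x0 s) x) > 0"
    using F0 content_cball_pos[OF s, of x0] by (simp add: \<epsilon>_def)
  ultimately show False by linarith
qed

lemma fun_of_eqI:
  assumes "continuous_on UNIV f" "restr UNIV w = fun_distribution f"
  shows "fun_of w = f"
  unfolding fun_of_def
  by (rule the_equality) (use assms fun_distribution_inject in auto)

section \<open>Estimates for the regularisations\<close>

text \<open>The absolute value of the Jacobian determinant of \<open>\<lambda>x. C * x\<close>,
  written over \<open>Basis\<close> to match the change of variables for
  \<open>lborel\<close>.\<close>

definition scale_factor :: "(real, 'n::finite) vec \<Rightarrow> real" where
  "scale_factor C = (\<Prod>b\<in>Basis. \<bar>C \<bullet> b\<bar>)"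

lemma lborel_integral_scale:
  fixes C :: "(real, 'n::finite) vec" and g :: "'n cfun"
  assumes C: "\<And>j. C $ j \<noteq> 0" and g: "g \<in> borel_measurable borel"
  shows "(LINT x|lborel. g x) = complex_of_real (scale_factor C) * (LINT x|lborel. g (C * x))"
proof -
  define T where "T x = 0 + (\<Sum>b\<in>Basis. ((C \<bullet> b) * (x \<bullet> b)) *\<^sub>R b)" for x :: "(real, 'n) vec"
  have Tx: "T x = C * x" for x
  proof (rule euclidean_eqI)
    fix b :: "(real, 'n) vec" assume b: "b \<in> Basis"
    then obtain j where j: "b = axis j 1"
      by (auto simp: Basis_vec_def)
    show "T x \<bullet> b = (C * x) \<bullet> b"
      using b by (simp add: T_def inner_sum_left_Basis) (simp add: j inner_axis)
  qed
  have "C \<bullet> b \<noteq> 0" if "b \<in> Basis" for b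
    using that C by (auto simp: Basis_vec_def inner_axis)
  from lborel_affine_euclidean[of "\<lambda>b. C \<bullet> b" 0, OF this]
  have eq: "lborel = density (distr lborel borel T) (\<lambda>_. ennreal (scale_factor C))"
    by (simp add: T_def[abs_def] scale_factor_def)
  have [measurable]: "T \<in> borel_measurable borel"
    unfolding T_def by measurable
  note [measurable] = g
  have "(LINT x|lborel. g x) = (LINT x|density (distr lborel borel T) (\<lambda>_. ennreal (scale_factor C)). g x)"
    using eq by simp
  also have "\<dots> = (LINT x|distr lborel borel T. scale_factor C *\<^sub>R g x)"
    by (rule integral_density) (simp_all add: scale_factor_def prod_nonneg)
  also have "\<dots> = (LINT x|lborel. scale_factor C *\<^sub>R g (T x))"
    by (rule integral_distr) simp_all
  finally show ?thesis
    by (simp add: Tx scaleR_conv_of_real)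
qed

text \<open>Substitute \<open>C * \<xi>\<close> for \<open>\<xi>\<close>: as \<open>c\<close> and
  \<open>C\<close> are inverse in each coordinate, the dilation passes from \<open>\<psi>\<close> to
  the argument of its transform and leaves the Jacobian as a factor.\<close>

lemma fourier_inv_scale:
  fixes C c :: "(real, 'n::finite) vec"
  assumes \<psi>: "\<psi> \<in> schwartz" and Cc: "\<And>j. c $ j * C $ j = 1"
  shows "fourier_inv (\<lambda>\<xi>. \<psi> (c * \<xi>)) z = complex_of_real (scale_factor C) * fourier_inv \<psi> (C * z)"
proof -
  have C0: "C $ j \<noteq> 0" for j using Cc[of j] by auto
  have cC: "c * (C * \<xi>) = \<xi>" for \<xi>
    by (simp add: vec_eq_iff mult.assoc[symmetric] Cc)
  have in_eq: "z \<bullet> (C * \<xi>) = (C * z) \<bullet> \<xi>" for \<xi>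
    by (simp add: inner_vec_def mult_ac)
  have cont: "continuous_on UNIV (\<lambda>\<xi>. \<psi> (c * \<xi>))"
    using smooth_continuous_on[OF smooth_affine[OF schwartz_smooth[OF \<psi>], of 0 c]] by simp
  have "(\<lambda>\<xi>. cis (z \<bullet> \<xi>) * \<psi> (c * \<xi>)) \<in> borel_measurable borel"
    by (intro borel_measurable_continuous_onI continuous_intros cont)
  from lborel_integral_scale[OF C0 this]
  have "(LINT \<xi>|lborel. cis (z \<bullet> \<xi>) * \<psi> (c * \<xi>)) =
      complex_of_real (scale_factor C) * (LINT \<xi>|lborel. cis ((C * z) \<bullet> \<xi>) * \<psi> \<xi>)"
    by (simp only: cC in_eq)
  then show ?thesis
    unfolding fourier_inv_def by simp
qed

lemma scale_factor_bounds:
  fixes C :: "(real, 'n::finite) vec"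
  assumes "\<And>j. 0 \<le> C $ j" "\<And>j. C $ j \<le> D"
  shows "0 \<le> scale_factor C" "scale_factor C \<le> D ^ CARD('n)"
proof -
  show "0 \<le> scale_factor C"
    by (simp add: scale_factor_def prod_nonneg)
  have "scale_factor C \<le> (\<Prod>b\<in>(Basis :: (real, 'n) vec set). D)"
    unfolding scale_factor_def
    by (rule prod_mono) (use assms in \<open>auto simp: Basis_vec_def inner_axis\<close>)
  then show "scale_factor C \<le> D ^ CARD('n)" by simp
qed

text \<open>The dilate of \<open>\<Phi>\<close>, normalised by the Jacobian, centred at
  \<open>x\<close> and regarded as a function of \<open>y\<close>. A general vector \<open>C\<close>
  stands for 2^(kM), so that the estimates refer only to bounds for its components.\<close>

definition dilation_kernel :: "'n::finite cfun \<Rightarrow> (real, 'n) vec \<Rightarrow> (real, 'n) vec \<Rightarrow> 'n cfun" where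
  "dilation_kernel \<Phi> C x = (\<lambda>y. complex_of_real (scale_factor C) * \<Phi> (C * (x - y)))"

lemma dilation_kernel_eq_affine:
  "dilation_kernel \<Phi> C x = (\<lambda>y. complex_of_real (scale_factor C) * \<Phi> (C * x + (- C) * y))"
  by (simp add: dilation_kernel_def right_diff_distrib)

lemma dilation_kernel_schwartz:
  assumes "\<Phi> \<in> schwartz" "\<And>j. C $ j \<noteq> 0"
  shows "dilation_kernel \<Phi> C x \<in> schwartz"
  unfolding dilation_kernel_eq_affine by (intro schwartz_cmult schwartz_affine assms(1)) (simp add: assms(2))

lemma norm_scale_ge:
  fixes C z :: "(real, 'n::finite) vec"
  assumes "t \<ge> 0" "\<And>j. t \<le> C $ j"
  shows "t * norm z \<le> norm (C * z)"
proof -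
  have "norm (t *\<^sub>R z) \<le> norm (C * z)"
  proof (rule norm_le_componentwise_cart)
    fix j
    have "t \<le> \<bar>C $ j\<bar>" using assms(2)[of j] by linarith
    then show "norm ((t *\<^sub>R z) $ j) \<le> norm ((C * z) $ j)"
      using assms(1) by (simp add: abs_mult mult_right_mono)
  qed
  then show ?thesis using assms(1) by simp
qed

text \<open>Taking \<open>E = 1\<close> gives growth in \<open>D\<close>; away from \<open>x\<close> a large \<open>E\<close> gives decay of any order \<open>L\<close>.\<close>

lemma dilation_kernel_bound:
  fixes \<Phi> :: "'n::finite cfun"
  assumes \<Phi>: "\<Phi> \<in> schwartz"
  obtains B where "B \<ge> 0"
    "\<And>C D E x y js. (\<And>j. 1 \<le> C $ j) \<Longrightarrow> (\<And>j. C $ j \<le> D) \<Longrightarrow> norm x \<le> R \<Longrightarrow> length js \<le> N \<Longrightarrow>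
      0 < E \<Longrightarrow> E \<le> 1 + norm (C * (x - y)) \<Longrightarrow>
      norm (iter_partial js (dilation_kernel \<Phi> C x) y) \<le> B * D ^ (CARD('n) + N) / E ^ L / (1 + norm y) ^ N"
proof -
  \<comment> \<open>Of the \<open>N + L\<close> powers of decay, \<open>N\<close> are spent on
    passing from the weight at \<open>C * (x - y)\<close> to the weight at \<open>y\<close>; the
    other \<open>L\<close> produce the factor \<open>E ^ L\<close>.\<close>
  obtain B where B: "seminorm_le (N + L) \<Phi> B"
    using \<Phi> unfolding schwartz_iff by blast
  note B0 = seminorm_le_nonneg[OF B]
  have sm: "smooth \<Phi>" by (rule schwartz_smooth[OF \<Phi>])
  show ?thesis
  proof (rule that[of "B * (1 + \<bar>R\<bar>) ^ N"])
    show "0 \<le> B * (1 + \<bar>R\<bar>) ^ N" using B0 by simp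
    fix C :: "(real, 'n) vec" and D E :: real and x y :: "(real, 'n) vec" and js :: "'n list"
    assume C1: "\<And>j. 1 \<le> C $ j" and CD: "\<And>j. C $ j \<le> D" and x: "norm x \<le> R"
      and js: "length js \<le> N" and E: "0 < E" "E \<le> 1 + norm (C * (x - y))"
    have C0: "0 \<le> C $ j" for j using C1[of j] by linarith
    have D1: "1 \<le> D" using C1 CD order_trans by blast
    define w where "w = C * (x - y)"
    have pr: "\<bar>prod_list (map (($) (- C)) js)\<bar> \<le> D ^ N"
    proof -
      have "\<bar>prod_list (map (($) (- C)) js)\<bar> \<le> D ^ length js"
      proof (induction js)
        case (Cons j js)
        have "\<bar>(- C) $ j\<bar> * \<bar>prod_list (map (($) (- C)) js)\<bar> \<le> D * D ^ length js"
          by (rule mult_mono[OF _ Cons.IH]) (use C0[of j] CD[of j] D1 in auto)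
        then show ?case by (simp only: list.map prod_list.Cons abs_mult length_Cons power_Suc)
      qed simp
      also have "\<dots> \<le> D ^ N" using js D1 by (intro power_increasing)
      finally show ?thesis .
    qed
    have "norm (iter_partial js \<Phi> w) \<le> B / (1 + norm w) ^ (N + L)"
      using seminorm_leD[OF B] js by simp
    also have "\<dots> \<le> B * ((1 + \<bar>R\<bar>) ^ N / (1 + norm y) ^ N) / E ^ L"
    proof -
      have "norm (x - y) \<le> norm w"
        using norm_scale_ge[of 1 C "x - y"] C1 by (simp add: w_def)
      have "(1 + norm y) ^ N \<le> (1 + norm x) ^ N * (1 + norm (y - x)) ^ N"
        by (rule peetre_power)
      also have "\<dots> \<le> (1 + \<bar>R\<bar>) ^ N * (1 + norm w) ^ N"
        using x \<open>norm (x - y) \<le> norm w\<close> by (intro mult_mono power_mono) (auto simp: norm_minus_commute)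
      finally have "(1 + norm y) ^ N * E ^ L \<le> ((1 + \<bar>R\<bar>) ^ N * (1 + norm w) ^ N) * (1 + norm w) ^ L"
        using E by (intro mult_mono power_mono) (auto simp: w_def)
      then have "B * ((1 + norm y) ^ N * E ^ L) \<le> B * ((1 + \<bar>R\<bar>) ^ N * (1 + norm w) ^ (N + L))"
        using B0 by (intro mult_left_mono) (simp_all add: power_add mult.assoc)
      then show ?thesis
        using one_plus_norm_power_pos[of w "N + L"] one_plus_norm_power_pos[of y N] E(1)
        by (simp add: divide_simps mult_ac)
    qed
    finally have d: "norm (iter_partial js \<Phi> w) \<le> B * ((1 + \<bar>R\<bar>) ^ N / (1 + norm y) ^ N) / E ^ L" .
    have "iter_partial js (dilation_kernel \<Phi> C x) y = complex_of_real (scale_factor C) *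
        (complex_of_real (prod_list (map (($) (- C)) js)) * iter_partial js \<Phi> w)"
      unfolding dilation_kernel_eq_affine iter_partial_cmult[OF smooth_affine[OF sm]] iter_partial_affine[OF sm]
      by (simp add: w_def right_diff_distrib)
    then have "norm (iter_partial js (dilation_kernel \<Phi> C x) y) =
        scale_factor C * (\<bar>prod_list (map (($) (- C)) js)\<bar> * norm (iter_partial js \<Phi> w))"
      using scale_factor_bounds(1)[OF C0 CD] by (simp add: norm_mult)
    \<comment> \<open>The Jacobian contributes at most \<open>D ^ CARD('n)\<close> and the chain
      rule at most \<open>D ^ N\<close>; neither power involves \<open>L\<close>.\<close>
    also have "\<dots> \<le> D ^ CARD('n) * (D ^ N * (B * ((1 + \<bar>R\<bar>) ^ N / (1 + norm y) ^ N) / E ^ L))"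
      using scale_factor_bounds[OF C0 CD] pr d D1 by (intro mult_mono) auto
    also have "\<dots> = B * (1 + \<bar>R\<bar>) ^ N * D ^ (CARD('n) + N) / E ^ L / (1 + norm y) ^ N"
      by (simp add: power_add mult_ac)
    finally show "norm (iter_partial js (dilation_kernel \<Phi> C x) y) \<le>
        B * (1 + \<bar>R\<bar>) ^ N * D ^ (CARD('n) + N) / E ^ L / (1 + norm y) ^ N" .
  qed
qed

text \<open>Meant for the factor whose behaviour on \<open>\<Omega>\<close> is unknown. The exponent
  is the dimension plus the index of a seminorm that bounds \<open>u\<close>.\<close>

lemma tempered_kernel_growth:
  fixes \<Phi> :: "'n::finite cfun"
  assumes u: "u \<in> tempered_distributions" and \<Phi>: "\<Phi> \<in> schwartz"
  shows "\<exists>B a. B \<ge> 0 \<and> (\<forall>C D x. (\<forall>j. 1 \<le> C $ j) \<and> (\<forall>j. C $ j \<le> D) \<and> norm x \<le> R \<longrightarrow>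
      norm (u (dilation_kernel \<Phi> C x)) \<le> B * D ^ a)"
proof -
  obtain A N where A: "A \<ge> 0" "\<And>f B. f \<in> schwartz \<Longrightarrow> seminorm_le N f B \<Longrightarrow> norm (u f) \<le> A * B"
    by (rule tempered_bound[OF u]) blast
  obtain B where B: "B \<ge> 0"
    "\<And>C D E x y js. (\<And>j. 1 \<le> C $ j) \<Longrightarrow> (\<And>j. C $ j \<le> D) \<Longrightarrow> norm x \<le> R \<Longrightarrow> length js \<le> N \<Longrightarrow>
      0 < E \<Longrightarrow> E \<le> 1 + norm (C * (x - y)) \<Longrightarrow>
      norm (iter_partial js (dilation_kernel \<Phi> C x) y) \<le> B * D ^ (CARD('n) + N) / E ^ 0 / (1 + norm y) ^ N"
    by (rule dilation_kernel_bound[OF \<Phi>, of R N 0]) blast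
  show ?thesis
  proof (intro exI[of _ "A * B"] exI[of _ "CARD('n) + N"] conjI allI impI)
    show "0 \<le> A * B" using A B by simp
    fix C :: "(real, 'n) vec" and D :: real and x :: "(real, 'n) vec"
    assume as: "(\<forall>j. 1 \<le> C $ j) \<and> (\<forall>j. C $ j \<le> D) \<and> norm x \<le> R"
    then have "C $ j \<noteq> 0" for j by (metis not_one_le_zero)
    then have S: "dilation_kernel \<Phi> C x \<in> schwartz" by (intro dilation_kernel_schwartz \<Phi>)
    have "seminorm_le N (dilation_kernel \<Phi> C x) (B * D ^ (CARD('n) + N))"
      by (rule seminorm_leI) (use B(2)[of C D x _ 1] as in simp)
    from A(2)[OF S this] show "norm (u (dilation_kernel \<Phi> C x)) \<le> A * B * D ^ (CARD('n) + N)"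
      by (simp add: mult.assoc)
  qed
qed

text \<open>The order of the quantifiers is the point: \<open>a\<close> is fixed by the dimension
  and the seminorm that bounds \<open>u\<close>, before \<open>L\<close> is chosen. Hence
  \<open>t ^ L\<close> can later outweigh \<open>D ^ a\<close>, even though \<open>D\<close> may be
  a high power of \<open>t\<close>.\<close>

lemma tempered_kernel_decay:
  fixes \<Phi> :: "'n::finite cfun"
  assumes u: "u \<in> tempered_distributions" and \<Phi>: "\<Phi> \<in> schwartz"
    and \<Omega>: "open \<Omega>" and zero: "restr \<Omega> u = (\<lambda>_. 0)" and K: "compact K" "K \<subseteq> \<Omega>"
  shows "\<exists>a. \<forall>L. \<exists>B\<ge>0. \<forall>C D t x. 1 \<le> t \<and> (\<forall>j. t \<le> C $ j) \<and> (\<forall>j. C $ j \<le> D) \<and> x \<in> K \<longrightarrow>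
      norm (u (dilation_kernel \<Phi> C x)) \<le> B * D ^ a / t ^ L"
proof -
  obtain A N where A: "A \<ge> 0" "\<And>f B. f \<in> schwartz \<Longrightarrow> seminorm_le N f B \<Longrightarrow> norm (u f) \<le> A * B"
    by (rule tempered_bound[OF u]) blast
  obtain \<eta> d where \<eta>: "\<eta> \<in> test_functions \<Omega>" and d: "d > 0"
    and \<eta>1: "\<And>x y. x \<in> K \<Longrightarrow> norm (x - y) < d \<Longrightarrow> \<eta> y = 1"
    by (rule cutoff_exists[OF K \<Omega>]) blast
  have \<eta>sm: "smooth \<eta>" by (rule test_functionsD(1)[OF \<eta>])
  obtain H where H: "seminorm_le N \<eta> H"
    using test_functions_schwartz[OF \<eta>] unfolding schwartz_iff by blast
  note H0 = seminorm_le_nonneg[OF H]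
  let ?\<chi> = "\<lambda>y. 1 - \<eta> y"
  have \<chi>sm: "smooth ?\<chi>" by (intro smooth_diff smooth_const \<eta>sm)
  have \<chi>b: "norm (iter_partial js ?\<chi> y) \<le> 1 + H" if "length js \<le> N" for js y
  proof -
    have "norm (iter_partial js \<eta> y) \<le> H / (1 + norm y) ^ N"
      by (rule seminorm_leD[OF H that])
    also have "\<dots> \<le> H / 1"
      using H0 by (intro divide_left_mono) (auto intro!: one_le_power one_plus_norm_power_pos)
    finally have "norm (iter_partial js \<eta> y) \<le> H" by simp
    then show ?thesis
      unfolding iter_partial_diff[OF smooth_const \<eta>sm] iter_partial_const
      using norm_triangle_ineq4[of "1 :: complex" "iter_partial js \<eta> y"] by (auto simp: norm_minus_commute)
  qed
  obtain R where R: "\<And>x. x \<in> K \<Longrightarrow> norm x \<le> R"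
    using compact_imp_bounded[OF K(1)] unfolding bounded_iff by blast
  show ?thesis
  proof (rule exI[of _ "CARD('n) + N"], rule allI)
    fix L
    obtain B where B: "B \<ge> 0"
      "\<And>C D E x y js. (\<And>j. 1 \<le> C $ j) \<Longrightarrow> (\<And>j. C $ j \<le> D) \<Longrightarrow> norm x \<le> R \<Longrightarrow> length js \<le> N \<Longrightarrow>
        0 < E \<Longrightarrow> E \<le> 1 + norm (C * (x - y)) \<Longrightarrow>
        norm (iter_partial js (dilation_kernel \<Phi> C x) y) \<le> B * D ^ (CARD('n) + N) / E ^ L / (1 + norm y) ^ N"
      by (rule dilation_kernel_bound[OF \<Phi>, of R N L]) blast
    \<comment> \<open>Collects the number of Leibniz terms, the bound for the derivatives of
      \<open>1 - \<eta>\<close>, the constant of the kernel estimate and the power of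
      \<open>d\<close> that splits off from \<open>(t * d) ^ L\<close>.\<close>
    define Q where "Q = 2 ^ N * (1 + H) * B / d ^ L"
    have Q0: "Q \<ge> 0" using H0 B(1) d by (simp add: Q_def)
    have "norm (u (dilation_kernel \<Phi> C x)) \<le> A * Q * D ^ (CARD('n) + N) / t ^ L"
      if t1: "1 \<le> t" and tC: "\<And>j. t \<le> C $ j" and CD: "\<And>j. C $ j \<le> D" and x: "x \<in> K" for C D t x
    proof -
      let ?G = "dilation_kernel \<Phi> C x"
      have C1: "1 \<le> C $ j" for j using t1 tC[of j] by linarith
      have D1: "1 \<le> D" using C1 CD order_trans by blast
      have "C $ j \<noteq> 0" for j using C1[of j] by auto
      then have GS: "?G \<in> schwartz" by (intro dilation_kernel_schwartz \<Phi>)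
      have \<eta>G: "(\<lambda>y. \<eta> y * ?G y) \<in> test_functions \<Omega>"
        using test_functions_mult[OF schwartz_smooth[OF GS] \<eta>] by (simp add: mult.commute)
      have \<eta>GS: "(\<lambda>y. \<eta> y * ?G y) \<in> schwartz" by (rule test_functions_schwartz[OF \<eta>G])
      have "u (\<lambda>y. \<eta> y * ?G y) = 0"
        using fun_cong[OF zero, of "\<lambda>y. \<eta> y * ?G y"] \<eta>G by (simp add: restr_def)
      then have uG: "u ?G = u (\<lambda>y. ?\<chi> y * ?G y)"
        using tempered_diff[OF u GS \<eta>GS] by (simp add: left_diff_distrib)
      have \<chi>GS: "(\<lambda>y. ?\<chi> y * ?G y) \<in> schwartz"
        using schwartz_diff[OF GS \<eta>GS] by (simp add: left_diff_distrib)
      have "seminorm_le N (\<lambda>y. ?\<chi> y * ?G y) (Q * D ^ (CARD('n) + N) / t ^ L)"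
      proof (rule seminorm_leI)
        fix js :: "'n list" and y
        assume js: "length js \<le> N"
        show "norm (iter_partial js (\<lambda>y. ?\<chi> y * ?G y) y) \<le>
            Q * D ^ (CARD('n) + N) / t ^ L / (1 + norm y) ^ N"
        proof (cases "norm (x - y) < d")
          case True
          have "iter_partial js (\<lambda>y. ?\<chi> y * ?G y) y = 0"
            by (rule iter_partial_eq_0[of "ball x d"]) (use True \<eta>1[OF x] in \<open>auto simp: dist_norm\<close>)
          moreover have "0 \<le> Q * D ^ (CARD('n) + N) / t ^ L / (1 + norm y) ^ N"
            using Q0 D1 t1 by (intro divide_nonneg_nonneg mult_nonneg_nonneg) auto
          ultimately show ?thesis by simp
        next
          case False
          \<comment> \<open>Every component of \<open>C\<close> is at least \<open>t\<close>, so off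
            the ball the argument of \<open>\<Phi>\<close> has norm at least \<open>t * d\<close>;
            this product is the \<open>E\<close> of the kernel estimate.\<close>
          have "t * d \<le> t * norm (x - y)"
            using False t1 by (intro mult_left_mono) auto
          also have "\<dots> \<le> norm (C * (x - y))"
            by (rule norm_scale_ge) (use t1 tC in auto)
          finally have E: "t * d \<le> 1 + norm (C * (x - y))" by simp
          have Gb: "norm (iter_partial ks ?G y) \<le> B * D ^ (CARD('n) + N) / (t * d) ^ L / (1 + norm y) ^ N"
            if "length ks \<le> N" for ks
            by (rule B(2)[OF C1 CD R[OF x] that _ E]) (use t1 d in simp)
          have "norm (iter_partial js (\<lambda>y. ?\<chi> y * ?G y) y) \<le>
              2 ^ length js * (1 + H) * (B * D ^ (CARD('n) + N) / (t * d) ^ L / (1 + norm y) ^ N)"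
            by (rule norm_iter_partial_mult_le[OF \<chi>sm schwartz_smooth[OF GS]
                  \<chi>b[OF order_trans[OF _ js]] Gb[OF order_trans[OF _ js]]])
          also have "\<dots> \<le> 2 ^ N * (1 + H) * (B * D ^ (CARD('n) + N) / (t * d) ^ L / (1 + norm y) ^ N)"
            using js H0 B(1) D1 t1 d
            by (intro mult_right_mono power_increasing divide_nonneg_nonneg mult_nonneg_nonneg) auto
          also have "\<dots> = Q * D ^ (CARD('n) + N) / t ^ L / (1 + norm y) ^ N"
            by (simp add: Q_def power_mult_distrib mult_ac)
          finally show ?thesis .
        qed
      qed
      from A(2)[OF \<chi>GS this] show ?thesis
        unfolding uG by (simp add: mult.assoc)
    qed
    then show "\<exists>B\<ge>0. \<forall>C D t x. 1 \<le> t \<and> (\<forall>j. t \<le> C $ j) \<and> (\<forall>j. C $ j \<le> D) \<and> x \<in> K \<longrightarrow>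
        norm (u (dilation_kernel \<Phi> C x)) \<le> B * D ^ (CARD('n) + N) / t ^ L"
      using A(1) Q0 by (intro exI[of _ "A * Q"] conjI allI impI) auto
  qed
qed

section \<open>Products of regularisations\<close>

lemma norm_le_test_norm:
  fixes \<phi> :: "'n::finite cfun"
  assumes "\<phi> \<in> schwartz"
  shows "norm (\<phi> x) \<le> test_norm 0 \<phi>"
proof -
  obtain B where B: "\<And>x. norm (\<phi> x) \<le> B"
    using schwartz_bound0[OF assms, of 0] by auto
  let ?S = "{js :: 'n list. length js \<le> 0} \<times> (UNIV :: (real, 'n) vec set)"
  let ?h = "\<lambda>(js, x). norm (iter_partial js \<phi> x)"
  have "bdd_above (?h ` ?S)"
    by (rule bdd_aboveI2[of _ _ B]) (use B in auto)
  moreover have "([], x) \<in> ?S" by simp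
  ultimately show ?thesis
    unfolding test_norm_def by (rule cSUP_upper2) simp
qed

lemma linear_functional_zero: "linear_functional_on V (\<lambda>_. 0)"
  by (simp add: linear_functional_on_def)

lemma zero_in_distributions: "(\<lambda>_. 0) \<in> distributions \<Omega>"
  unfolding distributions_def
  by (intro CollectI conjI linear_functional_zero allI impI exI[of _ 0]) simp

lemma restr_fun_distribution:
  "restr \<Omega> (fun_distribution f) \<phi> = (if \<phi> \<in> test_functions \<Omega> then (LINT x|lborel. f x * \<phi> x) else 0)"
  using test_functions_mono[of \<phi> \<Omega>] by (simp add: restr_def fun_distribution_def)

text \<open>On test functions supported in \<open>K\<close> the functional has order 0, with
  constant a bound of \<open>f\<close> on \<open>K\<close> times the volume of
  \<open>K\<close>.\<close>

lemma restr_fun_distribution_in_distributions: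
  fixes f :: "'n::finite cfun"
  assumes f: "continuous_on UNIV f"
  shows "restr \<Omega> (fun_distribution f) \<in> distributions \<Omega>"
  unfolding distributions_def
proof (intro CollectI conjI allI impI)
  note int = integrable_continuous_test[OF f]
  show "linear_functional_on (test_functions \<Omega>) (restr \<Omega> (fun_distribution f))"
    unfolding linear_functional_on_def
  proof (intro conjI ballI allI impI)
    fix \<phi> \<psi> :: "'n cfun" assume "\<phi> \<in> test_functions \<Omega>" "\<psi> \<in> test_functions \<Omega>"
    then show "restr \<Omega> (fun_distribution f) (\<lambda>x. \<phi> x + \<psi> x) =
        restr \<Omega> (fun_distribution f) \<phi> + restr \<Omega> (fun_distribution f) \<psi>"
      by (simp add: restr_fun_distribution test_functions_add distrib_left int)
  next
    fix c and \<phi> :: "'n cfun" assume "\<phi> \<in> test_functions \<Omega>"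
    then show "restr \<Omega> (fun_distribution f) (\<lambda>x. c * \<phi> x) = c * restr \<Omega> (fun_distribution f) \<phi>"
      by (simp add: restr_fun_distribution test_functions_cmult mult.left_commute)
  qed (simp add: restr_fun_distribution)
  fix K assume K: "compact K \<and> K \<subseteq> \<Omega>"
  then have "bounded (f ` K)"
    using f by (meson compact_continuous_image compact_imp_bounded continuous_on_subset subset_UNIV)
  then obtain B where B: "B > 0" "\<And>x. x \<in> K \<Longrightarrow> norm (f x) \<le> B"
    unfolding bounded_pos by fastforce
  have Ks: "K \<in> sets lborel" using K by (simp add: compact_imp_closed)
  have Kf: "emeasure lborel K < \<infinity>" using K by (intro emeasure_compact_finite) simp
  have "norm (restr \<Omega> (fun_distribution f) \<phi>) \<le> B * measure lborel K * test_norm 0 \<phi>"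
    if \<phi>: "\<phi> \<in> test_functions \<Omega>" and sK: "supp \<phi> \<subseteq> K" for \<phi>
  proof -
    have "norm (restr \<Omega> (fun_distribution f) \<phi>) \<le> (LINT x|lborel. norm (f x * \<phi> x))"
      using \<phi> by (simp add: restr_fun_distribution)
    also have "\<dots> \<le> (LINT x|lborel. (B * test_norm 0 \<phi>) * indicator K x)"
    proof (rule integral_mono)
      show "integrable lborel (\<lambda>x. norm (f x * \<phi> x))"
        by (intro integrable_norm int[OF \<phi>])
      show "integrable lborel (\<lambda>x. (B * test_norm 0 \<phi>) * indicator K x)"
        using Ks Kf by (intro integrable_mult_right integrable_real_indicator)
      show "norm (f x * \<phi> x) \<le> (B * test_norm 0 \<phi>) * indicator K x" for x
      proof (cases "x \<in> K")
        case True
        then show ?thesis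
          using B norm_le_test_norm[OF test_functions_schwartz[OF \<phi>], of x]
          by (simp add: norm_mult mult_mono)
      next
        case False
        then have "\<phi> x = 0" using sK not_in_supp[of x \<phi>] by blast
        then show ?thesis using False by simp
      qed
    qed
    also have "\<dots> = B * measure lborel K * test_norm 0 \<phi>"
      by simp
    finally show ?thesis .
  qed
  then show "\<exists>C N. \<forall>\<phi>\<in>test_functions \<Omega>. supp \<phi> \<subseteq> K \<longrightarrow>
      norm (restr \<Omega> (fun_distribution f) \<phi>) \<le> C * test_norm N \<phi>"
    by (intro exI[of _ "B * measure lborel K"] exI[of _ 0] ballI impI)
qed

text \<open>Uniform smallness on the support suffices, as a test function is integrable. The rate
  2^(-k) is the one that the product estimate delivers.\<close>

lemma converges_to_0_of_locally_uniform:
  fixes W :: "nat \<Rightarrow> 'n::finite cfun"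
  assumes W: "\<And>k. continuous_on UNIV (W k)"
    and bound: "\<And>K. compact K \<Longrightarrow> K \<subseteq> \<Omega> \<Longrightarrow> \<exists>B. \<forall>k. \<forall>x\<in>K. norm (W k x) \<le> B / 2 ^ k"
  shows "converges_in_distributions \<Omega> (\<lambda>k. restr \<Omega> (fun_distribution (W k))) (\<lambda>_. 0)"
  unfolding converges_in_distributions_def
proof (intro conjI allI ballI)
  fix \<phi> :: "'n cfun" assume \<phi>: "\<phi> \<in> test_functions \<Omega>"
  obtain B where B: "\<And>k x. x \<in> supp \<phi> \<Longrightarrow> norm (W k x) \<le> B / 2 ^ k"
    using bound[OF test_functionsD(2,3)[OF \<phi>]] by blast
  have le: "norm (restr \<Omega> (fun_distribution (W k)) \<phi>) \<le> B / 2 ^ k * (LINT x|lborel. norm (\<phi> x))" for k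
  proof -
    have "norm (restr \<Omega> (fun_distribution (W k)) \<phi>) \<le> (LINT x|lborel. norm (W k x * \<phi> x))"
      using \<phi> by (simp add: restr_fun_distribution)
    also have "\<dots> \<le> (LINT x|lborel. B / 2 ^ k * norm (\<phi> x))"
    proof (rule integral_mono)
      show "integrable lborel (\<lambda>x. norm (W k x * \<phi> x))"
        by (intro integrable_norm integrable_continuous_test[OF W \<phi>])
      show "integrable lborel (\<lambda>x. B / 2 ^ k * norm (\<phi> x))"
        by (intro integrable_mult_right integrable_norm schwartz_integrable test_functions_schwartz[OF \<phi>])
      show "norm (W k x * \<phi> x) \<le> B / 2 ^ k * norm (\<phi> x)" for x
      proof (cases "x \<in> supp \<phi>")
        case True
        show ?thesis unfolding norm_mult by (intro mult_right_mono B True norm_ge_zero)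
      qed (simp add: not_in_supp)
    qed
    also have "\<dots> = B / 2 ^ k * (LINT x|lborel. norm (\<phi> x))" by simp
    finally show ?thesis .
  qed
  have lim: "(\<lambda>k. B / 2 ^ k * (LINT x|lborel. norm (\<phi> x))) \<longlonglongrightarrow> 0"
    by (rule tendsto_mult_left_zero[OF LIMSEQ_divide_realpow_zero]) simp
  show "(\<lambda>k. restr \<Omega> (fun_distribution (W k)) \<phi>) \<longlonglongrightarrow> 0"
    by (rule Lim_null_comparison[OF always_eventually[OF allI[OF le]] lim])
qed (intro restr_fun_distribution_in_distributions W zero_in_distributions)+

section \<open>Regularisations as dilated kernels and the estimate of their product\<close>

lemma dilate_eq: "dilate M k x = (\<chi> j. 2 powr (- (real k * M $ j))) * x"
  by (simp add: dilate_def vec_eq_iff)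

lemma schwartz_dilate:
  assumes "\<psi> \<in> schwartz"
  shows "(\<lambda>\<xi>. \<psi> (dilate M k \<xi>)) \<in> schwartz"
  using schwartz_affine[OF assms, of "\<chi> j. 2 powr (- (real k * M $ j))" 0] by (simp add: dilate_eq)

lemma fun_of_smoothing:
  fixes u :: "'n::finite functional"
  assumes u: "u \<in> tempered_distributions" and \<psi>: "\<psi> \<in> schwartz"
  shows "fun_of (smoothing M \<psi> k u) = smoothing_fun (\<lambda>\<xi>. \<psi> (dilate M k \<xi>)) u"
proof (rule fun_of_eqI)
  note \<psi>k = schwartz_dilate[OF \<psi>, of M k]
  show "continuous_on UNIV (smoothing_fun (\<lambda>\<xi>. \<psi> (dilate M k \<xi>)) u)"
    by (rule continuous_smoothing_fun[OF u \<psi>k])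
  show "restr UNIV (smoothing M \<psi> k u) = fun_distribution (smoothing_fun (\<lambda>\<xi>. \<psi> (dilate M k \<xi>)) u)"
    unfolding restr_def smoothing_def fun_distribution_def
    using fourier_inv_dist_mult_dist[OF u \<psi>k] by auto
qed

lemma smoothing_fun_dilate:
  fixes u :: "'n::finite functional"
  assumes "\<psi> \<in> schwartz"
  shows "smoothing_fun (\<lambda>\<xi>. \<psi> (dilate M k \<xi>)) u x =
    u (dilation_kernel (fourier_inv \<psi>) (\<chi> j. 2 powr (real k * M $ j)) x)"
  unfolding smoothing_fun_def dilation_kernel_def dilate_eq
  by (subst fourier_inv_scale[OF assms, where C = "\<chi> j. 2 powr (real k * M $ j)"])
     (simp_all add: powr_add[symmetric])

text \<open>With t = 2^k and D = t^m the factors are bounded on \<open>K\<close> by multiples of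
  t^(m au) / t^L and t^(m av). The choice L = m (au + av) + 1 cancels all growth and leaves exactly
  one factor 1/t.\<close>

lemma smoothing_product_bound:
  fixes u v :: "'n::finite functional"
  assumes M: "\<And>j. 1 \<le> M $ j" and u: "u \<in> tempered_distributions" and v: "v \<in> tempered_distributions"
    and \<psi>: "\<psi> \<in> schwartz" and \<Omega>: "open \<Omega>" and zero: "restr \<Omega> u = (\<lambda>_. 0)"
    and K: "compact K" "K \<subseteq> \<Omega>"
  shows "\<exists>B. \<forall>k. \<forall>x\<in>K. norm (smoothing_fun (\<lambda>\<xi>. \<psi> (dilate M k \<xi>)) u x *
      smoothing_fun (\<lambda>\<xi>. \<psi> (dilate M k \<xi>)) v x) \<le> B / 2 ^ k"
proof -
  define \<Phi> where "\<Phi> = fourier_inv \<psi>"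
  have \<Phi>: "\<Phi> \<in> schwartz" unfolding \<Phi>_def by (rule fourier_inv_schwartz[OF \<psi>])
  obtain R where R: "\<And>x. x \<in> K \<Longrightarrow> norm x \<le> R"
    using compact_imp_bounded[OF K(1)] unfolding bounded_iff by blast
  \<comment> \<open>The components of \<open>M\<close> are real; an integer bound for them turns the
    upper bound of the dilation factors into a natural power of 2^k.\<close>
  obtain m :: nat where m: "Max (range (\<lambda>j. M $ j)) \<le> real m"
    using real_arch_simple by blast
  then have Mm: "M $ j \<le> real m" for j
    by (intro order_trans[OF Max_ge m]) auto
  obtain Bv av where Bv: "Bv \<ge> 0" and
    v_le: "\<forall>C D x. (\<forall>j. 1 \<le> C $ j) \<and> (\<forall>j. C $ j \<le> D) \<and> norm x \<le> R \<longrightarrow>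
      norm (v (dilation_kernel \<Phi> C x)) \<le> Bv * D ^ av"
    using tempered_kernel_growth[OF v \<Phi>, of R] by (elim exE conjE)
  obtain au where "\<forall>L. \<exists>B\<ge>0. \<forall>C D t x. 1 \<le> t \<and> (\<forall>j. t \<le> C $ j) \<and> (\<forall>j. C $ j \<le> D) \<and> x \<in> K \<longrightarrow>
      norm (u (dilation_kernel \<Phi> C x)) \<le> B * D ^ au / t ^ L"
    using tempered_kernel_decay[OF u \<Phi> \<Omega> zero K] by (elim exE)
  from this[THEN spec, of "Suc (m * (au + av))"]
  obtain Bu where Bu: "Bu \<ge> 0" and
    u_le: "\<forall>C D t x. 1 \<le> t \<and> (\<forall>j. t \<le> C $ j) \<and> (\<forall>j. C $ j \<le> D) \<and> x \<in> K \<longrightarrow>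
      norm (u (dilation_kernel \<Phi> C x)) \<le> Bu * D ^ au / t ^ Suc (m * (au + av))"
    by (elim exE conjE)
  show ?thesis
  proof (intro exI[of _ "Bu * Bv"] allI ballI)
    fix k x assume x: "x \<in> K"
    define t :: real where "t = 2 ^ k"
    define C where "C = (\<chi> j. 2 powr (real k * M $ j))"
    have t1: "1 \<le> t" by (simp add: t_def)
    have tC: "t \<le> C $ j" for j
    proof -
      have "t = 2 powr (real k * 1)" by (simp add: t_def powr_realpow)
      also have "\<dots> \<le> 2 powr (real k * M $ j)"
        using M[of j] by (intro powr_mono mult_left_mono) auto
      finally show ?thesis by (simp add: C_def)
    qed
    have CD: "C $ j \<le> t ^ m" for j
    proof -
      have "C $ j \<le> 2 powr (real k * real m)"
        unfolding C_def vec_lambda_beta using Mm[of j] by (intro powr_mono mult_left_mono) auto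
      also have "\<dots> = 2 powr real (k * m)" by simp
      also have "\<dots> = t ^ m" by (simp only: t_def power_mult powr_realpow zero_less_numeral)
      finally show ?thesis .
    qed
    have C1: "1 \<le> C $ j" for j using t1 tC[of j] by linarith
    have ub: "norm (u (dilation_kernel \<Phi> C x)) \<le> Bu * (t ^ m) ^ au / t ^ Suc (m * (au + av))"
      using u_le[THEN spec[of _ C], THEN spec[of _ "t ^ m"], THEN spec[of _ t], THEN spec[of _ x]] t1 tC CD x by blast
    have vb: "norm (v (dilation_kernel \<Phi> C x)) \<le> Bv * (t ^ m) ^ av"
      using v_le[THEN spec[of _ C], THEN spec[of _ "t ^ m"], THEN spec[of _ x]] C1 CD R[OF x] by blast
    have "norm (u (dilation_kernel \<Phi> C x) * v (dilation_kernel \<Phi> C x)) \<le>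
        (Bu * (t ^ m) ^ au / t ^ Suc (m * (au + av))) * (Bv * (t ^ m) ^ av)"
      unfolding norm_mult by (rule mult_mono[OF ub vb]) (use Bu t1 in auto)
    also have "\<dots> = Bu * Bv * (t ^ (m * (au + av)) / t ^ Suc (m * (au + av)))"
      by (simp add: power_mult[symmetric] power_add distrib_left)
    also have "\<dots> = Bu * Bv / 2 ^ k"
      using t1 by (simp add: t_def)
    finally show "norm (smoothing_fun (\<lambda>\<xi>. \<psi> (dilate M k \<xi>)) u x *
        smoothing_fun (\<lambda>\<xi>. \<psi> (dilate M k \<xi>)) v x) \<le> Bu * Bv / 2 ^ k"
      by (simp only: smoothing_fun_dilate[OF \<psi>] \<Phi>_def[symmetric] C_def[symmetric])
  qed
qed

lemma approx_prod_converges_to_0: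
  fixes u v :: "'n::finite functional"
  assumes M: "weight M" and u: "u \<in> tempered_distributions" and v: "v \<in> tempered_distributions"
    and \<Omega>: "open \<Omega>" and zero: "restr \<Omega> u = (\<lambda>_. 0) \<or> restr \<Omega> v = (\<lambda>_. 0)"
    and \<psi>: "\<psi> \<in> schwartz"
  shows "converges_in_distributions \<Omega> (\<lambda>k. restr \<Omega> (approx_prod M \<psi> u v k)) (\<lambda>_. 0)"
  unfolding approx_prod_def fun_of_smoothing[OF u \<psi>] fun_of_smoothing[OF v \<psi>]
proof (rule converges_to_0_of_locally_uniform)
  show "continuous_on UNIV (\<lambda>x. smoothing_fun (\<lambda>\<xi>. \<psi> (dilate M k \<xi>)) u x *
      smoothing_fun (\<lambda>\<xi>. \<psi> (dilate M k \<xi>)) v x)" for k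
    by (intro continuous_on_mult continuous_smoothing_fun u v schwartz_dilate \<psi>)
  have M1: "1 \<le> M $ j" for j using M by (simp add: weight_def)
  fix K assume K: "compact K" "K \<subseteq> \<Omega>"
  from zero show "\<exists>B. \<forall>k. \<forall>x\<in>K. norm (smoothing_fun (\<lambda>\<xi>. \<psi> (dilate M k \<xi>)) u x *
      smoothing_fun (\<lambda>\<xi>. \<psi> (dilate M k \<xi>)) v x) \<le> B / 2 ^ k"
  proof
    assume "restr \<Omega> u = (\<lambda>_. 0)"
    from smoothing_product_bound[OF M1 u v \<psi> \<Omega> this K] show ?thesis .
  next
    assume "restr \<Omega> v = (\<lambda>_. 0)"
    from smoothing_product_bound[OF M1 v u \<psi> \<Omega> this K] show ?thesis
      by (simp only: mult.commute)
  qed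
qed

section \<open>Uniqueness of limits and the product of distributions\<close>

lemma converges_in_distributions_unique:
  assumes "converges_in_distributions \<Omega> w w1" "converges_in_distributions \<Omega> w w2"
  shows "w1 = w2"
proof
  fix \<phi>
  show "w1 \<phi> = w2 \<phi>"
  proof (cases "\<phi> \<in> test_functions \<Omega>")
    case True
    then show ?thesis
      using assms LIMSEQ_unique unfolding converges_in_distributions_def by blast
  next
    \<comment> \<open>Off the test functions both limits are 0 by the convention for functionals, so
      they agree there too.\<close>
    case False
    then show ?thesis
      using assms unfolding converges_in_distributions_def distributions_def linear_functional_on_def
      by simp
  qed
qed

text \<open>Two nested descriptions are resolved: the given cutoff pins down the common value of all
  \<open>prod_psi\<close>, and uniqueness of limits identifies that value with the limit along this
  cutoff.\<close>

lemma prod_pi_limit: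
  assumes def: "prod_defined M u v" and \<psi>: "\<psi> \<in> cutoffs"
  shows "converges_in_distributions UNIV (approx_prod M \<psi> u v) (prod_pi M u v)"
proof -
  have "prod_pi M u v = prod_psi M \<psi> u v"
    unfolding prod_pi_def
  proof (rule the_equality)
    show "\<forall>\<psi>'\<in>cutoffs. prod_psi M \<psi>' u v = prod_psi M \<psi> u v"
      using def \<psi> unfolding prod_defined_def by blast
    fix w assume "\<forall>\<psi>\<in>cutoffs. prod_psi M \<psi> u v = w"
    from bspec[OF this \<psi>] show "w = prod_psi M \<psi> u v" ..
  qed
  moreover have "prod_psi_exists M \<psi> u v"
    using def \<psi> unfolding prod_defined_def by blast
  then obtain w where w: "converges_in_distributions UNIV (approx_prod M \<psi> u v) w"
    unfolding prod_psi_exists_def by (rule exE)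
  moreover have "prod_psi M \<psi> u v = w"
    unfolding prod_psi_def
    by (rule the_equality, rule w, rule converges_in_distributions_unique[OF _ w])
  ultimately show ?thesis by simp
qed

theorem proposition3p7:
  fixes M :: "(real, 'n::finite) vec"
    and u v :: "'n functional"
    and \<Omega> :: "(real, 'n) vec set"
  assumes "weight M"
    and "u \<in> tempered_distributions" and "v \<in> tempered_distributions"
    and "open \<Omega>"
    and "restr \<Omega> u = (\<lambda>_. 0) \<or> restr \<Omega> v = (\<lambda>_. 0)"
  shows "(\<forall>\<psi>\<in>schwartz. \<psi> 0 = 1 \<longrightarrow>
            converges_in_distributions \<Omega> (\<lambda>k. restr \<Omega> (approx_prod M \<psi> u v k)) (\<lambda>_. 0))
       \<and> (prod_defined M u v \<longrightarrow> restr \<Omega> (prod_pi M u v) = (\<lambda>_. 0))"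
proof (intro conjI ballI impI)
  show "converges_in_distributions \<Omega> (\<lambda>k. restr \<Omega> (approx_prod M \<psi> u v k)) (\<lambda>_. 0)"
    if "\<psi> \<in> schwartz" for \<psi>
    by (rule approx_prod_converges_to_0[OF assms that])
next
  assume def: "prod_defined M u v"
  \<comment> \<open>Any single cutoff computes the product. Being a Schwartz function as well, it
    also makes the regularised products tend to zero on \<open>\<Omega>\<close>, and the two limits
    are compared on test functions of \<open>\<Omega>\<close>.\<close>
  obtain \<psi> :: "'n cfun" where \<psi>: "\<psi> \<in> cutoffs"
    using cutoffs_nonempty by blast
  then have "\<psi> \<in> schwartz"
    unfolding cutoffs_def using test_functions_schwartz by blast
  note conv0 = approx_prod_converges_to_0[OF assms this]
  note conv = prod_pi_limit[OF def \<psi>]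
  show "restr \<Omega> (prod_pi M u v) = (\<lambda>_. 0)"
  proof
    fix \<phi>
    show "restr \<Omega> (prod_pi M u v) \<phi> = 0"
    proof (cases "\<phi> \<in> test_functions \<Omega>")
      case True
      have "(\<lambda>k. approx_prod M \<psi> u v k \<phi>) \<longlonglongrightarrow> prod_pi M u v \<phi>"
        using conv test_functions_mono[OF True] by (simp add: converges_in_distributions_def)
      moreover have "(\<lambda>k. approx_prod M \<psi> u v k \<phi>) \<longlonglongrightarrow> 0"
        using conv0 True by (simp add: converges_in_distributions_def restr_def)
      ultimately show ?thesis
        using True LIMSEQ_unique by (simp add: restr_def)
    qed (simp add: restr_def)
  qed
qed

end
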